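(* The continuous limit of the pentagram map $T$ in dimension $d$, defined by the system $du_j(x)/dt=w_j(x)$, $j=0,\dots,d-1$, for $x\in S^1$, is the $(2,d+1)$-KdV flow of the Adler--Gelfand--Dickey hierarchy on the circle.
   Context: Continuous limit. In the limit $n\to\infty$ a generic twisted $n$-gon in $\mathbb{RP}^d$ becomes a smooth non-degenerate quasi-periodic curve $\gamma(x)$ in $\mathbb{RP}^d$. Its lift $G(x)=(G_1,\dots,G_{d+1})(x)$ to $\mathbb{R}^{d+1}$ is defined by $\gamma=(G_1:\dots:G_{d+1})$ and $\det|G(x),G'(x),\dots,G^{(d)}(x)|=1$ for all $x\in\mathbb{R}$; furthermore $G(x+2\pi)=MG(x)$ for a given $M\in SL_{d+1}$. Then $G$ satisfies $G^{(d+1)}+u_{d-1}(x)G^{(d-1)}+\dots+u_1(x)G'+u_0(x)G=0$ with periodic coefficients $u_j(x)$. For small $\epsilon>0$ consider the hyperplane $P_\epsilon(x)$ passing through the $d$ points $\gamma(x-\varkappa\epsilon),\gamma(x-(\varkappa-1)\epsilon),\dots,\gamma(x),\dots,\gamma(x+\varkappa\epsilon)$ if $d=2\varkappa+1$ is odd, and through the $d$ points $\gamma(x-(2\varkappa-1)\epsilon),\gamma(x-(2\varkappa-3)\epsilon),\dots,\gamma(x-\epsilon),\gamma(x+\epsilon),\dots,\gamma(x+(2\varkappa-1)\epsilon)$ if $d=2\varkappa$ is even. Let $\ell_\epsilon(x)$ be the envelope curve of the family $P_\epsilon(x)$ for fixed $\epsilon$, i.e. the $P_\epsilon(x)$ are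 the osculating hyperplanes of $\ell_\epsilon$. Its lift $L_\epsilon(x)$ to $\mathbb{R}^{d+1}$ (normalized by $\det|L_\epsilon,L_\epsilon',\dots,L_\epsilon^{(d)}|=1$) satisfies the $d$ equations, $j=0,\dots,d-1$: for odd $d=2\varkappa+1$, $$\det|G(x-\varkappa\epsilon),G(x-(\varkappa-1)\epsilon),\dots,G(x),\dots,G(x+\varkappa\epsilon),L_\epsilon^{(j)}(x)|=0;$$ for even $d=2\varkappa$, $$\det|G(x-(2\varkappa-1)\epsilon),G(x-(2\varkappa-3)\epsilon),\dots,G(x-\epsilon),G(x+\epsilon),\dots,G(x+(2\varkappa-1)\epsilon),L_\epsilon^{(j)}(x)|=0.$$ The expansion of $L_\epsilon$ has the form $L_\epsilon(x)=G(x)+\epsilon^2B(x)+O(\epsilon^4)$, and $L_\epsilon$ satisfies $L_\epsilon^{(d+1)}+u_{d-1,\epsilon}(x)L_\epsilon^{(d-1)}+\dots+u_{1,\epsilon}(x)L_\epsilon'+u_{0,\epsilon}(x)L_\epsilon=0$ with $u_{j,0}=u_j$. The functions $w_j$ are defined by the expansion $u_{j,\epsilon}(x)=u_j(x)+\epsilon^2w_j(x)+O(\epsilon^4)$, and the continuous limit of the pentagram map is the system of evolution equations $du_j/dt=w_j$, $j=0,\dots,d-1$. KdV flows. The $(m,d+1)$-KdV flow is defined on linear differential operators $L=\partial^{d+1}+u_{d-1}(x)\partial^{d-1}+\dots+u_1(x)\partial+u_0(x)$ with periodic coefficients ($\partial=d/dx$). For a positive integer $m$ let $Q_m=(L^{m/(d+1)})_+$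 be the purely differential part of the pseudo-differential operator $L^{m/(d+1)}$; the $(m,d+1)$-KdV equation is the evolution equation $dL/dt=[Q_m,L]$ on the coefficients of $L$. In particular $Q_2=\partial^2+\frac{2}{d+1}u_{d-1}(x)$.
   Formalization: With w_j taken literally as the ε²-coefficient, the limit equals the (2,d+1)-KdV flow only up to a positive constant rescaling of time depending on d (e.g. factor 1/2 for d=2); the formal statement asserts equality up to such a constant, for d≥2. *)

theory Defs
  imports
    "HOL-Analysis.Derivative"
    "HOL-Library.Landau_Symbols"
    "Jordan_Normal_Form.Determinant"
begin

definition smooth :: "(real \<Rightarrow> real) \<Rightarrow> bool" where
  "smooth f \<longleftrightarrow> (\<forall>n x. (deriv ^^ n) f differentiable (at x))"


section \<open>Curves and the continuous limit of the pentagram map\<close>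

text \<open>A curve in \<open>\<real>\<^bsup>d+1\<^esup>\<close> is given by its \<open>d + 1\<close> coordinate functions \<open>G 0, \<dots>, G d\<close>.
  Values \<open>G i\<close> with \<open>i > d\<close> are junk and never used; the same holds for the coefficients
  \<open>u j\<close> with \<open>j \<ge> d\<close> below.\<close>

definition wronskian :: "nat \<Rightarrow> (nat \<Rightarrow> real \<Rightarrow> real) \<Rightarrow> real \<Rightarrow> real" where
  "wronskian d G x =
     Determinant.det (Matrix.mat (d + 1) (d + 1) (\<lambda>(i, j). (deriv ^^ j) (G i) x))"

text \<open>The lift to \<open>\<real>\<^bsup>d+1\<^esup>\<close> of a smooth non-degenerate curve \<open>(G 0 : \<dots> : G d)\<close> in \<open>\<real>P\<^sup>d\<close>.\<close>

definition normalized_lift :: "nat \<Rightarrow> (nat \<Rightarrow> real \<Rightarrow> real) \<Rightarrow> bool" where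
  "normalized_lift d G \<longleftrightarrow> (\<forall>i\<le>d. smooth (G i)) \<and> (\<forall>x. wronskian d G x = 1)"

definition quasi_periodic :: "nat \<Rightarrow> real mat \<Rightarrow> (nat \<Rightarrow> real \<Rightarrow> real) \<Rightarrow> bool" where
  "quasi_periodic d M G \<longleftrightarrow>
     M \<in> carrier_mat (d + 1) (d + 1) \<and> Determinant.det M = 1 \<and>
     (\<forall>x. Matrix.vec (d + 1) (\<lambda>i. G i (x + 2 * pi)) = M *\<^sub>v Matrix.vec (d + 1) (\<lambda>i. G i x))"

text \<open>\<open>G\<^bsup>(d+1)\<^esup> + u\<^bsub>d-1\<^esub> G\<^bsup>(d-1)\<^esup> + \<dots> + u\<^sub>1 G' + u\<^sub>0 G = 0\<close>\<close>

definition satisfies_ode ::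
    "nat \<Rightarrow> (nat \<Rightarrow> real \<Rightarrow> real) \<Rightarrow> (nat \<Rightarrow> real \<Rightarrow> real) \<Rightarrow> bool" where
  "satisfies_ode d u G \<longleftrightarrow>
     (\<forall>i\<le>d. \<forall>x. (deriv ^^ (d + 1)) (G i) x + (\<Sum>j<d. u j x * (deriv ^^ j) (G i) x) = 0)"

definition periodic_coeffs :: "nat \<Rightarrow> (nat \<Rightarrow> real \<Rightarrow> real) \<Rightarrow> bool" where
  "periodic_coeffs d u \<longleftrightarrow> (\<forall>j<d. smooth (u j) \<and> (\<forall>x. u j (x + 2 * pi) = u j x))"

definition curve_with_operator ::
    "nat \<Rightarrow> real mat \<Rightarrow> (nat \<Rightarrow> real \<Rightarrow> real) \<Rightarrow> (nat \<Rightarrow> real \<Rightarrow> real) \<Rightarrow> bool" where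
  "curve_with_operator d M G u \<longleftrightarrow>
     normalized_lift d G \<and> quasi_periodic d M G \<and> periodic_coeffs d u \<and> satisfies_ode d u G"

text \<open>The hyperplane \<open>P\<^sub>\<epsilon>(x)\<close> passes through the points \<open>G(x + node d c * \<epsilon>)\<close>, \<open>c < d\<close>.  For
  \<open>d = 2\<kappa> + 1\<close> the nodes are \<open>-\<kappa>, -\<kappa>+1, \<dots>, \<kappa>\<close>; for \<open>d = 2\<kappa>\<close> they are
  \<open>-(2\<kappa>-1), -(2\<kappa>-3), \<dots>, 2\<kappa>-1\<close>.\<close>

definition node :: "nat \<Rightarrow> nat \<Rightarrow> real" where
  "node d c = (if odd d then real c - real ((d - 1) div 2) else 2 * real c - real (d - 1))"

definition hyperplane_det ::
    "nat \<Rightarrow> (nat \<Rightarrow> real \<Rightarrow> real) \<Rightarrow> real \<Rightarrow> real \<Rightarrow> (nat \<Rightarrow> real) \<Rightarrow> real" where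
  "hyperplane_det d G \<epsilon> x v =
     Determinant.det (Matrix.mat (d + 1) (d + 1)
       (\<lambda>(i, c). if c < d then G i (x + node d c * \<epsilon>) else v i))"

text \<open>\<open>L\<close> is a normalized lift of the envelope of the hyperplanes \<open>P\<^sub>\<epsilon>(x)\<close>: its osculating
  hyperplane at \<open>x\<close>, spanned by \<open>L(x), L'(x), \<dots>, L\<^bsup>(d-1)\<^esup>(x)\<close>, is \<open>P\<^sub>\<epsilon>(x)\<close>.\<close>

definition envelope_lift ::
    "nat \<Rightarrow> (nat \<Rightarrow> real \<Rightarrow> real) \<Rightarrow> real \<Rightarrow> (nat \<Rightarrow> real \<Rightarrow> real) \<Rightarrow> bool" where
  "envelope_lift d G \<epsilon> L \<longleftrightarrow> normalized_lift d L \<and>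
     (\<forall>x. \<forall>j<d. hyperplane_det d G \<epsilon> x (\<lambda>i. (deriv ^^ j) (L i) x) = 0)"

text \<open>\<open>w\<close> is the \<open>\<epsilon>\<^sup>2\<close>-term in the expansion of the coefficients of the operator annihilating the
  envelope curve \<open>L\<^sub>\<epsilon> = G + \<epsilon>\<^sup>2 B + O(\<epsilon>\<^sup>4)\<close>.  The conditions on \<open>L \<epsilon>\<close> determine it only up to
  sign when \<open>d\<close> is odd; the expansion around \<open>G\<close> fixes the sign.  The choice of nodes fixes a time
  scale: for \<open>d = 2\<close>, say, \<open>B = (G'' + 2/3 u\<^sub>1 G) / 2\<close>, so that \<open>w\<close> agrees with the KdV field only
  up to a positive factor that depends on \<open>d\<close>.\<close>

definition pentagram_limit_field ::
    "nat \<Rightarrow> (nat \<Rightarrow> real \<Rightarrow> real) \<Rightarrow> (nat \<Rightarrow> real \<Rightarrow> real) \<Rightarrow> (nat \<Rightarrow> real \<Rightarrow> real) \<Rightarrow> bool" where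
  "pentagram_limit_field d G u w \<longleftrightarrow> (\<exists>\<epsilon>\<^sub>0>0. \<exists>L U B.
     (\<forall>\<epsilon>. 0 < \<epsilon> \<and> \<epsilon> < \<epsilon>\<^sub>0 \<longrightarrow> envelope_lift d G \<epsilon> (L \<epsilon>) \<and> satisfies_ode d (U \<epsilon>) (L \<epsilon>)) \<and>
     (\<forall>i\<le>d. \<forall>x. (\<lambda>\<epsilon>. L \<epsilon> i x - (G i x + \<epsilon>\<^sup>2 * B i x)) \<in> O[at_right 0](\<lambda>\<epsilon>. \<epsilon> ^ 4)) \<and>
     (\<forall>j<d. \<forall>x. (\<lambda>\<epsilon>. U \<epsilon> j x - (u j x + \<epsilon>\<^sup>2 * w j x)) \<in> O[at_right 0](\<lambda>\<epsilon>. \<epsilon> ^ 4)))"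

text \<open>The system \<open>du\<^sub>j/dt = w\<^sub>j\<close>, \<open>j < d\<close>, for \<open>t\<close> in the interval \<open>(a, b)\<close>, where \<open>G t\<close> is a curve
  with operator coefficients \<open>u t\<close>.\<close>

definition pentagram_limit_flow ::
    "nat \<Rightarrow> real \<Rightarrow> real \<Rightarrow> (real \<Rightarrow> nat \<Rightarrow> real \<Rightarrow> real) \<Rightarrow> (real \<Rightarrow> nat \<Rightarrow> real \<Rightarrow> real) \<Rightarrow> bool" where
  "pentagram_limit_flow d a b G u \<longleftrightarrow> (\<forall>t\<in>{a<..<b}. \<exists>w.
     pentagram_limit_field d (G t) (u t) w \<and>
     (\<forall>j<d. \<forall>x. ((\<lambda>s. u s j x) has_real_derivative w j x) (at t)))"


section \<open>Pseudo-differential operators and KdV flows\<close>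

text \<open>\<open>A k\<close> is the coefficient of \<open>\<partial>\<^sup>k\<close> in the formal series \<open>A = \<Sum>\<^sub>k A\<^sub>k \<partial>\<^sup>k\<close>.\<close>

type_synonym psido = "int \<Rightarrow> real \<Rightarrow> real"

definition is_psido :: "psido \<Rightarrow> bool" where
  "is_psido A \<longleftrightarrow> (\<forall>k. smooth (A k)) \<and> (\<exists>N. \<forall>k>N. A k = (\<lambda>_. 0))"

text \<open>The product is determined by \<open>\<partial>\<^sup>i f = \<Sum>\<^sub>l (i gchoose l) f\<^bsup>(l)\<^esup> \<partial>\<^bsup>i-l\<^esup>\<close> for all integers \<open>i\<close>.
  The index set of the sum is finite as soon as both series are bounded above.\<close>

definition psido_mult :: "psido \<Rightarrow> psido \<Rightarrow> psido" where
  "psido_mult A B k x =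
     (\<Sum>(i, l) \<in> {(i :: int, l :: nat). A i \<noteq> (\<lambda>_. 0) \<and> B (k - i + int l) \<noteq> (\<lambda>_. 0)}.
        ((of_int i :: real) gchoose l) * A i x * (deriv ^^ l) (B (k - i + int l)) x)"

primrec psido_power :: "psido \<Rightarrow> nat \<Rightarrow> psido" where
  "psido_power A 0 = (\<lambda>k x. if k = 0 then 1 else 0)"
| "psido_power A (Suc n) = psido_mult A (psido_power A n)"

definition psido_commutator :: "psido \<Rightarrow> psido \<Rightarrow> psido" where
  "psido_commutator A B k x = psido_mult A B k x - psido_mult B A k x"

definition differential_part :: "psido \<Rightarrow> psido" where
  "differential_part A k = (if k \<ge> 0 then A k else (\<lambda>_. 0))"

text \<open>The root \<open>A\<^bsup>1/n\<^esup> = \<partial> + r\<^sub>0 + r\<^bsub>-1\<^esub> \<partial>\<^bsup>-1\<^esup> + \<dots>\<close> of a monic operator \<open>A\<close> of order \<open>n\<close>.\<close>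

definition psido_root :: "nat \<Rightarrow> psido \<Rightarrow> psido" where
  "psido_root n A = (THE R. is_psido R \<and> R 1 = (\<lambda>_. 1) \<and> (\<forall>k>1. R k = (\<lambda>_. 0)) \<and>
     psido_power R n = A)"

text \<open>\<open>\<partial>\<^bsup>d+1\<^esup> + u\<^bsub>d-1\<^esub> \<partial>\<^bsup>d-1\<^esup> + \<dots> + u\<^sub>1 \<partial> + u\<^sub>0\<close>\<close>

definition kdv_operator :: "nat \<Rightarrow> (nat \<Rightarrow> real \<Rightarrow> real) \<Rightarrow> psido" where
  "kdv_operator d u k =
     (if k = int d + 1 then (\<lambda>_. 1) else if 0 \<le> k \<and> k < int d then u (nat k) else (\<lambda>_. 0))"

definition kdv_Q :: "nat \<Rightarrow> nat \<Rightarrow> (nat \<Rightarrow> real \<Rightarrow> real) \<Rightarrow> psido" where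
  "kdv_Q m d u = differential_part (psido_power (psido_root (d + 1) (kdv_operator d u)) m)"

text \<open>The right-hand side \<open>[Q\<^sub>m, L]\<close> of the \<open>(m, d+1)\<close>-KdV equation.\<close>

definition kdv_field :: "nat \<Rightarrow> nat \<Rightarrow> (nat \<Rightarrow> real \<Rightarrow> real) \<Rightarrow> psido" where
  "kdv_field m d u = psido_commutator (kdv_Q m d u) (kdv_operator d u)"

text \<open>\<open>dL/dt = [Q\<^sub>m, L]\<close> for \<open>t\<close> in \<open>(a, b)\<close>, as an equality of all coefficients, including those of
  \<open>\<partial>\<^sup>k\<close> for \<open>k \<ge> d\<close> and \<open>k < 0\<close>.\<close>

definition kdv_flow ::
    "nat \<Rightarrow> nat \<Rightarrow> real \<Rightarrow> real \<Rightarrow> (real \<Rightarrow> nat \<Rightarrow> real \<Rightarrow> real) \<Rightarrow> bool" where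
  "kdv_flow m d a b u \<longleftrightarrow> (\<forall>t\<in>{a<..<b}. periodic_coeffs d (u t) \<and>
     (\<forall>k x. ((\<lambda>s. kdv_operator d (u s) k x) has_real_derivative kdv_field m d (u t) k x) (at t)))"

end

theory Submission
  imports Defs
begin

text \<open>
  The differences of \<open>G\<close> at the nodes, divided by the appropriate power of \<open>\<epsilon>\<close>, form a frame of the hyperplane
  \<open>P\<^sub>\<epsilon>\<close> that stays regular as \<open>\<epsilon> \<rightarrow> 0\<close>: by the symmetry of the nodes it is
  \<open>G\<^bsup>(m)\<^esup> + \<epsilon>\<^sup>2 \<beta>\<^sub>m G\<^bsup>(m+2)\<^esup> + O(\<epsilon>\<^sup>4)\<close>, \<open>m < d\<close>, together with all derivatives in \<open>x\<close>.
  Its cofactors give a covector curve \<open>\<ell>\<^sub>\<epsilon>\<close>, and the envelope is the curve dual to \<open>\<ell>\<^sub>\<epsilon>\<close>, normalized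
  by a power of the Wronskian of \<open>\<ell>\<^sub>\<epsilon>\<close>; quasi-periodicity makes that Wronskian nonzero for all \<open>x\<close> at once.
  The \<open>\<epsilon>\<^sup>2\<close>-terms of the incidence relations force \<open>B = C G'' + b G\<close> with \<open>C = \<beta>\<^bsub>d-2\<^esub> > 0\<close>.
  The \<open>\<epsilon>\<^sup>2\<close>-term of the equation \<open>L G = 0\<close> then reads
  \<open>\<Sum>\<^sub>j w\<^sub>j G\<^bsup>(j)\<^esup> = - L B = [C \<partial>\<^sup>2 + b, L] G\<close>.
  Its \<open>G\<^bsup>(d)\<^esup>\<close>-component gives \<open>b' = C (2/(d+1)) u'\<^bsub>d-1\<^esub>\<close>, so that \<open>C \<partial>\<^sup>2 + b\<close> is \<open>C Q\<^sub>2\<close> up to an additive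
  constant, which commutes with \<open>L\<close>.
\<close>

subsection \<open>Smooth functions\<close>

text \<open>The definition of \<open>pentagram_limit_field\<close> constrains the dependence of
  \<open>L\<close> and \<open>U\<close> on \<epsilon> only by pointwise estimates. Therefore one
  family \<open>env\<close> is built whose expansions may be differentiated in x, and an arbitrary
  envelope lift is shown to be a constant sign times \<open>env\<close>. This sign may vary with
  \<epsilon>, but the annihilating operator does not see it. Only \<open>\<beta> (d - 2)\<close>
  survives because the osculating covector of G pairs nontrivially with G^(k+2), k < d, only for k +
  2 = d: for k = d - 1 the vector is G^(d+1), which has no G^(d) component by the normalization. The
  weights of the differences are Lagrange coefficients, and \<open>\<beta> (d - 2)\<close> comes
  from the second elementary symmetric function of the nodes. As the nodes sum to 0, this gives C =
  (sum of the squared nodes) / (2 d (d - 1)), which is positive and equals 1/2 for d = 2. A field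
  that is C times the KdV field has the same flow in the time \<tau> = C t.\<close>

abbreviation Dn :: "nat \<Rightarrow> (real \<Rightarrow> real) \<Rightarrow> real \<Rightarrow> real" where
  "Dn n \<equiv> deriv ^^ n"

text \<open>Peels off the first derivative, whereas \<open>smooth\<close> peels off the last one.
  Closure under products, shifts and powers then becomes an induction on the order for all functions
  at once, because the derivative is again built by the same operations.\<close>

primrec diff_upto :: "nat \<Rightarrow> (real \<Rightarrow> real) \<Rightarrow> bool" where
  "diff_upto 0 f \<longleftrightarrow> True"
| "diff_upto (Suc n) f \<longleftrightarrow> (\<forall>x. f differentiable (at x)) \<and> diff_upto n (deriv f)"

lemma deriv_funpow_deriv: "Dn n (deriv f) = Dn (Suc n) f"
  by (simp only: funpow_Suc_right o_apply)

lemma smooth_iff_diff_upto: "smooth f \<longleftrightarrow> (\<forall>n. diff_upto n f)"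
proof -
  have "diff_upto n f \<longleftrightarrow> (\<forall>k<n. \<forall>x. Dn k f differentiable (at x))" for n
  proof (induction n arbitrary: f)
    case (Suc n)
    show ?case
      unfolding diff_upto.simps Suc.IH deriv_funpow_deriv All_less_Suc2 by simp
  qed simp
  then show ?thesis unfolding smooth_def by (metis lessI)
qed

lemma diff_upto_SucD: "diff_upto (Suc n) f \<Longrightarrow> diff_upto n f"
  by (induction n arbitrary: f) auto

lemma DERIV_imp_differentiable: "(f has_real_derivative D) (at x) \<Longrightarrow> f differentiable (at x)"
  using real_differentiable_def by blast

lemma smooth_differentiable: "smooth f \<Longrightarrow> f differentiable (at x)"
  unfolding smooth_def by (metis funpow_0)

lemma smooth_DERIV: "smooth f \<Longrightarrow> (f has_real_derivative deriv f x) (at x)"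
  using smooth_differentiable DERIV_deriv_iff_real_differentiable by blast

lemma smooth_deriv: "smooth f \<Longrightarrow> smooth (deriv f)"
  unfolding smooth_def deriv_funpow_deriv by blast

lemma smooth_funpow_deriv: "smooth f \<Longrightarrow> smooth (Dn n f)"
  by (induction n) (auto intro: smooth_deriv)

lemma smooth_continuous: "smooth f \<Longrightarrow> continuous_on S f"
  by (meson smooth_DERIV DERIV_continuous_on has_field_derivative_at_within)

lemma deriv_add_fun:
  assumes "\<forall>x. f differentiable (at x)" "\<forall>x. g differentiable (at x)"
  shows "deriv (\<lambda>x. f x + g x :: real) = (\<lambda>x. deriv f x + deriv g x)"
  using assms by (intro ext DERIV_imp_deriv DERIV_add) (auto simp: DERIV_deriv_iff_real_differentiable)

lemma deriv_mult_fun: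
  assumes "\<forall>x. f differentiable (at x)" "\<forall>x. g differentiable (at x)"
  shows "deriv (\<lambda>x. f x * g x :: real) = (\<lambda>x. deriv f x * g x + f x * deriv g x)"
proof (rule ext, rule DERIV_imp_deriv)
  fix x
  have "(f has_real_derivative deriv f x) (at x)" "(g has_real_derivative deriv g x) (at x)"
    using assms DERIV_deriv_iff_real_differentiable by blast+
  then show "((\<lambda>x. f x * g x) has_real_derivative deriv f x * g x + f x * deriv g x) (at x)"
    by (auto intro!: derivative_eq_intros)
qed

lemma deriv_const_fun [simp]: "deriv (\<lambda>_::real. c::real) = (\<lambda>_. 0)"
  by (rule ext) simp

lemma funpow_deriv_const: "Dn n (\<lambda>_::real. c::real) = (\<lambda>_. if n = 0 then c else 0)"
  by (induction n) auto

lemma smooth_const [simp]: "smooth (\<lambda>_. c)"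
  unfolding smooth_def funpow_deriv_const by simp

lemma diff_upto_add: "diff_upto n f \<Longrightarrow> diff_upto n g \<Longrightarrow> diff_upto n (\<lambda>x. f x + g x)"
  by (induction n arbitrary: f g) (auto simp: deriv_add_fun)

lemma smooth_add: "smooth f \<Longrightarrow> smooth g \<Longrightarrow> smooth (\<lambda>x. f x + g x)"
  unfolding smooth_iff_diff_upto using diff_upto_add by blast

lemma diff_upto_mult: "diff_upto n f \<Longrightarrow> diff_upto n g \<Longrightarrow> diff_upto n (\<lambda>x. f x * g x)"
proof (induction n arbitrary: f g)
  case (Suc n)
  have "diff_upto n f" "diff_upto n g" using Suc.prems diff_upto_SucD by blast+
  with Suc show ?case by (auto simp: deriv_mult_fun intro!: diff_upto_add)
qed simp

lemma smooth_mult: "smooth f \<Longrightarrow> smooth g \<Longrightarrow> smooth (\<lambda>x. f x * g x)"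
  unfolding smooth_iff_diff_upto using diff_upto_mult by blast

lemma smooth_cmult: "smooth f \<Longrightarrow> smooth (\<lambda>x. c * f x)"
  by (intro smooth_mult smooth_const)

lemma smooth_uminus: "smooth f \<Longrightarrow> smooth (\<lambda>x. - f x)"
  using smooth_cmult[of f "-1"] by simp

lemma smooth_diff: "smooth f \<Longrightarrow> smooth g \<Longrightarrow> smooth (\<lambda>x. f x - g x)"
  using smooth_add[OF _ smooth_uminus, of f g] by simp

lemma smooth_sum: "(\<And>i. i \<in> I \<Longrightarrow> smooth (f i)) \<Longrightarrow> smooth (\<lambda>x. \<Sum>i\<in>I. f i x)"
  by (induction I rule: infinite_finite_induct) (auto intro: smooth_add)

lemma smooth_prod: "(\<And>i. i \<in> I \<Longrightarrow> smooth (f i)) \<Longrightarrow> smooth (\<lambda>x. \<Prod>i\<in>I. f i x)"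
  by (induction I rule: infinite_finite_induct) (auto intro: smooth_mult)

lemma DERIV_shift_fun:
  assumes "\<forall>x. f differentiable (at x)"
  shows "((\<lambda>x. f (x + h)) has_real_derivative deriv f (x + h)) (at x)"
  using assms DERIV_shift DERIV_deriv_iff_real_differentiable by blast

lemma deriv_shift_fun:
  assumes "\<forall>x. f differentiable (at x)"
  shows "deriv (\<lambda>x. f (x + h) :: real) = (\<lambda>x. deriv f (x + h))"
  using DERIV_shift_fun[OF assms] DERIV_imp_deriv by blast

lemma smooth_shift: 
  assumes "smooth f" shows "smooth (\<lambda>x. f (x + h))"
proof -
  have "diff_upto n f \<Longrightarrow> diff_upto n (\<lambda>x. f (x + h))" for n
  proof (induction n arbitrary: f)
    case (Suc n)
    then show ?case
      by (auto simp: deriv_shift_fun intro: DERIV_imp_differentiable[OF DERIV_shift_fun])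
  qed simp
  then show ?thesis using assms unfolding smooth_iff_diff_upto by blast
qed

lemma DERIV_powr_fun:
  assumes "\<forall>x. f differentiable (at x)" "\<forall>x. (f x::real) > 0"
  shows "((\<lambda>x. f x powr q) has_real_derivative q * (deriv f x * f x powr (q - 1))) (at x)"
  using assms DERIV_deriv_iff_real_differentiable
  by (auto intro!: derivative_eq_intros simp: powr_diff field_simps)

lemma deriv_powr_fun:
  assumes "\<forall>x. f differentiable (at x)" "\<forall>x. (f x::real) > 0"
  shows "deriv (\<lambda>x. f x powr q) = (\<lambda>x. q * (deriv f x * f x powr (q - 1)))"
  using DERIV_powr_fun[OF assms] DERIV_imp_deriv by blast

lemma smooth_powr:
  assumes "smooth f" "\<forall>x. f x > 0" shows "smooth (\<lambda>x. f x powr q)"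
proof -
  have "diff_upto n f \<Longrightarrow> diff_upto n (\<lambda>x. f x powr q)" if "\<forall>x. f x > 0" for n
  proof (induction n arbitrary: q)
    case (Suc n)
    have "diff_upto n f" using Suc diff_upto_SucD by blast
    moreover have "\<forall>x. (\<lambda>x. f x powr q) differentiable (at x)"
      using Suc.prems that by (auto intro!: DERIV_imp_differentiable[OF DERIV_powr_fun])
    moreover have "diff_upto n (\<lambda>_. q)" using smooth_const smooth_iff_diff_upto by blast
    ultimately show ?case
      using Suc that by (auto simp: deriv_powr_fun intro!: diff_upto_mult)
  qed simp
  then show ?thesis using assms unfolding smooth_iff_diff_upto by blast
qed

lemma deriv_add: "smooth f \<Longrightarrow> smooth g \<Longrightarrow> deriv (\<lambda>x. f x + g x) = (\<lambda>x. deriv f x + deriv g x)"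
  using smooth_differentiable deriv_add_fun by blast

lemma deriv_mult: "smooth f \<Longrightarrow> smooth g \<Longrightarrow> deriv (\<lambda>x. f x * g x) = (\<lambda>x. deriv f x * g x + f x * deriv g x)"
  using smooth_differentiable deriv_mult_fun by blast

lemma funpow_deriv_add: "smooth f \<Longrightarrow> smooth g \<Longrightarrow>
    Dn n (\<lambda>x. f x + g x) = (\<lambda>x. Dn n f x + Dn n g x)"
  by (induction n) (auto simp: deriv_add smooth_funpow_deriv)

lemma funpow_deriv_cmult: "smooth f \<Longrightarrow> Dn n (\<lambda>x. c * f x) = (\<lambda>x. c * Dn n f x)"
  by (induction n) (auto simp: deriv_mult smooth_funpow_deriv)

lemma funpow_deriv_diff:
  assumes "smooth f" "smooth g"
  shows "Dn n (\<lambda>x. f x - g x) = (\<lambda>x. Dn n f x - Dn n g x)"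
  using funpow_deriv_add[OF assms(1) smooth_cmult[OF assms(2)], of n "-1"]
    funpow_deriv_cmult[OF assms(2), of n "-1"] by simp

lemma funpow_deriv_sum:
  assumes "\<And>i. i \<in> I \<Longrightarrow> smooth (f i)"
  shows "Dn n (\<lambda>x. \<Sum>i\<in>I. f i x) = (\<lambda>x. \<Sum>i\<in>I. Dn n (f i) x)"
  using assms by (induction I rule: infinite_finite_induct)
    (auto simp: funpow_deriv_add smooth_sum funpow_deriv_const)

lemma funpow_deriv_shift: "smooth f \<Longrightarrow> Dn n (\<lambda>x. f (x + h)) = (\<lambda>x. Dn n f (x + h))"
  by (induction n) (auto simp: deriv_shift_fun smooth_differentiable smooth_funpow_deriv)

lemma funpow_deriv_mult:
  assumes "smooth f" "smooth g"
  shows "Dn n (\<lambda>x. f x * g x) x =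
    (\<Sum>l\<le>n. real (n choose l) * Dn l f x * Dn (n - l) g x)"
  using assms
proof (induction n arbitrary: f g)
  case (Suc n)
  have "Dn (Suc n) (\<lambda>x. f x * g x) x =
     Dn n (\<lambda>x. deriv f x * g x) x + Dn n (\<lambda>x. f x * deriv g x) x"
    using Suc.prems by (simp add: funpow_Suc_right deriv_mult funpow_deriv_add smooth_mult smooth_deriv del: funpow.simps)
  also have "\<dots> = (\<Sum>l\<le>n. real (n choose l) * Dn (Suc l) f x * Dn (n - l) g x)
      + (\<Sum>l\<le>n. real (n choose l) * Dn l f x * Dn (Suc (n - l)) g x)"
    using Suc.prems by (simp add: Suc.IH smooth_deriv deriv_funpow_deriv del: funpow.simps)
  also have "(\<Sum>l\<le>n. real (n choose l) * Dn (Suc l) f x * Dn (n - l) g x)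
     = (\<Sum>l\<in>{1..Suc n}. real (n choose (l - 1)) * Dn l f x * Dn (Suc n - l) g x)"
    by (rule sum.reindex_bij_witness[of _ "\<lambda>l. l - 1" Suc]) auto
  also have "\<dots> = (\<Sum>l\<le>Suc n. (if l = 0 then 0 else real (n choose (l - 1))) * Dn l f x * Dn (Suc n - l) g x)"
    by (rule sum.mono_neutral_cong_left) auto
  also have "(\<Sum>l\<le>n. real (n choose l) * Dn l f x * Dn (Suc (n - l)) g x)
     = (\<Sum>l\<le>Suc n. real (n choose l) * Dn l f x * Dn (Suc n - l) g x)"
    by (rule sum.mono_neutral_cong_left) (auto simp: Suc_diff_le binomial_eq_0)
  also have "(\<Sum>l\<le>Suc n. (if l = 0 then 0 else real (n choose (l - 1))) * Dn l f x * Dn (Suc n - l) g x) + \<dots>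
    = (\<Sum>l\<le>Suc n. real (Suc n choose l) * Dn l f x * Dn (Suc n - l) g x)"
    unfolding sum.distrib[symmetric]
  proof (rule sum.cong[OF refl])
    fix l show "(if l = 0 then 0 else real (n choose (l - 1))) * Dn l f x * Dn (Suc n - l) g x
       + real (n choose l) * Dn l f x * Dn (Suc n - l) g x
       = real (Suc n choose l) * Dn l f x * Dn (Suc n - l) g x"
      by (cases l) (auto simp: algebra_simps simp del: funpow.simps)
  qed
  finally show ?case .
qed simp

subsection \<open>Expansions modulo fourth powers\<close>

text \<open>Uniform in x on each compact set, with a threshold for h that may depend on the set.
  Uniformity over a whole period is what later yields positivity of a Wronskian at all x for one
  common range of \<epsilon>.\<close>

definition bigO_pow :: "nat \<Rightarrow> (real \<Rightarrow> real \<Rightarrow> real) \<Rightarrow> bool" where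
  "bigO_pow p f \<longleftrightarrow> (\<forall>S. compact S \<longrightarrow> (\<exists>K. \<forall>\<^sub>F h in at_right 0. \<forall>x\<in>S. \<bar>f h x\<bar> \<le> K * h ^ p))"

lemma eventually_pos_le_1: "\<forall>\<^sub>F h::real in at_right 0. 0 < h \<and> h \<le> 1"
  unfolding eventually_at_right_field by (rule exI[of _ 1]) auto

lemma bigO_pow_cong:
  assumes "bigO_pow p f" "\<forall>\<^sub>F h in at_right 0. \<forall>x. f h x = g h x"
  shows "bigO_pow p g"
  unfolding bigO_pow_def
proof (intro allI impI)
  fix S :: "real set" assume "compact S"
  then obtain K where "\<forall>\<^sub>F h in at_right 0. \<forall>x\<in>S. \<bar>f h x\<bar> \<le> K * h ^ p"
    using assms(1) unfolding bigO_pow_def by blast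
  with assms(2) have "\<forall>\<^sub>F h in at_right 0. \<forall>x\<in>S. \<bar>g h x\<bar> \<le> K * h ^ p"
    by eventually_elim auto
  then show "\<exists>K. \<forall>\<^sub>F h in at_right 0. \<forall>x\<in>S. \<bar>g h x\<bar> \<le> K * h ^ p" ..
qed

lemma bigO_pow_add:
  assumes "bigO_pow p f" "bigO_pow p g" shows "bigO_pow p (\<lambda>h x. f h x + g h x)"
  unfolding bigO_pow_def
proof (intro allI impI)
  fix S :: "real set" assume "compact S"
  then obtain K K' where "\<forall>\<^sub>F h in at_right 0. \<forall>x\<in>S. \<bar>f h x\<bar> \<le> K * h ^ p"
     "\<forall>\<^sub>F h in at_right 0. \<forall>x\<in>S. \<bar>g h x\<bar> \<le> K' * h ^ p"
    using assms unfolding bigO_pow_def by meson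
  then have "\<forall>\<^sub>F h in at_right 0. \<forall>x\<in>S. \<bar>f h x + g h x\<bar> \<le> (K + K') * h ^ p"
  proof eventually_elim
    case (elim h)
    show ?case
    proof
      fix x assume "x \<in> S"
      with elim have "\<bar>f h x\<bar> \<le> K * h ^ p" "\<bar>g h x\<bar> \<le> K' * h ^ p" by auto
      then show "\<bar>f h x + g h x\<bar> \<le> (K + K') * h ^ p" by (simp add: distrib_right)
    qed
  qed
  then show "\<exists>K. \<forall>\<^sub>F h in at_right 0. \<forall>x\<in>S. \<bar>f h x + g h x\<bar> \<le> K * h ^ p" ..
qed

lemma bigO_pow_mult:
  assumes "bigO_pow p f" "bigO_pow q g" shows "bigO_pow (p + q) (\<lambda>h x. f h x * g h x)"
  unfolding bigO_pow_def
proof (intro allI impI)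
  fix S :: "real set" assume "compact S"
  then obtain K K' where "\<forall>\<^sub>F h in at_right 0. \<forall>x\<in>S. \<bar>f h x\<bar> \<le> K * h ^ p"
     "\<forall>\<^sub>F h in at_right 0. \<forall>x\<in>S. \<bar>g h x\<bar> \<le> K' * h ^ q"
    using assms unfolding bigO_pow_def by meson
  then have "\<forall>\<^sub>F h in at_right 0. \<forall>x\<in>S. \<bar>f h x * g h x\<bar> \<le> (K * K') * h ^ (p + q)"
  proof eventually_elim
    case (elim h)
    show ?case
    proof
      fix x assume x: "x \<in> S"
      have "\<bar>f h x\<bar> * \<bar>g h x\<bar> \<le> (K * h ^ p) * (K' * h ^ q)"
        using elim x by (intro mult_mono) (auto intro: order_trans[OF abs_ge_zero])
      then show "\<bar>f h x * g h x\<bar> \<le> (K * K') * h ^ (p + q)"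
        by (simp add: abs_mult power_add mult_ac)
    qed
  qed
  then show "\<exists>K. \<forall>\<^sub>F h in at_right 0. \<forall>x\<in>S. \<bar>f h x * g h x\<bar> \<le> K * h ^ (p + q)" ..
qed

lemma bigO_pow_const:
  assumes "smooth a" shows "bigO_pow 0 (\<lambda>h. a)"
  unfolding bigO_pow_def
proof (intro allI impI)
  fix S :: "real set" assume "compact S"
  then have "bounded (a ` S)"
    using smooth_continuous[OF assms] compact_continuous_image compact_imp_bounded by blast
  then obtain K where "\<forall>x\<in>S. \<bar>a x\<bar> \<le> K" by (auto simp: bounded_iff)
  then show "\<exists>K. \<forall>\<^sub>F h::real in at_right 0. \<forall>x\<in>S. \<bar>a x\<bar> \<le> K * h ^ 0" by auto
qed

lemma bigO_pow_power: "bigO_pow p (\<lambda>h x. h ^ p)"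
  unfolding bigO_pow_def
proof (intro allI impI)
  fix S :: "real set"
  have "\<forall>\<^sub>F h::real in at_right 0. \<forall>x\<in>S. \<bar>h ^ p\<bar> \<le> 1 * h ^ p"
    using eventually_pos_le_1 by eventually_elim auto
  then show "\<exists>K. \<forall>\<^sub>F h::real in at_right 0. \<forall>x\<in>S. \<bar>h ^ p\<bar> \<le> K * h ^ p" ..
qed

lemma bigO_pow_mono:
  assumes "bigO_pow p f" "q \<le> p" shows "bigO_pow q f"
  unfolding bigO_pow_def
proof (intro allI impI)
  fix S :: "real set" assume "compact S"
  then obtain K where "\<forall>\<^sub>F h in at_right 0. \<forall>x\<in>S. \<bar>f h x\<bar> \<le> K * h ^ p"
    using assms(1) unfolding bigO_pow_def by blast
  then have "\<forall>\<^sub>F h in at_right 0. \<forall>x\<in>S. \<bar>f h x\<bar> \<le> \<bar>K\<bar> * h ^ q"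
    using eventually_pos_le_1
  proof eventually_elim
    case (elim h)
    have "K * h ^ p \<le> \<bar>K\<bar> * h ^ q"
      using elim assms(2) by (intro mult_mono power_decreasing) auto
    then show ?case using elim by force
  qed
  then show "\<exists>K. \<forall>\<^sub>F h in at_right 0. \<forall>x\<in>S. \<bar>f h x\<bar> \<le> K * h ^ q" ..
qed

lemma bigO_pow_cmult: "bigO_pow p f \<Longrightarrow> bigO_pow p (\<lambda>h x. c * f h x)"
  using bigO_pow_mult[OF bigO_pow_const[of "\<lambda>_. c"], of p f] by simp

lemma bigO_pow_monom: "smooth c \<Longrightarrow> bigO_pow p (\<lambda>h x. h ^ p * c x)"
  using bigO_pow_mult[OF bigO_pow_power bigO_pow_const[of c], of p] by simp

lemma bigO_pow_zero: "bigO_pow p (\<lambda>h x. 0)"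
  using bigO_pow_cmult[OF bigO_pow_power[of p], of 0] by simp

lemma bigO_pow_sum: "(\<And>i. i \<in> I \<Longrightarrow> bigO_pow p (f i)) \<Longrightarrow> bigO_pow p (\<lambda>h x. \<Sum>i\<in>I. f i h x)"
  by (induction I rule: infinite_finite_induct) (auto intro: bigO_pow_add bigO_pow_zero)

lemma bigO_pow_at:
  assumes "bigO_pow p f" shows "(\<lambda>h. f h x) \<in> O[at_right 0](\<lambda>h. h ^ p)"
proof -
  from assms have "compact {x} \<longrightarrow> (\<exists>K. \<forall>\<^sub>F h in at_right 0. \<forall>y\<in>{x}. \<bar>f h y\<bar> \<le> K * h ^ p)"
    unfolding bigO_pow_def by (rule spec)
  then obtain K where "\<forall>\<^sub>F h in at_right 0. \<forall>y\<in>{x}. \<bar>f h y\<bar> \<le> K * h ^ p"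
    by (auto simp only: compact_sing)
  then have "\<forall>\<^sub>F h in at_right 0. norm (f h x) \<le> K * norm (h ^ p)"
    using eventually_pos_le_1
  proof eventually_elim
    case (elim h)
    then have "\<bar>f h x\<bar> \<le> K * h ^ p" "\<bar>h ^ p\<bar> = h ^ p" by auto
    then show ?case by (simp only: real_norm_def)
  qed
  from bigoI[OF this] show ?thesis .
qed

text \<open>A pointwise expansion need not survive differentiation in x, while Wronskians and
  operator coefficients involve derivatives up to order d + 1; so the estimate is built in for every
  derivative. Smoothness is asked only for small h because the normalizing power in
  \<open>env\<close> is smooth only once its base is positive.\<close>

definition expansion :: "(real \<Rightarrow> real \<Rightarrow> real) \<Rightarrow> (real \<Rightarrow> real) \<Rightarrow> (real \<Rightarrow> real) \<Rightarrow> bool" where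
  "expansion f a b \<longleftrightarrow> smooth a \<and> smooth b \<and> (\<forall>\<^sub>F h in at_right 0. smooth (f h)) \<and>
     (\<forall>k. bigO_pow 4 (\<lambda>h x. Dn k (f h) x - (Dn k a x + h\<^sup>2 * Dn k b x)))"

lemma expansion_funpow_value:
  assumes "expansion f a b"
  shows "bigO_pow 4 (\<lambda>h x. Dn k (f h) x - (Dn k a x + h\<^sup>2 * Dn k b x))"
proof -
  have "\<forall>k. bigO_pow 4 (\<lambda>h x. Dn k (f h) x - (Dn k a x + h\<^sup>2 * Dn k b x))"
    using assms unfolding expansion_def by (elim conjE)
  then show ?thesis by (rule spec)
qed

lemma expansionD:
  assumes "expansion f a b"
  shows "smooth a" "smooth b" "\<forall>\<^sub>F h in at_right 0. smooth (f h)"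
    "bigO_pow 4 (\<lambda>h x. f h x - (a x + h\<^sup>2 * b x))"
  using assms expansion_funpow_value[OF assms, of 0] by (simp_all add: expansion_def)

lemma expansionI:
  assumes "smooth a" "smooth b" "\<forall>\<^sub>F h in at_right 0. smooth (f h)"
    "\<And>k. bigO_pow 4 (\<lambda>h x. Dn k (f h) x - (Dn k a x + h\<^sup>2 * Dn k b x))"
  shows "expansion f a b"
  unfolding expansion_def by (intro conjI allI assms)

lemma expansion_deriv: "expansion f a b \<Longrightarrow> expansion (\<lambda>h. deriv (f h)) (deriv a) (deriv b)"
  unfolding expansion_def deriv_funpow_deriv
  by (auto intro: smooth_deriv eventually_mono[of "\<lambda>h. smooth (f h)"] simp del: funpow.simps)

lemma expansion_funpow_deriv:
  "expansion f a b \<Longrightarrow> expansion (\<lambda>h. Dn n (f h)) (Dn n a) (Dn n b)"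
  by (induction n) (auto dest: expansion_deriv)

lemma expansion_const: "smooth a \<Longrightarrow> expansion (\<lambda>_. a) a (\<lambda>_. 0)"
  unfolding expansion_def by (auto simp: funpow_deriv_const intro: bigO_pow_zero)

lemma expansion_add:
  assumes "expansion f a b" "expansion g c d"
  shows "expansion (\<lambda>h x. f h x + g h x) (\<lambda>x. a x + c x) (\<lambda>x. b x + d x)"
proof -
  have ev: "\<forall>\<^sub>F h in at_right 0. smooth (f h) \<and> smooth (g h)"
    using expansionD(3)[OF assms(1)] expansionD(3)[OF assms(2)] by eventually_elim auto
  have sm: "smooth a" "smooth b" "smooth c" "smooth d"
    using expansionD(1,2)[OF assms(1)] expansionD(1,2)[OF assms(2)] by blast+
  have "bigO_pow 4 (\<lambda>h x. Dn k (\<lambda>x. f h x + g h x) x -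
     (Dn k (\<lambda>x. a x + c x) x + h\<^sup>2 * Dn k (\<lambda>x. b x + d x) x))" for k
  proof (rule bigO_pow_cong)
    show "bigO_pow 4 (\<lambda>h x. (Dn k (f h) x - (Dn k a x + h\<^sup>2 * Dn k b x)) +
      (Dn k (g h) x - (Dn k c x + h\<^sup>2 * Dn k d x)))"
      by (rule bigO_pow_add[OF expansion_funpow_value[OF assms(1)] expansion_funpow_value[OF assms(2)]])
    show "\<forall>\<^sub>F h in at_right 0. \<forall>x. (Dn k (f h) x - (Dn k a x + h\<^sup>2 * Dn k b x)) +
      (Dn k (g h) x - (Dn k c x + h\<^sup>2 * Dn k d x)) =
      Dn k (\<lambda>x. f h x + g h x) x -
     (Dn k (\<lambda>x. a x + c x) x + h\<^sup>2 * Dn k (\<lambda>x. b x + d x) x)"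
      using ev
    proof eventually_elim
      case (elim h)
      then have "smooth (f h)" "smooth (g h)" by auto
      then show ?case
        by (simp only: funpow_deriv_add[OF sm(1,3)] funpow_deriv_add[OF sm(2,4)] funpow_deriv_add)
          (simp add: distrib_left)
    qed
  qed
  moreover have "\<forall>\<^sub>F h in at_right 0. smooth (\<lambda>x. f h x + g h x)"
    using ev by eventually_elim (auto intro: smooth_add)
  ultimately show ?thesis by (intro expansionI smooth_add sm)
qed

lemma bigO_pow_two_terms:
  assumes "smooth a" "smooth b" shows "bigO_pow 0 (\<lambda>h x. a x + h\<^sup>2 * b x)"
  by (rule bigO_pow_add[OF bigO_pow_const[OF assms(1)] bigO_pow_mono[OF bigO_pow_monom[OF assms(2)]]]) simp

lemma expansion_bounded:
  assumes "expansion f a b" shows "bigO_pow 0 f"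
  using bigO_pow_add[OF bigO_pow_mono[OF expansionD(4)[OF assms], of 0]
      bigO_pow_two_terms[OF expansionD(1,2)[OF assms]]] by simp

text \<open>With f0 and g0 the two-term approximations, f g - f0 g0 = (f - f0) g + f0 (g - g0),
  where one factor of each product is bounded and the other has order 4. The only term of f0 g0
  beyond the claimed ones is h^4 b d.\<close>

lemma expansion_mult_value:
  assumes "expansion f a b" "expansion g c d"
  shows "bigO_pow 4 (\<lambda>h x. f h x * g h x - (a x * c x + h\<^sup>2 * (a x * d x + b x * c x)))"
proof -
  note f = expansionD[OF assms(1)] and g = expansionD[OF assms(2)]
  have "bigO_pow (4 + 0) (\<lambda>h x. (f h x - (a x + h\<^sup>2 * b x)) * g h x)"
    by (rule bigO_pow_mult[OF f(4) expansion_bounded[OF assms(2)]])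
  moreover have "bigO_pow (0 + 4) (\<lambda>h x. (a x + h\<^sup>2 * b x) * (g h x - (c x + h\<^sup>2 * d x)))"
    by (rule bigO_pow_mult[OF bigO_pow_two_terms[OF f(1,2)] g(4)])
  moreover have "bigO_pow 4 (\<lambda>h x. h ^ 4 * (b x * d x))"
    using f g by (intro bigO_pow_monom smooth_mult)
  ultimately have "bigO_pow 4 (\<lambda>h x. (f h x - (a x + h\<^sup>2 * b x)) * g h x +
     (a x + h\<^sup>2 * b x) * (g h x - (c x + h\<^sup>2 * d x)) + h ^ 4 * (b x * d x))"
    by (intro bigO_pow_add) auto
  then show ?thesis
    by (rule bigO_pow_cong) (simp add: algebra_simps power2_eq_square power4_eq_xxxx)
qed

text \<open>Since (f g)' = f' g + f g' is a sum of two products of expansions, the induction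
  hypothesis applied to each gives the next derivative; the full Leibniz formula is avoided.\<close>

lemma expansion_mult:
  assumes "expansion f a b" "expansion g c d"
  shows "expansion (\<lambda>h x. f h x * g h x) (\<lambda>x. a x * c x) (\<lambda>x. a x * d x + b x * c x)"
proof -
  have "bigO_pow 4 (\<lambda>h x. Dn k (\<lambda>x. f h x * g h x) x -
     (Dn k (\<lambda>x. a x * c x) x + h\<^sup>2 * Dn k (\<lambda>x. a x * d x + b x * c x) x))" for k
    using assms
  proof (induction k arbitrary: f a b g c d)
    case 0
    then show ?case using expansion_mult_value by simp
  next
    case (Suc k)
    have ev: "\<forall>\<^sub>F h in at_right 0. smooth (f h) \<and> smooth (g h)"
      using expansionD(3)[OF Suc.prems(1)] expansionD(3)[OF Suc.prems(2)] by eventually_elim auto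
    have sm: "smooth a" "smooth b" "smooth c" "smooth d"
      using expansionD(1,2)[OF Suc.prems(1)] expansionD(1,2)[OF Suc.prems(2)] by blast+
    show ?case
    proof (rule bigO_pow_cong[OF bigO_pow_add[OF
            Suc.IH[OF expansion_deriv[OF Suc.prems(1)] Suc.prems(2)]
            Suc.IH[OF Suc.prems(1) expansion_deriv[OF Suc.prems(2)]]]])
      show "\<forall>\<^sub>F h in at_right 0. \<forall>x.
        Dn k (\<lambda>x. deriv (f h) x * g h x) x -
           (Dn k (\<lambda>x. deriv a x * c x) x +
            h\<^sup>2 * Dn k (\<lambda>x. deriv a x * d x + deriv b x * c x) x) +
           (Dn k (\<lambda>x. f h x * deriv (g h) x) x -
            (Dn k (\<lambda>x. a x * deriv c x) x +
             h\<^sup>2 * Dn k (\<lambda>x. a x * deriv d x + b x * deriv c x) x)) =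
        Dn (Suc k) (\<lambda>x. f h x * g h x) x -
           (Dn (Suc k) (\<lambda>x. a x * c x) x +
            h\<^sup>2 * Dn (Suc k) (\<lambda>x. a x * d x + b x * c x) x)"
        using ev by eventually_elim (use sm in \<open>simp add: funpow_Suc_right deriv_mult deriv_add
            funpow_deriv_add smooth_mult smooth_add smooth_deriv algebra_simps del: funpow.simps\<close>)
    qed
  qed
  moreover have "\<forall>\<^sub>F h in at_right 0. smooth (\<lambda>x. f h x * g h x)"
    using expansionD(3)[OF assms(1)] expansionD(3)[OF assms(2)] by eventually_elim (rule smooth_mult)
  ultimately show ?thesis
    by (intro expansionI smooth_add smooth_mult expansionD[OF assms(1)] expansionD[OF assms(2)])
qed

lemma expansion_cmult:
  assumes "expansion f a b"
  shows "expansion (\<lambda>h x. c * f h x) (\<lambda>x. c * a x) (\<lambda>x. c * b x)"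
  using expansion_mult[OF expansion_const[of "\<lambda>_. c"] assms] by simp

lemma expansion_sum:
  assumes "\<And>i. i \<in> I \<Longrightarrow> expansion (f i) (a i) (b i)"
  shows "expansion (\<lambda>h x. \<Sum>i\<in>I. f i h x) (\<lambda>x. \<Sum>i\<in>I. a i x) (\<lambda>x. \<Sum>i\<in>I. b i x)"
  using assms
proof (induction I rule: infinite_finite_induct)
  case (insert i I)
  then show ?case
    using expansion_add[of "f i" "a i" "b i" "\<lambda>h x. \<Sum>i\<in>I. f i h x"] by simp
qed (use expansion_const[of "\<lambda>_. 0"] in simp_all)

text \<open>For determinants only the leading term is tracked. Their second order terms are merely
  known to exist; the ones that matter are computed later from identities that hold exactly in
  \<epsilon>.\<close>

lemma expansion_prod_ex:
  assumes "\<And>i. i \<in> I \<Longrightarrow> \<exists>b. expansion (f i) (a i) b"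
  shows "\<exists>b. expansion (\<lambda>h x. \<Prod>i\<in>I. f i h x) (\<lambda>x. \<Prod>i\<in>I. a i x) b"
  using assms
proof (induction I rule: infinite_finite_induct)
  case (insert i I)
  obtain b b' where "expansion (f i) (a i) b"
    "expansion (\<lambda>h x. \<Prod>i\<in>I. f i h x) (\<lambda>x. \<Prod>i\<in>I. a i x) b'"
    using insert.IH insert.prems by (meson insertCI)
  from expansion_mult[OF this] show ?case using insert.hyps by auto
qed (use expansion_const[of "\<lambda>_. 1"] in \<open>simp_all, blast+\<close>)

lemma expansion_sum_ex:
  assumes "\<And>i. i \<in> I \<Longrightarrow> \<exists>b. expansion (f i) (a i) b"
  shows "\<exists>b. expansion (\<lambda>h x. \<Sum>i\<in>I. f i h x) (\<lambda>x. \<Sum>i\<in>I. a i x) b"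
proof -
  have "\<forall>i\<in>I. \<exists>b. expansion (f i) (a i) b" by (rule ballI) (rule assms)
  from bchoice[OF this] obtain b where "\<forall>i\<in>I. expansion (f i) (a i) (b i)" ..
  then show ?thesis by (intro exI[of _ "\<lambda>x. \<Sum>i\<in>I. b i x"] expansion_sum) (erule bspec)
qed

lemma bigO_power4_imp_zero:
  fixes u v :: real
  assumes "(\<lambda>h. u + h\<^sup>2 * v) \<in> O[at_right 0](\<lambda>h. h ^ 4)"
  shows "u = 0" "v = 0"
proof -
  have p4: "((\<lambda>h::real. h ^ 4) \<longlongrightarrow> 0) (at_right 0)" "((\<lambda>h::real. h\<^sup>2) \<longlongrightarrow> 0) (at_right 0)"
    by (auto intro!: tendsto_eq_intros)
  obtain K where K: "\<forall>\<^sub>F h in at_right 0. \<bar>u + h\<^sup>2 * v\<bar> \<le> K * h ^ 4"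
    using landau_o.bigE[OF assms] by auto
  have "((\<lambda>h. u + h\<^sup>2 * v) \<longlongrightarrow> 0) (at_right 0)"
    by (rule tendsto_rabs_zero_cancel, rule tendsto_sandwich[of "\<lambda>_. 0" _ _ "\<lambda>h. K * h ^ 4"])
      (use K p4(1) in \<open>auto intro: tendsto_mult_right_zero\<close>)
  moreover have "((\<lambda>h. u + h\<^sup>2 * v) \<longlongrightarrow> u + 0 * v) (at_right 0)"
    by (intro tendsto_intros p4)
  ultimately show u: "u = 0"
    using tendsto_unique[OF trivial_limit_at_right_real] by force
  have "\<forall>\<^sub>F h in at_right 0. \<bar>v\<bar> \<le> K * h\<^sup>2"
    using K eventually_pos_le_1
  proof eventually_elim
    case (elim h)
    then have "h\<^sup>2 * \<bar>v\<bar> \<le> h\<^sup>2 * (K * h\<^sup>2)"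
      by (simp add: u abs_mult power2_eq_square power4_eq_xxxx mult_ac)
    then show ?case using elim by (simp add: mult_le_cancel_left_pos)
  qed
  moreover have "((\<lambda>h. K * h\<^sup>2) \<longlongrightarrow> 0) (at_right 0)"
    using p4 by (intro tendsto_mult_right_zero)
  ultimately have "\<bar>v\<bar> \<le> 0"
    by (intro tendsto_le[OF _ _ tendsto_const[of "\<bar>v\<bar>" "at_right 0"]]) auto
  then show "v = 0" by simp
qed

text \<open>The tool for comparing coefficients: it turns each exact identity at small h, be it an
  incidence or a differential equation, into a relation between second order terms.\<close>

lemma expansion_unique:
  assumes "expansion f a b" "\<forall>\<^sub>F h in at_right 0. f h x = 0"
  shows "a x = 0" "b x = 0"
proof -
  have "(\<lambda>h. f h x - (a x + h\<^sup>2 * b x)) \<in> O[at_right 0](\<lambda>h. h ^ 4)"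
    using bigO_pow_at[OF expansionD(4)[OF assms(1)]] .
  also have "?this \<longleftrightarrow> (\<lambda>h. - (a x + h\<^sup>2 * b x)) \<in> O[at_right 0](\<lambda>h. h ^ 4)"
    by (rule landau_o.big.in_cong) (rule eventually_mono[OF assms(2)], simp)
  finally have "(\<lambda>h. a x + h\<^sup>2 * b x) \<in> O[at_right 0](\<lambda>h. h ^ 4)"
    by (simp only: landau_o.big.uminus_in_iff)
  then show "a x = 0" "b x = 0" using bigO_power4_imp_zero by blast+
qed

section \<open>Real powers of expansions with leading term 1\<close>

lemma powr_quadratic_bound:
  "\<exists>K. \<forall>y::real. \<bar>y\<bar> \<le> 1/2 \<longrightarrow> \<bar>(1 + y) powr q - 1 - q * y\<bar> \<le> K * y\<^sup>2"
proof -
  \<comment> \<open>For |t| \<le> 1/2 the base 1 + t stays in [1/2, 3/2], where the second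
    derivative of the power is bounded for every real exponent.\<close>
  have "continuous_on {-1/2..1/2} (\<lambda>t::real. q * (q - 1) * (1 + t) powr (q - 2) / 2)"
    by (intro continuous_intros) auto
  then have "bounded ((\<lambda>t::real. q * (q - 1) * (1 + t) powr (q - 2) / 2) ` {-1/2..1/2})"
    by (intro compact_imp_bounded compact_continuous_image) auto
  then obtain K where K: "\<And>t. t \<in> {-1/2..1/2} \<Longrightarrow> \<bar>q * (q - 1) * (1 + t) powr (q - 2) / 2\<bar> \<le> K"
    unfolding bounded_iff real_norm_def by blast
  have "\<bar>(1 + y) powr q - 1 - q * y\<bar> \<le> K * y\<^sup>2" if y: "\<bar>y\<bar> \<le> 1/2" for y :: real
  proof (cases "y = 0")
    case False
    \<comment> \<open>\<open>Taylor\<close> expects the successive derivatives as one sequence; the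
      indices 0, 1 and 2 carry them.\<close>
    define df where "df m t = (if m = (0::nat) then (1 + t) powr q
      else if m = 1 then q * (1 + t) powr (q - 1) else q * (q - 1) * (1 + t) powr (q - 2))" for m and t :: real
    have df: "\<forall>m t. m < 2 \<and> -1/2 \<le> t \<and> t \<le> 1/2 \<longrightarrow> (df m has_real_derivative df (Suc m) t) (at t)"
    proof (intro allI impI)
      fix m :: nat and t :: real assume "m < 2 \<and> -1/2 \<le> t \<and> t \<le> 1/2"
      then have "m = 0 \<or> m = 1" and "1 + t > 0" by auto
      have p: "((\<lambda>t. (1 + t) powr p) has_real_derivative p * (1 + t) powr (p - 1)) (at t)" for p
        using DERIV_shift[of "\<lambda>z. z powr p" "p * (1 + t) powr (p - 1)" t 1]
          has_real_derivative_powr[of "1 + t" p] \<open>1 + t > 0\<close> by (simp add: add.commute)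
      show "(df m has_real_derivative df (Suc m) t) (at t)"
        using \<open>m = 0 \<or> m = 1\<close> p[of q] DERIV_cmult[OF p[of "q - 1"], of q]
        unfolding df_def by (auto simp: mult.assoc)
    qed
    have "-1/2 \<le> y" "y \<le> 1/2" using y by auto
    then have "\<exists>t. (if y < 0 then y < t \<and> t < 0 else 0 < t \<and> t < y) \<and>
        df 0 y = (\<Sum>m<2. df m 0 / fact m * (y - 0) ^ m) + df 2 t / fact 2 * (y - 0)\<^sup>2"
      using False by (intro Taylor[OF _ _ df]) auto
    then obtain t where t: "if y < 0 then y < t \<and> t < 0 else 0 < t \<and> t < y"
      "df 0 y = (\<Sum>m<2. df m 0 / fact m * (y - 0) ^ m) + df 2 t / fact 2 * (y - 0)\<^sup>2" by blast
    have "t \<in> {-1/2..1/2}" using t(1) y by (auto split: if_splits)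
    have "(1 + y) powr q - 1 - q * y = (q * (q - 1) * (1 + t) powr (q - 2) / 2) * y\<^sup>2"
      using t(2) by (simp add: df_def numeral_2_eq_2)
    then show ?thesis
      using K[OF \<open>t \<in> _\<close>] by (simp only: abs_mult abs_power2 mult_right_mono zero_le_power2)
  qed simp
  then show ?thesis by blast
qed

text \<open>Here f - 1 has order h^2, so the quadratic remainder of the power at 1 already has order
  h^4.\<close>

lemma expansion_powr_value:
  assumes "expansion f (\<lambda>_. 1) b"
  shows "bigO_pow 4 (\<lambda>h x. f h x powr q - (1 + h\<^sup>2 * (q * b x)))"
proof -
  obtain K where K: "\<And>y::real. \<bar>y\<bar> \<le> 1/2 \<Longrightarrow> \<bar>(1 + y) powr q - 1 - q * y\<bar> \<le> K * y\<^sup>2"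
    using powr_quadratic_bound by meson
  note f = expansionD[OF assms]
  have "bigO_pow 2 (\<lambda>h x. (f h x - (1 + h\<^sup>2 * b x)) + h\<^sup>2 * b x)"
    by (rule bigO_pow_add[OF bigO_pow_mono[OF f(4)] bigO_pow_monom[OF f(2)]]) simp
  then have y: "bigO_pow 2 (\<lambda>h x. f h x - 1)"
    by (rule bigO_pow_cong) simp
  have 1: "bigO_pow 4 (\<lambda>h x. f h x powr q - 1 - q * (f h x - 1))"
    unfolding bigO_pow_def
  proof (intro allI impI)
    fix S :: "real set" assume S: "compact S"
    then obtain K' where K': "\<forall>\<^sub>F h in at_right 0. \<forall>x\<in>S. \<bar>f h x - 1\<bar> \<le> K' * h\<^sup>2"
      using y unfolding bigO_pow_def by (auto simp only:)
    have "((\<lambda>h::real. \<bar>K'\<bar> * h\<^sup>2) \<longlongrightarrow> 0) (at_right 0)"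
      by (auto intro!: tendsto_eq_intros)
    then have "\<forall>\<^sub>F h in at_right 0. \<bar>K'\<bar> * h\<^sup>2 < 1/2"
      by (rule order_tendstoD) simp
    with K' have "\<forall>\<^sub>F h in at_right 0. \<forall>x\<in>S. \<bar>f h x powr q - 1 - q * (f h x - 1)\<bar> \<le> (\<bar>K\<bar> * K'\<^sup>2) * h ^ 4"
    proof eventually_elim
      case (elim h)
      show ?case
      proof
        fix x assume "x \<in> S"
        with elim have a: "\<bar>f h x - 1\<bar> \<le> \<bar>K'\<bar> * h\<^sup>2"
          by (meson abs_ge_self mult_right_mono order_trans zero_le_power2)
        with elim have "\<bar>f h x - 1\<bar> \<le> 1/2" by simp
        from K[OF this] have "\<bar>f h x powr q - 1 - q * (f h x - 1)\<bar> \<le> K * (f h x - 1)\<^sup>2" by simp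
        also have "\<dots> \<le> \<bar>K\<bar> * (\<bar>K'\<bar> * h\<^sup>2)\<^sup>2"
          using power_mono[OF a, of 2] by (intro mult_mono) auto
        also have "\<dots> = (\<bar>K\<bar> * K'\<^sup>2) * h ^ 4" by (simp add: power_mult_distrib flip: power_mult)
        finally show "\<bar>f h x powr q - 1 - q * (f h x - 1)\<bar> \<le> (\<bar>K\<bar> * K'\<^sup>2) * h ^ 4" .
      qed
    qed
    then show "\<exists>K. \<forall>\<^sub>F h in at_right 0. \<forall>x\<in>S. \<bar>f h x powr q - 1 - q * (f h x - 1)\<bar> \<le> K * h ^ 4" ..
  qed
  show ?thesis
    by (rule bigO_pow_cong[OF bigO_pow_add[OF 1 bigO_pow_cmult[OF f(4), of q]]])
      (simp add: algebra_simps)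
qed

text \<open>A k-th derivative of the power is another real power of f times P_k, so the
  undifferentiated estimate with exponent q - k suffices. For k \<ge> 1 the leading term of P_k is
  0, because that of f is constant; hence the power contributes only its leading term 1 to the
  coefficient of h^2.\<close>

lemma expansion_powr:
  assumes "expansion f (\<lambda>_. 1) b" and pos: "\<forall>\<^sub>F h in at_right 0. \<forall>x. f h x > 0"
  shows "expansion (\<lambda>h x. f h x powr q) (\<lambda>_. 1) (\<lambda>x. q * b x)"
proof -
  note f = expansionD[OF assms(1)]
  have ev: "\<forall>\<^sub>F h in at_right 0. smooth (f h) \<and> (\<forall>x. f h x > 0)"
    using f(3) pos by eventually_elim simp
  \<comment> \<open>\<open>(f\<^sup>q)\<^bsup>(k)\<^esup> = f\<^bsup>q-k\<^esup> P\<^sub>k\<close> where \<open>P\<^sub>k\<close> is a differential polynomial in \<open>f\<close>\<close>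
  define P where "P = rec_nat (\<lambda>h x. 1)
    (\<lambda>k p h x. (q - real k) * (deriv (f h) x * p h x) + f h x * deriv (p h) x)"
  have P0: "P 0 = (\<lambda>h x. 1)"
    and PS: "P (Suc k) = (\<lambda>h x. (q - real k) * (deriv (f h) x * P k h x) + f h x * deriv (P k h) x)" for k
    by (simp_all add: P_def)
  have f': "expansion (\<lambda>h. deriv (f h)) (\<lambda>_. 0) (deriv b)"
    using expansion_deriv[OF assms(1)] by simp
  have P: "expansion (P (Suc k)) (\<lambda>_. 0) (\<lambda>x. q * Dn (Suc k) b x)" for k
  proof (induction k)
    case 0
    have "expansion (P 0) (\<lambda>_. 1) (\<lambda>_. 0)" unfolding P0 by (rule expansion_const) simp
    from expansion_add[OF expansion_cmult[OF expansion_mult[OF f' this], of q]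
        expansion_mult[OF assms(1) expansion_deriv[OF this]]]
    show ?case unfolding PS[of 0] by simp
  next
    case (Suc k)
    have s: "smooth (Dn (Suc k) b)" using f(2) by (rule smooth_funpow_deriv)
    from expansion_add[OF expansion_cmult[OF expansion_mult[OF f' Suc], of "q - real (Suc k)"]
        expansion_mult[OF assms(1) expansion_deriv[OF Suc]]]
    show ?case unfolding PS[of "Suc k"] using deriv_mult[OF smooth_const s, of q] by simp
  qed
  have Psm: "\<forall>\<^sub>F h in at_right 0. smooth (P k h)" for k
    using expansionD(3)[OF P] by (cases k) (auto simp: P0)
  have DP: "\<forall>\<^sub>F h in at_right 0. \<forall>x. Dn k (\<lambda>x. f h x powr q) x = f h x powr (q - real k) * P k h x" for k
  proof (induction k)
    case (Suc k)
    from Suc ev Psm[of k] show ?case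
    proof eventually_elim
      case (elim h)
      have fs: "smooth (f h)" "\<forall>x. f h x > 0" using elim by auto
      have "Dn (Suc k) (\<lambda>x. f h x powr q) = deriv (\<lambda>x. f h x powr (q - real k) * P k h x)"
      proof -
        have "Dn k (\<lambda>x. f h x powr q) = (\<lambda>x. f h x powr (q - real k) * P k h x)"
          using elim by (intro ext) blast
        then show ?thesis by simp
      qed
      also have "\<dots> = (\<lambda>x. deriv (\<lambda>x. f h x powr (q - real k)) x * P k h x + f h x powr (q - real k) * deriv (P k h) x)"
        using fs elim by (intro deriv_mult smooth_powr) auto
      also have "deriv (\<lambda>x. f h x powr (q - real k)) = (\<lambda>x. (q - real k) * (deriv (f h) x * f h x powr (q - real k - 1)))"
        using fs by (intro deriv_powr_fun) (auto simp: smooth_differentiable)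
      finally have *: "Dn (Suc k) (\<lambda>x. f h x powr q) x = (q - real k) * (deriv (f h) x * f h x powr (q - real k - 1)) * P k h x
         + f h x powr (q - real k) * deriv (P k h) x" for x by (rule fun_cong)
      have e: "f h x powr (q - real k) = f h x powr (q - real k - 1) * f h x" for x
      proof -
        have "f h x > 0" using fs(2) by blast
        then show ?thesis by (simp add: powr_diff)
      qed
      have n: "q - real (Suc k) = q - real k - 1" by simp
      show ?case unfolding * PS n by (subst e) (simp add: algebra_simps)
    qed
  qed (use ev in \<open>auto simp: P0\<close>)
  show ?thesis
  proof (rule expansionI)
    show "\<forall>\<^sub>F h in at_right 0. smooth (\<lambda>x. f h x powr q)"
      using ev by eventually_elim (simp add: smooth_powr)
    fix k
    show "bigO_pow 4 (\<lambda>h x. Dn k (\<lambda>x. f h x powr q) x - (Dn k (\<lambda>_. 1) x + h\<^sup>2 * Dn k (\<lambda>x. q * b x) x))"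
    proof (cases k)
      case 0
      then show ?thesis using expansion_powr_value[OF assms(1), of q] by simp
    next
      case (Suc j)
      have "bigO_pow 4 (\<lambda>h x. f h x powr (q - real k) * P k h x - h\<^sup>2 * (q * Dn k b x))"
      proof -
        have "bigO_pow (4 + 0) (\<lambda>h x. (f h x powr (q - real k) - (1 + h\<^sup>2 * ((q - real k) * b x))) * P k h x)"
          unfolding Suc by (rule bigO_pow_mult[OF expansion_powr_value[OF assms(1)] expansion_bounded[OF P]])
        moreover have "bigO_pow (0 + 4) (\<lambda>h x. (1 + h\<^sup>2 * ((q - real k) * b x)) * (P k h x - (0 + h\<^sup>2 * (q * Dn k b x))))"
          unfolding Suc by (rule bigO_pow_mult[OF bigO_pow_two_terms[OF smooth_const smooth_cmult[OF f(2)]] expansionD(4)[OF P]])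
        moreover have "bigO_pow 4 (\<lambda>h x. h ^ 4 * ((q - real k) * b x * (q * Dn k b x)))"
          by (intro bigO_pow_monom smooth_mult smooth_const f(2) smooth_funpow_deriv)
        ultimately have "bigO_pow 4 (\<lambda>h x. (f h x powr (q - real k) - (1 + h\<^sup>2 * ((q - real k) * b x))) * P k h x
           + (1 + h\<^sup>2 * ((q - real k) * b x)) * (P k h x - (0 + h\<^sup>2 * (q * Dn k b x)))
           + h ^ 4 * ((q - real k) * b x * (q * Dn k b x)))"
          unfolding add_0_left add_0_right by (rule bigO_pow_add[OF bigO_pow_add])
        then show ?thesis
        proof (rule bigO_pow_cong, intro always_eventually allI)
          fix h x :: real
          show "(f h x powr (q - real k) - (1 + h\<^sup>2 * ((q - real k) * b x))) * P k h x
             + (1 + h\<^sup>2 * ((q - real k) * b x)) * (P k h x - (0 + h\<^sup>2 * (q * Dn k b x)))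
             + h ^ 4 * ((q - real k) * b x * (q * Dn k b x))
             = f h x powr (q - real k) * P k h x - h\<^sup>2 * (q * Dn k b x)"
            by (simp add: algebra_simps power2_eq_square power4_eq_xxxx)
        qed
      qed
      then show ?thesis
        by (rule bigO_pow_cong)
          (use DP[of k] in \<open>rule eventually_mono\<close>, simp add: Suc funpow_deriv_const funpow_deriv_cmult[OF f(2)] del: funpow.simps)
    qed
  qed (auto intro: smooth_cmult f(2))
qed

section \<open>Taylor expansion of difference quotients\<close>

lemma taylor_bigO:
  assumes "smooth g" "N > 0"
  shows "bigO_pow N (\<lambda>h x. g (x + n * h) - (\<Sum>k<N. (n * h) ^ k / fact k * Dn k g x))"
  unfolding bigO_pow_def
proof (intro allI impI)
  fix S :: "real set" assume "compact S"
  then obtain R where R: "\<And>x. x \<in> S \<Longrightarrow> \<bar>x\<bar> \<le> R" 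
    using compact_imp_bounded[of S] unfolding bounded_iff by auto
  \<comment> \<open>For h \<le> 1 the point x + n h and everything between it and x lie in
    [-R', R'], so one bound on the N-th derivative serves all x in S.\<close>
  define R' where "R' = R + \<bar>n\<bar>"
  have "bounded (Dn N g ` {-R'..R'})"
    by (intro compact_imp_bounded compact_continuous_image smooth_continuous smooth_funpow_deriv assms) auto
  then obtain K where K: "\<And>x. x \<in> {-R'..R'} \<Longrightarrow> \<bar>Dn N g x\<bar> \<le> K"
    unfolding bounded_iff real_norm_def by blast
  have "\<forall>\<^sub>F h in at_right 0. \<forall>x\<in>S. \<bar>g (x + n * h) - (\<Sum>k<N. (n * h) ^ k / fact k * Dn k g x)\<bar>
      \<le> (\<bar>K\<bar> * \<bar>n\<bar> ^ N) * h ^ N"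
    using eventually_pos_le_1
  proof eventually_elim
    case (elim h)
    show ?case
    proof
      fix x assume x: "x \<in> S"
      show "\<bar>g (x + n * h) - (\<Sum>k<N. (n * h) ^ k / fact k * Dn k g x)\<bar> \<le> (\<bar>K\<bar> * \<bar>n\<bar> ^ N) * h ^ N"
      \<comment> \<open>\<open>Taylor\<close> needs two distinct points; for n = 0 the sum reduces
        to its term k = 0.\<close>
      proof (cases "n = 0")
        case True
        then have "(\<Sum>k<N. (n * h) ^ k / fact k * Dn k g x) = (\<Sum>k<N. if k = 0 then g x else 0)"
          by (intro sum.cong) auto
        also have "\<dots> = g x" using assms(2) by simp
          finally show ?thesis using True elim by simp
      next
        case False
        have ne: "\<bar>n * h\<bar> \<le> \<bar>n\<bar>" using elim by (simp add: abs_mult mult_left_le)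
        have "\<exists>t. (if x + n * h < x then x + n * h < t \<and> t < x else x < t \<and> t < x + n * h) \<and>
           g (x + n * h) = (\<Sum>m<N. Dn m g x / fact m * (x + n * h - x) ^ m)
             + Dn N g t / fact N * (x + n * h - x) ^ N"
          using R[OF x] ne False elim assms(2)
          by (intro Taylor[of N "\<lambda>m. Dn m g" g "-R'" R'])
            (auto simp: R'_def intro!: smooth_DERIV smooth_funpow_deriv assms(1))
        then obtain t where t: "if x + n * h < x then x + n * h < t \<and> t < x else x < t \<and> t < x + n * h"
          "g (x + n * h) = (\<Sum>m<N. Dn m g x / fact m * (n * h) ^ m)
             + Dn N g t / fact N * (n * h) ^ N" by auto
        have "t \<in> {-R'..R'}" using t(1) R[OF x] ne by (auto simp: R'_def split: if_splits)
        then have "\<bar>Dn N g t\<bar> / fact N \<le> \<bar>K\<bar> / 1"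
          using K by (intro frac_le) (auto intro: order_trans[OF _ abs_ge_self])
        then have "\<bar>Dn N g t\<bar> / fact N * \<bar>n * h\<bar> ^ N \<le> \<bar>K\<bar> * \<bar>n * h\<bar> ^ N"
          by (intro mult_right_mono) auto
        also have "\<dots> = (\<bar>K\<bar> * \<bar>n\<bar> ^ N) * h ^ N"
          using elim by (simp add: abs_mult power_mult_distrib)
        finally have "\<bar>Dn N g t / fact N * (n * h) ^ N\<bar> \<le> (\<bar>K\<bar> * \<bar>n\<bar> ^ N) * h ^ N"
          by (simp add: abs_mult power_abs)
        then show ?thesis unfolding t(2) by (simp add: mult.commute)
      qed
    qed
  qed
  then show "\<exists>K. \<forall>\<^sub>F h in at_right 0. \<forall>x\<in>S. \<bar>g (x + n * h) - (\<Sum>k<N. (n * h) ^ k / fact k * Dn k g x)\<bar>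
     \<le> K * h ^ N" ..
qed

text \<open>The moment conditions cancel all terms of the Taylor expansion other than those of order
  \<open>m\<close> and \<open>m + 2\<close>, up to the error.\<close>

lemma expansion_difference_quotient:
  fixes \<alpha> n :: "nat \<Rightarrow> real"
  assumes "smooth g" and "\<And>k. k < m + 4 \<Longrightarrow> k \<noteq> m + 2 \<Longrightarrow> (\<Sum>c<d. \<alpha> c * n c ^ k) = (if k = m then fact m else 0)"
  shows "expansion (\<lambda>h x. \<Sum>c<d. \<alpha> c / h ^ m * g (x + n c * h)) (Dn m g)
    (\<lambda>x. (\<Sum>c<d. \<alpha> c * n c ^ (m + 2)) / fact (m + 2) * Dn (m + 2) g x)"
proof -
  define \<beta> where "\<beta> = (\<Sum>c<d. \<alpha> c * n c ^ (m + 2)) / fact (m + 2)"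
  have val: "bigO_pow 4 (\<lambda>h x. (\<Sum>c<d. \<alpha> c / h ^ m * g (x + n c * h)) - (Dn m g x + h\<^sup>2 * (\<beta> * Dn (m + 2) g x)))"
    if g: "smooth g" for g
  proof -
    \<comment> \<open>The remainder is taken at order m + 4, so that order 4 is left after the
      division by h^m.\<close>
    define T where "T h x = (\<Sum>c<d. \<alpha> c * (g (x + n c * h) - (\<Sum>k<m+4. (n c * h) ^ k / fact k * Dn k g x)))" for h x
    have T: "bigO_pow (m + 4) T"
      unfolding T_def by (intro bigO_pow_sum bigO_pow_cmult taylor_bigO g) simp
    have "bigO_pow 4 (\<lambda>h x. T h x / h ^ m)"
      unfolding bigO_pow_def
    proof (intro allI impI)
      fix S :: "real set" assume "compact S"
      then obtain K where "\<forall>\<^sub>F h in at_right 0. \<forall>x\<in>S. \<bar>T h x\<bar> \<le> K * h ^ (m + 4)"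
        using T unfolding bigO_pow_def by (auto simp only:)
      then have "\<forall>\<^sub>F h in at_right 0. \<forall>x\<in>S. \<bar>T h x / h ^ m\<bar> \<le> K * h ^ 4"
        using eventually_pos_le_1 by eventually_elim (auto simp: field_simps power_add)
      then show "\<exists>K. \<forall>\<^sub>F h in at_right 0. \<forall>x\<in>S. \<bar>T h x / h ^ m\<bar> \<le> K * h ^ 4" ..
    qed
    then show ?thesis
    proof (rule bigO_pow_cong)
      show "\<forall>\<^sub>F h in at_right 0. \<forall>x. T h x / h ^ m =
        (\<Sum>c<d. \<alpha> c / h ^ m * g (x + n c * h)) - (Dn m g x + h\<^sup>2 * (\<beta> * Dn (m + 2) g x))"
        using eventually_pos_le_1
      proof (eventually_elim, intro allI)
        fix h x :: real assume h: "0 < h \<and> h \<le> 1"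
        have "(\<Sum>c<d. \<alpha> c * (\<Sum>k<m+4. (n c * h) ^ k / fact k * Dn k g x))
          = (\<Sum>k<m+4. (\<Sum>c<d. \<alpha> c * n c ^ k) * (h ^ k / fact k * Dn k g x))"
          unfolding sum_distrib_left sum_distrib_right
          by (subst sum.swap) (simp add: power_mult_distrib mult_ac)
        also have "\<dots> = (\<Sum>k<m+4. (if k = m then fact m * (h ^ k / fact k * Dn k g x) else 0)
            + (if k = m + 2 then (\<Sum>c<d. \<alpha> c * n c ^ k) * (h ^ k / fact k * Dn k g x) else 0))"
          by (rule sum.cong[OF refl]) (use assms(2) in auto)
        also have "\<dots> = h ^ m * Dn m g x + h ^ (m + 2) * (\<beta> * Dn (m + 2) g x)"
          unfolding sum.distrib by (simp add: \<beta>_def del: fact_Suc funpow.simps)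
        finally have *: "T h x = (\<Sum>c<d. \<alpha> c * g (x + n c * h)) - (h ^ m * Dn m g x + h ^ (m + 2) * (\<beta> * Dn (m + 2) g x))"
          unfolding T_def right_diff_distrib sum_subtractf by (simp only:)
        show "T h x / h ^ m = (\<Sum>c<d. \<alpha> c / h ^ m * g (x + n c * h)) - (Dn m g x + h\<^sup>2 * (\<beta> * Dn (m + 2) g x))"
          unfolding * using h by (simp add: diff_divide_distrib add_divide_distrib power_add sum_divide_distrib power2_eq_square del: funpow.simps)
      qed
    qed
  qed
  have sm: "smooth (\<lambda>x. \<Sum>c<d. \<alpha> c / h ^ m * g (x + n c * h))" for h
    by (intro smooth_sum smooth_cmult smooth_shift assms(1))
  show ?thesis
    unfolding \<beta>_def[symmetric]
  proof (rule expansionI)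
    fix k
    \<comment> \<open>Differentiation in x commutes with the difference quotient; the k-th
      derivative of the claim is thus \<open>val\<close> for the function
      \<open>Dn k g\<close>.\<close>
    have *: "Dn k (\<lambda>x. \<Sum>c<d. \<alpha> c / h ^ m * g (x + n c * h)) x = (\<Sum>c<d. \<alpha> c / h ^ m * Dn k g (x + n c * h))" for h x
      by (subst funpow_deriv_sum) (simp_all only: funpow_deriv_cmult[OF smooth_shift[OF assms(1)]]
          funpow_deriv_shift[OF assms(1)] smooth_cmult[OF smooth_shift[OF assms(1)]])
    have **: "Dn k (Dn j g) = Dn j (Dn k g)" for j
      by (simp add: add.commute flip: funpow_add[THEN fun_cong, unfolded o_apply])
    show "bigO_pow 4 (\<lambda>h x. Dn k (\<lambda>x. \<Sum>c<d. \<alpha> c / h ^ m * g (x + n c * h)) x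
      - (Dn k (Dn m g) x + h\<^sup>2 * Dn k (\<lambda>x. \<beta> * Dn (m + 2) g x) x))"
      unfolding * funpow_deriv_cmult[OF smooth_funpow_deriv[OF assms(1)]] **
      by (rule val[OF smooth_funpow_deriv[OF assms(1)]])
  qed (use sm assms(1) in \<open>simp_all only: smooth_funpow_deriv smooth_cmult eventually_True\<close>)
qed

section \<open>The nodes, interpolation and moments\<close>

lemma node_reflect: "c < d \<Longrightarrow> node d (d - 1 - c) = - node d c"
  unfolding node_def by (auto simp: of_nat_diff field_simps elim!: oddE)

lemma inj_node: "inj (node d)"
  unfolding node_def inj_def by auto

lemma sum_node: "(\<Sum>c<d. node d c) = 0"
proof -
  have "(\<Sum>c<d. node d c) = (\<Sum>c<d. node d (d - Suc c))"
    using sum.nat_diff_reindex[of "node d" d] by simp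
  also have "\<dots> = - (\<Sum>c<d. node d c)"
    unfolding sum_negf[symmetric] by (rule sum.cong) (use node_reflect in auto)
  finally show ?thesis by simp
qed

text \<open>The leading coefficients of the monic polynomial with roots \<open>a c\<close>: 1, -e1
  and e2. Newton's identity puts e2 in terms of power sums, which makes its sign visible for nodes
  whose sum is 0.\<close>

lemma coeff_prod_linear:
  fixes a :: "nat \<Rightarrow> real"
  shows "coeff (\<Prod>c<n. [:- a c, 1:]) n = 1"
    and "coeff (\<Prod>c<Suc n. [:- a c, 1:]) n = - (\<Sum>c<Suc n. a c)"
    and "2 * coeff (\<Prod>c<Suc (Suc n). [:- a c, 1:]) n = (\<Sum>c<Suc (Suc n). a c)\<^sup>2 - (\<Sum>c<Suc (Suc n). (a c)\<^sup>2)"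
proof -
  have step: "coeff (\<Prod>c<Suc m. [:- a c, 1:]) (Suc k) = coeff (\<Prod>c<m. [:- a c, 1:]) k - a m * coeff (\<Prod>c<m. [:- a c, 1:]) (Suc k)" for m k
    by (simp add: mult.commute)
  have step0: "coeff (\<Prod>c<Suc m. [:- a c, 1:]) 0 = - a m * coeff (\<Prod>c<m. [:- a c, 1:]) 0" for m
    by (simp add: mult.commute)
  have deg: "degree (\<Prod>c<m. [:- a c, 1:]) = m" for m
    by (simp add: degree_prod_eq_sum_degree)
  have 0: "coeff (\<Prod>c<n. [:- a c, 1:]) n = 1" for n
    by (induction n) (auto simp only: step coeff_eq_0 deg lessI, auto)
  have 1: "coeff (\<Prod>c<Suc n. [:- a c, 1:]) n = - (\<Sum>c<Suc n. a c)" for n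
  proof (induction n)
    case (Suc n)
    show ?case unfolding step Suc 0 by simp
  qed simp
  have 2: "2 * coeff (\<Prod>c<Suc (Suc n). [:- a c, 1:]) n = (\<Sum>c<Suc (Suc n). a c)\<^sup>2 - (\<Sum>c<Suc (Suc n). (a c)\<^sup>2)"
  proof (induction n)
    case 0
    show ?case unfolding step0 by (simp add: power2_eq_square algebra_simps)
  next
    case (Suc n)
    show ?case unfolding step right_diff_distrib Suc 1
      by (simp add: power2_eq_square algebra_simps)
  qed
  show "coeff (\<Prod>c<n. [:- a c, 1:]) n = 1"
    "coeff (\<Prod>c<Suc n. [:- a c, 1:]) n = - (\<Sum>c<Suc n. a c)"
    "2 * coeff (\<Prod>c<Suc (Suc n). [:- a c, 1:]) n = (\<Sum>c<Suc (Suc n). a c)\<^sup>2 - (\<Sum>c<Suc (Suc n). (a c)\<^sup>2)"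
    by (fact 0 1 2)+
qed

lemma poly_eq_if_eq_on_nodes:
  assumes "inj a" "degree p < d" "degree q < d" "\<And>c. c < d \<Longrightarrow> poly p (a c) = poly q (a c)"
  shows "p = (q :: real poly)"
proof (rule poly_eqI_degree)
  have "card (a ` {..<d}) = d" using assms(1) by (simp add: card_image inj_on_def)
  then show "degree p < card (a ` {..<d})" "degree q < card (a ` {..<d})" using assms by auto
qed (use assms(4) in auto)

definition lagrange_basis :: "nat \<Rightarrow> (nat \<Rightarrow> real) \<Rightarrow> nat \<Rightarrow> real poly" where
  "lagrange_basis d a c = (\<Prod>b\<in>{..<d} - {c}. smult (1 / (a c - a b)) [:- a b, 1:])"

lemma poly_lagrange_basis:
  assumes "inj a" "c < d" "b < d"
  shows "poly (lagrange_basis d a c) (a b) = (if b = c then 1 else 0)"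
proof (cases "b = c")
  case True
  have "poly (lagrange_basis d a c) (a c) = (\<Prod>b\<in>{..<d} - {c}. 1 / (a c - a b) * (a c - a b))"
    unfolding lagrange_basis_def poly_prod by (rule prod.cong) (auto simp: divide_simps)
  also have "\<dots> = 1" using assms(1) by (intro prod.neutral) (auto dest: injD)
  finally show ?thesis using True by simp
next
  case False
  then have "\<exists>b'\<in>{..<d} - {c}. poly (smult (1 / (a c - a b')) [:- a b', 1:]) (a b) = 0"
    using assms by (intro bexI[of _ b]) auto
  then show ?thesis using False unfolding lagrange_basis_def poly_prod by (subst prod_zero) auto
qed

lemma degree_lagrange_basis:
  assumes "c < d" shows "degree (lagrange_basis d a c) < d"
proof -
  have "degree (lagrange_basis d a c) \<le> (\<Sum>b\<in>{..<d} - {c}. degree (smult (1 / (a c - a b)) [:- a b, 1:]))"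
    unfolding lagrange_basis_def using degree_prod_sum_le[of "{..<d} - {c}" "\<lambda>b. smult (1 / (a c - a b)) [:- a b, 1:]"]
    by (simp only: finite_Diff finite_lessThan o_def)
  also have "\<dots> \<le> (\<Sum>b\<in>{..<d} - {c}. 1)" by (intro sum_mono) (auto simp: degree_smult_eq)
  also have "\<dots> < d" using assms by simp
  finally show ?thesis .
qed

text \<open>\<open>\<alpha> m\<close> are the weights of the interpolatory formula for the m-th
  derivative at 0. The k-th moment of \<open>\<alpha> m\<close> is m! times the coefficient of X^m
  in the interpolant \<open>I k\<close> of X^k, and all three claims are read from it:
  \<open>I k\<close> is X^k itself for k < d, it has the parity of k, and \<open>I d\<close> is X^d
  minus the node polynomial.\<close>

lemma node_moments:
  assumes "d \<ge> 2"
  obtains \<alpha> :: "nat \<Rightarrow> nat \<Rightarrow> real" where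
    "\<And>m k. m < d \<Longrightarrow> k < d \<Longrightarrow> (\<Sum>c<d. \<alpha> m c * node d c ^ k) = (if k = m then fact m else 0)"
    "\<And>m k. m < d \<Longrightarrow> odd (m + k) \<Longrightarrow> (\<Sum>c<d. \<alpha> m c * node d c ^ k) = 0"
    "(\<Sum>c<d. \<alpha> (d - 2) c * node d c ^ d) > 0"
proof -
  define a where "a = node d"
  have inj: "inj a" unfolding a_def by (rule inj_node)
  define I where "I k = (\<Sum>c<d. smult (a c ^ k) (lagrange_basis d a c))" for k
  define \<alpha> where "\<alpha> m c = fact m * coeff (lagrange_basis d a c) m" for m c
  have \<alpha>: "(\<Sum>c<d. \<alpha> m c * a c ^ k) = fact m * coeff (I k) m" for m k
    unfolding \<alpha>_def I_def coeff_sum sum_distrib_left by (rule sum.cong) auto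
  have I_poly: "poly (I k) (a b) = a b ^ k" if "b < d" for k b
    unfolding I_def using that inj by (simp add: poly_sum poly_lagrange_basis if_distrib cong: if_cong)
  have I_deg: "degree (I k) < d" for k
    unfolding I_def using assms degree_lagrange_basis
    by (intro degree_sum_less) (auto intro: le_less_trans[OF degree_smult_le])
  have I_low: "I k = monom 1 k" if "k < d" for k
    using that by (intro poly_eq_if_eq_on_nodes[OF inj, of _ d]) (auto simp: I_deg I_poly degree_monom_eq poly_monom)
  \<comment> \<open>The reflection c -> d - 1 - c negates the nodes, so \<open>I k\<close> at -X and
    (-1)^k times \<open>I k\<close> agree at all of them.\<close>
  have I_par: "pcompose (I k) [:0, - 1:] = smult ((- 1) ^ k) (I k)" for k
  proof (rule poly_eq_if_eq_on_nodes[OF inj, of _ d])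
    fix c assume c: "c < d"
    have "- a c = a (d - 1 - c)" unfolding a_def using c by (simp only: node_reflect)
    then have "poly (I k) (- a c) = (- a c) ^ k" using I_poly[of "d - 1 - c" k] c by simp
    then show "poly (pcompose (I k) [:0, - 1:]) (a c) = poly (smult ((- 1) ^ k) (I k)) (a c)"
      using I_poly[OF c, of k] by (simp add: poly_pcompose power_minus[of "a c"])
  qed (use I_deg in \<open>auto simp: degree_pcompose\<close>)
  have I_odd: "coeff (I k) m = 0" if "odd (m + k)" for k m
  proof -
    have "(- 1) ^ m * coeff (I k) m = (- 1) ^ k * coeff (I k) m"
      using arg_cong[OF I_par[of k], of "\<lambda>p. coeff p m"] by (simp add: coeff_pcompose_linear)
    then show ?thesis using that by (cases "even m") auto
  qed
  have top: "I d = monom 1 d - (\<Prod>c<d. [:- a c, 1:])"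
  proof (rule poly_eq_if_eq_on_nodes[OF inj, of _ d])
    have "coeff (monom 1 d - (\<Prod>c<d. [:- a c, 1:])) i = 0" if "i \<ge> d" for i
    proof (cases "i = d")
      case False
      have "degree (\<Prod>c<d. [:- a c, 1:]) = d" by (simp add: degree_prod_eq_sum_degree)
      then show ?thesis using that False by (simp add: coeff_eq_0)
    qed (simp add: coeff_prod_linear)
    then have "degree (monom 1 d - (\<Prod>c<d. [:- a c, 1:])) \<le> d - 1"
      using assms by (intro degree_le) auto
    then show "degree (monom 1 d - (\<Prod>c<d. [:- a c, 1:])) < d" using assms by simp
  next
    fix c assume c: "c < d"
    then have "poly (\<Prod>c<d. [:- a c, 1:]) (a c) = 0" by (auto simp: poly_prod)
    then show "poly (I d) (a c) = poly (monom 1 d - (\<Prod>c<d. [:- a c, 1:])) (a c)"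
      using I_poly[OF c] by (simp add: poly_monom)
  qed (rule I_deg)
  \<comment> \<open>The coefficient is -e2 of the nodes, and e1 = 0 turns it into half the sum of
    their squares.\<close>
  have "2 * coeff (I d) (d - 2) = (\<Sum>c<d. (a c)\<^sup>2)"
    using coeff_prod_linear(3)[of a "d - 2"] assms sum_node[of d]
    by (simp add: top numeral_2_eq_2 Suc_diff_Suc a_def del: prod.lessThan_Suc sum.lessThan_Suc)
  moreover have "(\<Sum>c<d. (a c)\<^sup>2) > 0"
  proof (rule ccontr)
    assume "\<not> ?thesis"
    moreover have "(\<Sum>c<d. (a c)\<^sup>2) \<ge> 0" by (intro sum_nonneg) auto
    ultimately have "(\<Sum>c<d. (a c)\<^sup>2) = 0" by simp
    then have "\<forall>c<d. a c = 0" by (auto simp: sum_nonneg_eq_0_iff)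
    then have "a 0 = a 1" using assms by simp
    then show False using inj by (auto dest: injD)
  qed
  ultimately have "coeff (I d) (d - 2) > 0" by simp
  then have "(\<Sum>c<d. \<alpha> (d - 2) c * node d c ^ d) > 0"
    using \<alpha>[of "d - 2" d] unfolding a_def by simp
  moreover have "(\<Sum>c<d. \<alpha> m c * node d c ^ k) = (if k = m then fact m else 0)" if "m < d" "k < d" for m k
    using \<alpha>[of m k] I_low[OF that(2)] unfolding a_def by simp
  moreover have "(\<Sum>c<d. \<alpha> m c * node d c ^ k) = 0" if "odd (m + k)" for m k
    using \<alpha>[of m k] I_odd[OF that] unfolding a_def by simp
  ultimately show thesis using that by blast
qed

subsection \<open>Determinants of matrices given by their entries\<close>

text \<open>Entries are given by a function of the indices, so that determinants depending on x and
  \<epsilon> can be treated entry by entry, without carrier conditions.\<close>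

definition mdet :: "nat \<Rightarrow> (nat \<Rightarrow> nat \<Rightarrow> real) \<Rightarrow> real" where
  "mdet n f = Determinant.det (Matrix.mat n n (\<lambda>(i, j). f i j))"

definition cof :: "nat \<Rightarrow> (nat \<Rightarrow> nat \<Rightarrow> real) \<Rightarrow> nat \<Rightarrow> nat \<Rightarrow> real" where
  "cof n f i j = cofactor (Matrix.mat n n (\<lambda>(i, j). f i j)) i j"

lemma mdet_cong: "(\<And>i j. i < n \<Longrightarrow> j < n \<Longrightarrow> f i j = g i j) \<Longrightarrow> mdet n f = mdet n g"
  unfolding mdet_def by (intro arg_cong[of _ _ Determinant.det] eq_matI) auto

lemma mdet_perm: "mdet n f = (\<Sum>p | p permutes {0..<n}. of_int (sign p) * (\<Prod>j<n. f (p j) j))"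
proof -
  have "mdet n f = (\<Sum>p | p permutes {0..<n}. of_int (sign p) * (\<Prod>j<n. Matrix.mat n n (\<lambda>(i, j). f i j) $$ (p j, j)))"
    unfolding mdet_def by (rule det_col) simp
  also have "\<dots> = (\<Sum>p | p permutes {0..<n}. of_int (sign p) * (\<Prod>j<n. f (p j) j))"
    by (intro sum.cong refl arg_cong2[of _ _ _ _ "(*)"] prod.cong) (auto dest: permutes_in_image)
  finally show ?thesis .
qed

lemma mdet_mult: "mdet n (\<lambda>i j. \<Sum>k<n. f i k * g k j) = mdet n f * mdet n g"
proof -
  have "Matrix.mat n n (\<lambda>(i, j). \<Sum>k<n. f i k * g k j) = Matrix.mat n n (\<lambda>(i, j). f i j) * Matrix.mat n n (\<lambda>(i, j). g i j)"
    by (rule eq_matI) (auto simp: scalar_prod_def atLeast0LessThan)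
  then show ?thesis unfolding mdet_def by (simp add: det_mult[of _ n])
qed

lemma mdet_transpose: "mdet n (\<lambda>i j. f j i) = mdet n f"
proof -
  have "Matrix.mat n n (\<lambda>(i, j). f j i) = (Matrix.mat n n (\<lambda>(i, j). f i j))\<^sup>T"
    by (rule eq_matI) auto
  then show ?thesis unfolding mdet_def by (simp add: Determinant.det_transpose[of _ n])
qed

lemma mdet_lower_triangular:
  assumes "\<And>i j. i < j \<Longrightarrow> j < n \<Longrightarrow> f i j = 0"
  shows "mdet n f = (\<Prod>i<n. f i i)"
proof -
  have "mdet n f = prod_list (diag_mat (Matrix.mat n n (\<lambda>(i, j). f i j)))"
    unfolding mdet_def by (rule det_lower_triangular[of n]) (use assms in auto)
  also have "diag_mat (Matrix.mat n n (\<lambda>(i, j). f i j)) = map (\<lambda>i. f i i) [0..<n]"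
    unfolding diag_mat_def by auto
  also have "prod_list (map (\<lambda>i. f i i) [0..<n]) = (\<Prod>i<n. f i i)"
    by (simp add: prod.list_conv_set_nth lessThan_atLeast0)
  finally show ?thesis .
qed

lemma mdet_identical_columns:
  assumes "j < n" "k < n" "j \<noteq> k" "\<And>i. i < n \<Longrightarrow> f i j = f i k"
  shows "mdet n f = 0"
  unfolding mdet_def
  by (rule det_identical_columns[of _ n j k]) (use assms in \<open>auto intro!: eq_vecI\<close>)

lemma cof_cong:
  assumes "\<And>i j. i < n \<Longrightarrow> j < n \<Longrightarrow> f i j = g i j" shows "cof n f i j = cof n g i j"
proof -
  have "Matrix.mat n n (\<lambda>(i, j). f i j) = Matrix.mat n n (\<lambda>(i, j). g i j)"
    using assms by (intro eq_matI) auto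
  then show ?thesis unfolding cof_def by simp
qed

lemma cof_column:
  assumes "\<And>i k. i < n \<Longrightarrow> k < n \<Longrightarrow> k \<noteq> c \<Longrightarrow> f i k = g i k" "c < n"
  shows "cof n f i c = cof n g i c"
proof -
  have "mat_delete (Matrix.mat n n (\<lambda>(i, j). f i j)) i c = mat_delete (Matrix.mat n n (\<lambda>(i, j). g i j)) i c"
    using assms by (intro eq_matI) (auto simp: mat_delete_def)
  then show ?thesis unfolding cof_def cofactor_def by simp
qed

lemma mdet_laplace_column: "c < n \<Longrightarrow> mdet n f = (\<Sum>i<n. f i c * cof n f i c)"
  unfolding mdet_def cof_def by (subst laplace_expansion_column[of _ n c]) auto

lemma mdet_replace_column:
  assumes "c < n"
  shows "mdet n (\<lambda>i j. if j = c then v i else f i j) = (\<Sum>i<n. v i * cof n f i c)"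
proof -
  have "cof n (\<lambda>i j. if j = c then v i else f i j) i c = cof n f i c" for i
    by (rule cof_column) (use assms in auto)
  then show ?thesis using mdet_laplace_column[OF assms, of "\<lambda>i j. if j = c then v i else f i j"] by simp
qed

text \<open>Transfers smoothness and expansions from determinants to cofactors.\<close>

lemma cof_eq_mdet:
  assumes "c < n" "i < n"
  shows "cof n f i c = mdet n (\<lambda>r j. if j = c then (if r = i then 1 else 0) else f r j)"
  using mdet_replace_column[OF assms(1), of "\<lambda>r. if r = i then 1 else 0" f] assms
  by (simp add: if_distrib[of "\<lambda>x. x * _"] cong: if_cong)

lemma sum_column_cof:
  assumes "c < n" "k < n"
  shows "(\<Sum>i<n. f i k * cof n f i c) = (if k = c then mdet n f else 0)"
proof (cases "k = c")
  case False
  have "(\<Sum>i<n. f i k * cof n f i c) = mdet n (\<lambda>i j. if j = c then f i k else f i j)"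
    using mdet_replace_column[OF assms(1), of "\<lambda>i. f i k" f] by simp
  also have "\<dots> = 0" by (rule mdet_identical_columns[of c n k]) (use assms False in auto)
  finally show ?thesis using False by simp
qed (simp add: mdet_laplace_column[OF assms(1), of f])

lemma sum_row_cof:
  assumes "i < n" "r < n"
  shows "(\<Sum>c<n. f i c * cof n f r c) = (if i = r then mdet n f else 0)"
proof -
  let ?A = "Matrix.mat n n (\<lambda>(i, j). f i j)"
  have "(\<Sum>c<n. f i c * cof n f r c) = (?A * adj_mat ?A) $$ (i, r)"
    using assms by (simp add: adj_mat_def scalar_prod_def cof_def atLeast0LessThan)
  also have "?A * adj_mat ?A = Determinant.det ?A \<cdot>\<^sub>m 1\<^sub>m n" by (rule adj_mat) simp
  finally show ?thesis using assms by (simp add: mdet_def)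
qed

text \<open>Combining the equations with the cofactors of row r isolates v r times the
  determinant.\<close>

lemma mdet_nonzero_kernel:
  assumes "mdet n f \<noteq> 0" "\<And>j. j < n \<Longrightarrow> (\<Sum>i<n. v i * f i j) = 0" "r < n"
  shows "v r = 0"
proof -
  have "0 = (\<Sum>j<n. (\<Sum>i<n. v i * f i j) * cof n f r j)" using assms(2) by simp
  also have "\<dots> = (\<Sum>i<n. v i * (\<Sum>j<n. f i j * cof n f r j))"
    unfolding sum_distrib_left sum_distrib_right by (subst sum.swap) (simp add: mult_ac)
  also have "\<dots> = (\<Sum>i<n. if i = r then v i * mdet n f else 0)"
    using sum_row_cof[of _ n r f] assms(3) by (intro sum.cong) auto
  also have "\<dots> = v r * mdet n f" using assms(3) by simp
  finally show ?thesis using assms(1) by simp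
qed

lemma mdet_nonzero_kernel':
  assumes "mdet n f \<noteq> 0" "\<And>i. i < n \<Longrightarrow> (\<Sum>j<n. f i j * v j) = 0" "r < n"
  shows "v r = 0"
proof (rule mdet_nonzero_kernel[of n "\<lambda>i j. f j i" v r])
  show "mdet n (\<lambda>i j. f j i) \<noteq> 0" by (subst mdet_transpose) (rule assms(1))
  show "(\<Sum>i<n. v i * f j i) = 0" if "j < n" for j using assms(2)[OF that] by (simp add: mult.commute)
qed fact

lemma smooth_mdet:
  assumes "\<And>i j. i < n \<Longrightarrow> j < n \<Longrightarrow> smooth (f i j)"
  shows "smooth (\<lambda>x. mdet n (\<lambda>i j. f i j x))"
  unfolding mdet_perm
  by (intro smooth_sum smooth_mult smooth_const smooth_prod assms) (auto dest: permutes_in_image)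

lemma expansion_mdet:
  assumes "\<And>i j. i < n \<Longrightarrow> j < n \<Longrightarrow> \<exists>b. expansion (f i j) (a i j) b"
  shows "\<exists>b. expansion (\<lambda>\<epsilon> x. mdet n (\<lambda>i j. f i j \<epsilon> x)) (\<lambda>x. mdet n (\<lambda>i j. a i j x)) b"
  unfolding mdet_perm
proof (rule expansion_sum_ex)
  fix p assume "p \<in> {p. p permutes {0..<n}}"
  then have "\<exists>b. expansion (f (p j) j) (a (p j) j) b" if "j \<in> {..<n}" for j
    using that by (intro assms) (auto dest: permutes_in_image)
  from expansion_prod_ex[of "{..<n}" "\<lambda>j. f (p j) j" "\<lambda>j. a (p j) j", OF this]
  obtain b where "expansion (\<lambda>\<epsilon> x. \<Prod>j<n. f (p j) j \<epsilon> x) (\<lambda>x. \<Prod>j<n. a (p j) j x) b" ..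
  from expansion_cmult[OF this, of "of_int (sign p)"]
  show "\<exists>b. expansion (\<lambda>\<epsilon> x. of_int (sign p) * (\<Prod>j<n. f (p j) j \<epsilon> x))
     (\<lambda>x. of_int (sign p) * (\<Prod>j<n. a (p j) j x)) b"
    by (intro exI[of _ "\<lambda>x. of_int (sign p) * b x"])
qed

lemma expansion_cof:
  assumes "\<And>i j. i < n \<Longrightarrow> j < n \<Longrightarrow> \<exists>b. expansion (f i j) (a i j) b" "i < n" "c < n"
  shows "\<exists>b. expansion (\<lambda>\<epsilon> x. cof n (\<lambda>i j. f i j \<epsilon> x) i c) (\<lambda>x. cof n (\<lambda>i j. a i j x) i c) b"
proof -
  have "\<exists>b. expansion (if j = c then (\<lambda>_ _. if r = i then 1 else 0) else f r j)
     (if j = c then (\<lambda>_. if r = i then 1 else 0) else a r j) b" if "r < n" "j < n" for r j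
    using assms(1)[OF that] expansion_const[of "\<lambda>_. if r = i then 1 else 0"] by auto
  note * = expansion_mdet[of n "\<lambda>r j. if j = c then (\<lambda>_ _. if r = i then 1 else 0) else f r j"
      "\<lambda>r j. if j = c then (\<lambda>_. if r = i then 1 else 0) else a r j", OF this]
  have "(\<lambda>\<epsilon> x. mdet n (\<lambda>r j. (if j = c then (\<lambda>_ _. if r = i then 1 else 0) else f r j) \<epsilon> x))
     = (\<lambda>\<epsilon> x. cof n (\<lambda>i j. f i j \<epsilon> x) i c)"
    by (intro ext, subst cof_eq_mdet[OF assms(3,2)]) (rule mdet_cong, simp)
  moreover have "(\<lambda>x. mdet n (\<lambda>r j. (if j = c then (\<lambda>_. if r = i then 1 else 0) else a r j) x))
     = (\<lambda>x. cof n (\<lambda>i j. a i j x) i c)"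
    by (intro ext, subst cof_eq_mdet[OF assms(3,2)]) (rule mdet_cong, simp)
  ultimately show ?thesis using * by (simp only:)
qed

lemma smooth_cof:
  assumes "\<And>i j. i < n \<Longrightarrow> j < n \<Longrightarrow> smooth (f i j)" "i < n" "c < n"
  shows "smooth (\<lambda>x. cof n (\<lambda>i j. f i j x) i c)"
proof -
  have "(\<lambda>x. cof n (\<lambda>i j. f i j x) i c) = (\<lambda>x. mdet n (\<lambda>r j. (if j = c then (\<lambda>_. if r = i then 1 else 0) else f r j) x))"
    by (intro ext, subst cof_eq_mdet[OF assms(3,2)]) (rule mdet_cong, simp)
  moreover have "smooth \<dots>" using assms by (intro smooth_mdet) auto
  ultimately show ?thesis by simp
qed

lemma DERIV_mdet:
  assumes "\<And>i j. i < n \<Longrightarrow> j < n \<Longrightarrow> (f i j has_real_derivative f' i j) (at x)"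
  shows "((\<lambda>x. mdet n (\<lambda>i j. f i j x)) has_real_derivative
    (\<Sum>c<n. mdet n (\<lambda>i j. if j = c then f' i j else f i j x))) (at x)"
proof -
  have "((\<lambda>x. of_int (sign p) * (\<Prod>j<n. f (p j) j x)) has_real_derivative
      (\<Sum>c<n. of_int (sign p) * (\<Prod>j<n. if j = c then f' (p j) j else f (p j) j x))) (at x)"
    if p: "p permutes {0..<n}" for p
  proof -
    have "((\<lambda>x. \<Prod>j<n. f (p j) j x) has_real_derivative (\<Sum>c<n. f' (p c) c * (\<Prod>j\<in>{..<n} - {c}. f (p j) j x))) (at x)"
      by (rule has_field_derivative_prod) (use assms permutes_in_image[OF p] in auto)
    also have "(\<Sum>c<n. f' (p c) c * (\<Prod>j\<in>{..<n} - {c}. f (p j) j x)) = (\<Sum>c<n. \<Prod>j<n. if j = c then f' (p j) j else f (p j) j x)"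
    proof (rule sum.cong[OF refl])
      fix c assume "c \<in> {..<n}"
      then show "f' (p c) c * (\<Prod>j\<in>{..<n} - {c}. f (p j) j x) = (\<Prod>j<n. if j = c then f' (p j) j else f (p j) j x)"
        by (subst prod.remove[of _ c]) (auto intro!: prod.cong)
    qed
    finally show ?thesis unfolding sum_distrib_left[symmetric] by (rule DERIV_cmult)
  qed
  then have "((\<lambda>x. mdet n (\<lambda>i j. f i j x)) has_real_derivative
     (\<Sum>p | p permutes {0..<n}. \<Sum>c<n. of_int (sign p) * (\<Prod>j<n. if j = c then f' (p j) j else f (p j) j x))) (at x)"
    unfolding mdet_perm by (intro DERIV_sum) auto
  then show ?thesis unfolding mdet_perm by (subst (asm) sum.swap)
qed

subsection \<open>Dual curves and their Wronskians\<close>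

lemma DERIV_pairing:
  assumes "\<And>i. i < n \<Longrightarrow> smooth (p i)" "\<And>i. i < n \<Longrightarrow> smooth (q i)"
  shows "((\<lambda>x. \<Sum>i<n. p i x * q i x) has_real_derivative
    (\<Sum>i<n. deriv (p i) x * q i x) + (\<Sum>i<n. p i x * deriv (q i) x)) (at x)"
proof -
  have "((\<lambda>x. \<Sum>i<n. p i x * q i x) has_real_derivative (\<Sum>i<n. deriv (p i) x * q i x + p i x * deriv (q i) x)) (at x)"
  proof (rule DERIV_sum)
    fix i assume "i \<in> {..<n}"
    then have "(p i has_real_derivative deriv (p i) x) (at x)" "(q i has_real_derivative deriv (q i) x) (at x)"
      using assms smooth_DERIV by auto
    then show "((\<lambda>x. p i x * q i x) has_real_derivative deriv (p i) x * q i x + p i x * deriv (q i) x) (at x)"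
      by (auto intro!: derivative_eq_intros)
  qed
  then show ?thesis by (simp only: sum.distrib)
qed

lemma pairing_shift_derivative:
  assumes "\<And>i. i < n \<Longrightarrow> smooth (p i)" "\<And>i. i < n \<Longrightarrow> smooth (q i)"
    and "\<And>x. (\<Sum>i<n. p i x * q i x) = 0"
  shows "(\<Sum>i<n. deriv (p i) x * q i x) = - (\<Sum>i<n. p i x * deriv (q i) x)"
proof -
  have "((\<lambda>x. 0) has_real_derivative (\<Sum>i<n. deriv (p i) x * q i x) + (\<Sum>i<n. p i x * deriv (q i) x)) (at x)"
    using DERIV_pairing[of n p q x] assms by simp
  then show ?thesis using DERIV_unique[OF _ DERIV_const] by fastforce
qed

text \<open>Differentiating a pairing that vanishes for all x trades one derivative on q for one on
  p, with a minus sign. Inside the range a + b < d this propagates zeros; on its edge a + b = d it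
  transports the value of the top pairing, and (-1)^a counts the moves.\<close>

lemma pairing_derivatives:
  assumes p: "\<And>i. i < n \<Longrightarrow> smooth (p i)" and q: "\<And>i. i < n \<Longrightarrow> smooth (q i)"
    and zero: "\<And>k x. k < d \<Longrightarrow> (\<Sum>i<n. p i x * Dn k (q i) x) = 0"
  shows "a + b < d \<Longrightarrow> (\<Sum>i<n. Dn a (p i) x * Dn b (q i) x) = 0"
    and "a + b = d \<Longrightarrow> (\<Sum>i<n. Dn a (p i) x * Dn b (q i) x) =
      (- 1) ^ a * (\<Sum>i<n. p i x * Dn d (q i) x)"
proof -
  have 1: "\<forall>b x. a + b < d \<longrightarrow> (\<Sum>i<n. Dn a (p i) x * Dn b (q i) x) = 0" for a
  proof (induction a)
    case (Suc a)
    show ?case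
    proof (intro allI impI)
      fix b x assume "Suc a + b < d"
      then show "(\<Sum>i<n. Dn (Suc a) (p i) x * Dn b (q i) x) = 0"
        using pairing_shift_derivative[of n "\<lambda>i. Dn a (p i)" "\<lambda>i. Dn b (q i)" x]
          Suc[rule_format, of "Suc b" x] Suc[rule_format, of b] p q by (simp add: smooth_funpow_deriv)
    qed
  qed (use zero in auto)
  have 2: "\<forall>b x. a + b = d \<longrightarrow> (\<Sum>i<n. Dn a (p i) x * Dn b (q i) x) =
      (- 1) ^ a * (\<Sum>i<n. p i x * Dn d (q i) x)" for a
  proof (induction a)
    case (Suc a)
    show ?case
    proof (intro allI impI)
      fix b x assume "Suc a + b = d"
      then show "(\<Sum>i<n. Dn (Suc a) (p i) x * Dn b (q i) x) = (- 1) ^ Suc a * (\<Sum>i<n. p i x * Dn d (q i) x)"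
        using pairing_shift_derivative[of n "\<lambda>i. Dn a (p i)" "\<lambda>i. Dn b (q i)" x]
          Suc[rule_format, of "Suc b" x] 1[of a, rule_format, of b] p q by (simp add: smooth_funpow_deriv)
    qed
  qed auto
  show "a + b < d \<Longrightarrow> (\<Sum>i<n. Dn a (p i) x * Dn b (q i) x) = 0"
    "a + b = d \<Longrightarrow> (\<Sum>i<n. Dn a (p i) x * Dn b (q i) x) =
      (- 1) ^ a * (\<Sum>i<n. p i x * Dn d (q i) x)"
    using 1 2 by blast+
qed

text \<open>The roles of the two curves are exchanged: the envelope conditions differentiate the
  curve, whereas the construction by cofactors controls derivatives of the covector.\<close>

lemma pairing_derivatives_swap:
  assumes p: "\<And>i. i < n \<Longrightarrow> smooth (p i)" and q: "\<And>i. i < n \<Longrightarrow> smooth (q i)"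
    and zero: "\<And>k x. k < d \<Longrightarrow> (\<Sum>i<n. Dn k (p i) x * q i x) = 0"
  shows "k < d \<Longrightarrow> (\<Sum>i<n. p i x * Dn k (q i) x) = 0"
    and "(\<Sum>i<n. p i x * Dn d (q i) x) = (- 1) ^ d * (\<Sum>i<n. Dn d (p i) x * q i x)"
proof -
  have zero': "(\<Sum>i<n. q i x * Dn k (p i) x) = 0" if "k < d" for k x
    using zero[OF that] by (simp add: mult.commute)
  show "k < d \<Longrightarrow> (\<Sum>i<n. p i x * Dn k (q i) x) = 0"
    using pairing_derivatives(1)[OF q p zero', where d = d and b = 0 and a = k and x = x] by (simp add: mult.commute)
  show "(\<Sum>i<n. p i x * Dn d (q i) x) = (- 1) ^ d * (\<Sum>i<n. Dn d (p i) x * q i x)"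
    using pairing_derivatives(2)[OF q p zero', where d = d and b = 0 and a = d and x = x] by (simp add: mult.commute)
qed

text \<open>This is (-1)^(d(d+1)/2), the sign of reversing d + 1 columns; it collects the signs
  (-1)^i of the pairings on the diagonal.\<close>

definition alt_sign :: "nat \<Rightarrow> real" where "alt_sign d = (\<Prod>i<Suc d. (- 1) ^ i)"

lemma alt_sign_square: "alt_sign d * alt_sign d = 1"
  unfolding alt_sign_def prod.distrib[symmetric] by (simp flip: power_add)

text \<open>The columns are in reverse order, so that the matrix of pairings with the derivatives of a dual
  curve becomes triangular.\<close>

definition rev_wronskian :: "nat \<Rightarrow> (nat \<Rightarrow> real \<Rightarrow> real) \<Rightarrow> real \<Rightarrow> real" where
  "rev_wronskian d q x = mdet (Suc d) (\<lambda>i j. Dn (d - j) (q i) x)"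

lemma wronskian_mdet: "wronskian d p x = mdet (Suc d) (\<lambda>i j. Dn j (p i) x)"
  unfolding wronskian_def mdet_def by simp

text \<open>The product of the two matrices has as entry (i, j) the pairing of p^(i) with q^(d-j).
  The orders add up to less than d above the diagonal and to exactly d on it, so the matrix is
  triangular with the top pairing, up to sign, in each diagonal place.\<close>

lemma wronskian_mult_rev_wronskian:
  assumes p: "\<And>i. i < Suc d \<Longrightarrow> smooth (p i)" and q: "\<And>i. i < Suc d \<Longrightarrow> smooth (q i)"
    and zero: "\<And>k x. k < d \<Longrightarrow> (\<Sum>i<Suc d. p i x * Dn k (q i) x) = 0"
  shows "wronskian d p x * rev_wronskian d q x =
    alt_sign d * (\<Sum>i<Suc d. p i x * Dn d (q i) x) ^ Suc d"
proof -
  let ?n = "Suc d"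
  have "wronskian d p x * rev_wronskian d q x = mdet ?n (\<lambda>i j. Dn i (p j) x) * rev_wronskian d q x"
    unfolding wronskian_mdet by (subst mdet_transpose) (rule refl)
  also have "\<dots> = mdet ?n (\<lambda>i j. \<Sum>k<?n. Dn i (p k) x * Dn (d - j) (q k) x)"
    unfolding rev_wronskian_def by (rule mdet_mult[symmetric])
  also have "\<dots> = (\<Prod>i<?n. \<Sum>k<?n. Dn i (p k) x * Dn (d - i) (q k) x)"
  proof (rule mdet_lower_triangular)
    fix i j assume "i < j" "j < ?n"
    then show "(\<Sum>k<?n. Dn i (p k) x * Dn (d - j) (q k) x) = 0"
      by (intro pairing_derivatives(1)[OF p q zero, where d = d]) auto
  qed
  also have "\<dots> = (\<Prod>i<?n. (- 1) ^ i * (\<Sum>k<?n. p k x * Dn d (q k) x))"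
    by (rule prod.cong[OF refl], rule pairing_derivatives(2)[OF p q zero, where d = d]) auto
  also have "\<dots> = alt_sign d * (\<Sum>k<?n. p k x * Dn d (q k) x) ^ ?n"
    unfolding alt_sign_def by (simp only: prod.distrib prod_constant card_lessThan)
  finally show ?thesis .
qed

subsection \<open>The operator annihilating a curve\<close>

definition ode_coeff :: "nat \<Rightarrow> (nat \<Rightarrow> real \<Rightarrow> real) \<Rightarrow> nat \<Rightarrow> real \<Rightarrow> real" where
  "ode_coeff d L j x = - (\<Sum>i<Suc d. Dn (Suc d) (L i) x * cof (Suc d) (\<lambda>i j. Dn j (L i) x) i j)"

text \<open>Abel's argument: in the derivative of the constant Wronskian, differentiating any column
  but the last repeats the next column, and the remaining summand is the coefficient of order d up
  to sign.\<close>

lemma ode_coeff_top: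
  assumes "normalized_lift d L" shows "ode_coeff d L d x = 0"
proof -
  let ?n = "Suc d"
  have s: "smooth (L i)" if "i < ?n" for i using assms that unfolding normalized_lift_def by auto
  have W: "mdet ?n (\<lambda>i j. Dn j (L i) x) = 1" for x
    using assms unfolding normalized_lift_def wronskian_mdet by blast
  have "((\<lambda>x. mdet ?n (\<lambda>i j. Dn j (L i) x)) has_real_derivative
    (\<Sum>c<?n. mdet ?n (\<lambda>i j. if j = c then Dn (Suc j) (L i) x else Dn j (L i) x))) (at x)"
    by (rule DERIV_mdet) (use s in \<open>auto intro: smooth_DERIV smooth_funpow_deriv\<close>)
  then have "0 = (\<Sum>c<?n. mdet ?n (\<lambda>i j. if j = c then Dn (Suc j) (L i) x else Dn j (L i) x))"
    unfolding W using DERIV_unique[OF DERIV_const] by blast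
  also have "\<dots> = (\<Sum>c<?n. if c = d then mdet ?n (\<lambda>i j. if j = d then Dn (Suc j) (L i) x else Dn j (L i) x) else 0)"
  proof (rule sum.cong[OF refl])
    fix c assume "c \<in> {..<?n}"
    then have "mdet ?n (\<lambda>i j. if j = c then Dn (Suc j) (L i) x else Dn j (L i) x) = 0" if "c \<noteq> d"
      using that by (intro mdet_identical_columns[of c ?n "Suc c"]) auto
    then show "mdet ?n (\<lambda>i j. if j = c then Dn (Suc j) (L i) x else Dn j (L i) x) =
      (if c = d then mdet ?n (\<lambda>i j. if j = d then Dn (Suc j) (L i) x else Dn j (L i) x) else 0)" by auto
  qed
  also have "\<dots> = mdet ?n (\<lambda>i j. if j = d then Dn (Suc d) (L i) x else Dn j (L i) x)"
    by (simp, rule mdet_cong, simp)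
  also have "\<dots> = - ode_coeff d L d x"
    unfolding ode_coeff_def by (subst mdet_replace_column) auto
  finally show ?thesis by simp
qed

lemma satisfies_ode_iff:
  assumes "normalized_lift d L"
  shows "satisfies_ode d U L \<longleftrightarrow> (\<forall>j<d. \<forall>x. U j x = ode_coeff d L j x)"
proof -
  let ?n = "Suc d"
  have W: "mdet ?n (\<lambda>i j. Dn j (L i) x) = 1" for x
    using assms unfolding normalized_lift_def wronskian_mdet by blast
  have ode: "Dn ?n (L i) x + (\<Sum>j<d. ode_coeff d L j x * Dn j (L i) x) = 0" if "i < ?n" for i x
  proof -
    let ?f = "\<lambda>i j. Dn j (L i) x"
    have "(\<Sum>j<d. ode_coeff d L j x * ?f i j) = (\<Sum>j<?n. ode_coeff d L j x * ?f i j)"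
      by (simp add: ode_coeff_top[OF assms])
    also have "\<dots> = - (\<Sum>r<?n. Dn ?n (L r) x * (\<Sum>j<?n. ?f i j * cof ?n ?f r j))"
      unfolding ode_coeff_def sum_distrib_left sum_distrib_right sum_negf[symmetric] mult_minus_left
      by (subst sum.swap) (simp only: mult_ac)
    also have "\<dots> = - (\<Sum>r<?n. if i = r then Dn ?n (L r) x else 0)"
      using that by (intro arg_cong[of _ _ uminus] sum.cong refl, subst sum_row_cof) (auto simp: W)
    also have "\<dots> = - Dn ?n (L i) x" using that by simp
    finally show ?thesis by simp
  qed
  show ?thesis
  proof
    assume U: "satisfies_ode d U L"
    show "\<forall>j<d. \<forall>x. U j x = ode_coeff d L j x"
    proof (intro allI impI)
      fix j x assume "j < d"
      \<comment> \<open>The operator has no term of order d; the vector of differences is therefore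
        padded by 0 at index d to match the d + 1 columns of the Wronskian.\<close>
      define v where "v j = (if j < d then U j x - ode_coeff d L j x else 0)" for j
      have "v j = 0"
      proof (rule mdet_nonzero_kernel'[of ?n "\<lambda>i j. Dn j (L i) x"])
        fix i assume i: "i < ?n"
        have "(\<Sum>j<d. U j x * Dn j (L i) x) = (\<Sum>j<d. ode_coeff d L j x * Dn j (L i) x)"
        proof -
          have "Dn ?n (L i) x + (\<Sum>j<d. U j x * Dn j (L i) x) = 0"
            using U i unfolding satisfies_ode_def by (simp only: less_Suc_eq_le Suc_eq_plus1)
          then show ?thesis using ode[OF i, of x] by linarith
        qed
        then show "(\<Sum>j<?n. Dn j (L i) x * v j) = 0"
          unfolding v_def by (simp add: right_diff_distrib sum_subtractf mult.commute)
      qed (use \<open>j < d\<close> W in auto)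
      then show "U j x = ode_coeff d L j x" using \<open>j < d\<close> by (simp add: v_def)
    qed
  next
    assume U: "\<forall>j<d. \<forall>x. U j x = ode_coeff d L j x"
    show "satisfies_ode d U L"
      unfolding satisfies_ode_def
    proof (intro allI impI)
      fix i x assume "i \<le> d"
      have "(\<Sum>j<d. U j x * Dn j (L i) x) = (\<Sum>j<d. ode_coeff d L j x * Dn j (L i) x)"
        using U by (intro sum.cong) auto
      then show "Dn (d + 1) (L i) x + (\<Sum>j<d. U j x * Dn j (L i) x) = 0"
        using ode[of i x] \<open>i \<le> d\<close> by simp
    qed
  qed
qed

lemma expansion_ode_coeff:
  assumes "\<And>i. i < Suc d \<Longrightarrow> \<exists>b. expansion (L i) (G i) b" "j < Suc d"
  shows "\<exists>w. expansion (\<lambda>\<epsilon> x. ode_coeff d (\<lambda>i. L i \<epsilon>) j x) (ode_coeff d G j) w"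
proof -
  have D: "\<exists>b. expansion (\<lambda>\<epsilon>. Dn k (L i \<epsilon>)) (Dn k (G i)) b" if "i < Suc d" for i k
    using assms(1)[OF that] by (elim exE) (rule exI, erule expansion_funpow_deriv)
  have "\<exists>b. expansion (\<lambda>\<epsilon> x. Dn (Suc d) (L i \<epsilon>) x * cof (Suc d) (\<lambda>i j. Dn j (L i \<epsilon>) x) i j)
     (\<lambda>x. Dn (Suc d) (G i) x * cof (Suc d) (\<lambda>i j. Dn j (G i) x) i j) b" if i: "i \<in> {..<Suc d}" for i
  proof -
    from i have i': "i < Suc d" by simp
    obtain b where b: "expansion (\<lambda>\<epsilon>. Dn (Suc d) (L i \<epsilon>)) (Dn (Suc d) (G i)) b" using D[OF i'] ..
    obtain b' where b': "expansion (\<lambda>\<epsilon> x. cof (Suc d) (\<lambda>i j. Dn j (L i \<epsilon>) x) i j) (\<lambda>x. cof (Suc d) (\<lambda>i j. Dn j (G i) x) i j) b'"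
      using expansion_cof[of "Suc d" "\<lambda>i j \<epsilon>. Dn j (L i \<epsilon>)" "\<lambda>i j. Dn j (G i)" i j, OF D i' assms(2)] ..
    show ?thesis by (rule exI, rule expansion_mult[OF b b'])
  qed
  from expansion_sum_ex[of "{..<Suc d}", OF this]
  obtain b where "expansion (\<lambda>\<epsilon> x. \<Sum>i<Suc d. Dn (Suc d) (L i \<epsilon>) x * cof (Suc d) (\<lambda>i j. Dn j (L i \<epsilon>) x) i j)
    (\<lambda>x. \<Sum>i<Suc d. Dn (Suc d) (G i) x * cof (Suc d) (\<lambda>i j. Dn j (G i) x) i j) b" ..
  from expansion_cmult[OF this, of "-1"] show ?thesis
    unfolding ode_coeff_def by (intro exI[of _ "\<lambda>x. - 1 * b x"]) simp
qed

subsection \<open>The coframe of the hyperplanes\<close>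

definition frame_col :: "nat \<Rightarrow> (nat \<Rightarrow> nat \<Rightarrow> real) \<Rightarrow> (nat \<Rightarrow> real \<Rightarrow> real) \<Rightarrow> nat \<Rightarrow> nat \<Rightarrow> real \<Rightarrow> real \<Rightarrow> real" where
  "frame_col d \<alpha> G m i \<epsilon> x = (\<Sum>c<d. \<alpha> m c / \<epsilon> ^ m * G i (x + node d c * \<epsilon>))"

text \<open>The last column is a placeholder that the cofactors along it do not see. Pairing a
  vector with this covector puts that vector in the last column, so the covector annihilates the
  frame.\<close>

definition hyp_cov :: "nat \<Rightarrow> (nat \<Rightarrow> nat \<Rightarrow> real) \<Rightarrow> (nat \<Rightarrow> real \<Rightarrow> real) \<Rightarrow> real \<Rightarrow> nat \<Rightarrow> real \<Rightarrow> real" where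
  "hyp_cov d \<alpha> G \<epsilon> i x = cof (Suc d) (\<lambda>r c. if c < d then frame_col d \<alpha> G c r \<epsilon> x else 0) i d"

text \<open>The dual curve of G: the covector of its osculating hyperplane, and the limit of
  \<open>hyp_cov\<close>.\<close>

definition osc_cov :: "nat \<Rightarrow> (nat \<Rightarrow> real \<Rightarrow> real) \<Rightarrow> nat \<Rightarrow> real \<Rightarrow> real" where
  "osc_cov d G i x = cof (Suc d) (\<lambda>r c. if c < d then Dn c (G r) x else 0) i d"

lemma mdet_last_column:
  "mdet (Suc d) (\<lambda>r c. if c < d then f r c else v r) = (\<Sum>i<Suc d. v i * cof (Suc d) (\<lambda>r c. if c < d then f r c else 0) i d)"
proof -
  have "mdet (Suc d) (\<lambda>r c. if c < d then f r c else v r) = mdet (Suc d) (\<lambda>r c. if c = d then v r else if c < d then f r c else 0)"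
    by (rule mdet_cong) auto
  then show ?thesis by (simp only: mdet_replace_column lessI)
qed

lemma sum_hyp_cov:
  "(\<Sum>i<Suc d. v i * hyp_cov d \<alpha> G \<epsilon> i x) = mdet (Suc d) (\<lambda>r c. if c < d then frame_col d \<alpha> G c r \<epsilon> x else v r)"
  unfolding hyp_cov_def mdet_last_column ..

lemma sum_osc_cov:
  "(\<Sum>i<Suc d. v i * osc_cov d G i x) = mdet (Suc d) (\<lambda>r c. if c < d then Dn c (G r) x else v r)"
  unfolding osc_cov_def mdet_last_column ..

lemma hyp_cov_frame_col:
  assumes "m < d" shows "(\<Sum>i<Suc d. frame_col d \<alpha> G m i \<epsilon> x * hyp_cov d \<alpha> G \<epsilon> i x) = 0"
  unfolding sum_hyp_cov by (rule mdet_identical_columns[of m _ d]) (use assms in auto)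

lemma osc_cov_derivs:
  "k < d \<Longrightarrow> (\<Sum>i<Suc d. Dn k (G i) x * osc_cov d G i x) = 0"
  "(\<Sum>i<Suc d. Dn d (G i) x * osc_cov d G i x) = wronskian d G x"
proof -
  show "k < d \<Longrightarrow> (\<Sum>i<Suc d. Dn k (G i) x * osc_cov d G i x) = 0"
    unfolding sum_osc_cov by (rule mdet_identical_columns[of k _ d]) auto
  show "(\<Sum>i<Suc d. Dn d (G i) x * osc_cov d G i x) = wronskian d G x"
    unfolding sum_osc_cov wronskian_mdet by (rule mdet_cong) (auto simp: less_Suc_eq)
qed

lemma smooth_frame_col: "smooth (G i) \<Longrightarrow> smooth (frame_col d \<alpha> G m i \<epsilon>)"
  unfolding frame_col_def by (intro smooth_sum smooth_cmult smooth_shift)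

lemma smooth_hyp_cov:
  assumes "\<And>i. i < Suc d \<Longrightarrow> smooth (G i)" "i < Suc d" shows "smooth (hyp_cov d \<alpha> G \<epsilon> i)"
proof -
  have "smooth (if c < d then frame_col d \<alpha> G c r \<epsilon> else (\<lambda>_. 0))" if "r < Suc d" for r c
    using assms(1)[OF that] by (auto intro: smooth_frame_col)
  then have "smooth (\<lambda>x. cof (Suc d) (\<lambda>r c. (if c < d then frame_col d \<alpha> G c r \<epsilon> else (\<lambda>_. 0)) x) i d)"
    by (intro smooth_cof) (use assms in auto)
  moreover have "(\<lambda>x. cof (Suc d) (\<lambda>r c. (if c < d then frame_col d \<alpha> G c r \<epsilon> else (\<lambda>_. 0)) x) i d) = hyp_cov d \<alpha> G \<epsilon> i"
    unfolding hyp_cov_def by (intro ext cof_cong) auto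
  ultimately show ?thesis by simp
qed

lemma smooth_osc_cov:
  assumes "\<And>i. i < Suc d \<Longrightarrow> smooth (G i)" "i < Suc d" shows "smooth (osc_cov d G i)"
proof -
  have "smooth (if c < d then Dn c (G r) else (\<lambda>_. 0))" if "r < Suc d" for r c
    using assms(1)[OF that] by (auto intro: smooth_funpow_deriv)
  then have "smooth (\<lambda>x. cof (Suc d) (\<lambda>r c. (if c < d then Dn c (G r) else (\<lambda>_. 0)) x) i d)"
    by (intro smooth_cof) (use assms in auto)
  moreover have "(\<lambda>x. cof (Suc d) (\<lambda>r c. (if c < d then Dn c (G r) else (\<lambda>_. 0)) x) i d) = osc_cov d G i"
    unfolding osc_cov_def by (intro ext cof_cong) auto
  ultimately show ?thesis by simp
qed

lemma expansion_hyp_cov: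
  assumes "\<And>m i. m < d \<Longrightarrow> i < Suc d \<Longrightarrow> \<exists>b. expansion (frame_col d \<alpha> G m i) (Dn m (G i)) b" "i < Suc d"
  shows "\<exists>b. expansion (\<lambda>\<epsilon>. hyp_cov d \<alpha> G \<epsilon> i) (osc_cov d G i) b"
proof -
  have "\<exists>b. expansion (if c < d then frame_col d \<alpha> G c r else (\<lambda>_ _. 0)) (if c < d then Dn c (G r) else (\<lambda>_. 0)) b"
    if "r < Suc d" "c < Suc d" for r c
    using assms(1)[of c r] that expansion_const[of "\<lambda>_. 0"] by (cases "c < d") auto
  from expansion_cof[of "Suc d" "\<lambda>r c. if c < d then frame_col d \<alpha> G c r else (\<lambda>_ _. 0)"
      "\<lambda>r c. if c < d then Dn c (G r) else (\<lambda>_. 0)" i d, OF this assms(2)]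
  have "\<exists>b. expansion (\<lambda>\<epsilon> x. cof (Suc d) (\<lambda>r c. (if c < d then frame_col d \<alpha> G c r else (\<lambda>_ _. 0)) \<epsilon> x) i d)
     (\<lambda>x. cof (Suc d) (\<lambda>r c. (if c < d then Dn c (G r) else (\<lambda>_. 0)) x) i d) b" by simp
  moreover have "(\<lambda>\<epsilon> x. cof (Suc d) (\<lambda>r c. (if c < d then frame_col d \<alpha> G c r else (\<lambda>_ _. 0)) \<epsilon> x) i d) = (\<lambda>\<epsilon>. hyp_cov d \<alpha> G \<epsilon> i)"
    unfolding hyp_cov_def by (intro ext cof_cong) auto
  moreover have "(\<lambda>x. cof (Suc d) (\<lambda>r c. (if c < d then Dn c (G r) else (\<lambda>_. 0)) x) i d) = osc_cov d G i"
    unfolding osc_cov_def by (intro ext cof_cong) auto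
  ultimately show ?thesis by (simp only:)
qed

text \<open>Passing from the points at the nodes to the frame multiplies the matrix on the right by
  \<open>T\<close>. The moment conditions say that the matrix \<open>S\<close> of scaled Taylor
  monomials inverts \<open>T\<close>, so the two determinants differ by a nonzero factor.\<close>

lemma hyperplane_det_eq_0_iff:
  assumes \<alpha>: "\<And>m k. m < d \<Longrightarrow> k < d \<Longrightarrow> (\<Sum>c<d. \<alpha> m c * node d c ^ k) = (if k = m then fact m else 0)"
    and "\<epsilon> \<noteq> 0"
  shows "hyperplane_det d G \<epsilon> x v = 0 \<longleftrightarrow> (\<Sum>i<Suc d. v i * hyp_cov d \<alpha> G \<epsilon> i x) = 0"
proof -
  define H where "H r c = (if c < d then G r (x + node d c * \<epsilon>) else v r)" for r c
  \<comment> \<open>The extra index d is an identity block that leaves the last column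
    \<open>v\<close> alone.\<close>
  define T where "T c m = (if c < d \<and> m < d then \<alpha> m c / \<epsilon> ^ m else if c = m then 1 else 0)" for c m
  define S where "S k c = (if k < d \<and> c < d then \<epsilon> ^ k * node d c ^ k / fact k else if k = c then 1 else 0)" for k c
  have "mdet (Suc d) S * mdet (Suc d) T = mdet (Suc d) (\<lambda>k m. \<Sum>c<Suc d. S k c * T c m)"
    by (rule mdet_mult[symmetric])
  also have "\<dots> = mdet (Suc d) (\<lambda>k m. if k = m then 1 else 0)"
  proof (rule mdet_cong)
    fix k m assume "k < Suc d" "m < Suc d"
    show "(\<Sum>c<Suc d. S k c * T c m) = (if k = m then 1 else 0)"
    proof (cases "k < d \<and> m < d")
      case True
      then have "(\<Sum>c<Suc d. S k c * T c m) = (\<Sum>c<d. \<epsilon> ^ k * node d c ^ k / fact k * (\<alpha> m c / \<epsilon> ^ m))"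
        by (simp add: S_def T_def)
      also have "\<dots> = \<epsilon> ^ k / fact k / \<epsilon> ^ m * (\<Sum>c<d. \<alpha> m c * node d c ^ k)"
        unfolding sum_distrib_left by (rule sum.cong) auto
      also have "\<dots> = (if k = m then 1 else 0)" using \<alpha>[of m k] True assms(2) by simp
      finally show ?thesis .
    next
      case False
      then have "k = d \<or> m = d" using \<open>k < Suc d\<close> \<open>m < Suc d\<close> by auto
      then show ?thesis
        by (cases "k = d"; cases "m = d") (auto simp: S_def T_def intro!: sum.neutral)
    qed
  qed
  also have "\<dots> = 1" by (subst mdet_lower_triangular) auto
  finally have T: "mdet (Suc d) T \<noteq> 0" by auto
  have "(\<Sum>i<Suc d. v i * hyp_cov d \<alpha> G \<epsilon> i x) = mdet (Suc d) (\<lambda>r m. \<Sum>c<Suc d. H r c * T c m)"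
    unfolding sum_hyp_cov
  proof (rule mdet_cong)
    fix r m assume "r < Suc d" "m < Suc d"
    show "(if m < d then frame_col d \<alpha> G m r \<epsilon> x else v r) = (\<Sum>c<Suc d. H r c * T c m)"
    proof (cases "m < d")
      case True
      then show ?thesis by (simp add: H_def T_def frame_col_def mult.commute)
    next
      case False
      then have "m = d" using \<open>m < Suc d\<close> by simp
      then show ?thesis by (simp add: H_def T_def)
    qed
  qed
  also have "\<dots> = mdet (Suc d) H * mdet (Suc d) T" by (rule mdet_mult)
  also have "mdet (Suc d) H = hyperplane_det d G \<epsilon> x v"
    unfolding hyperplane_det_def mdet_def H_def by simp
  finally show ?thesis using T by simp
qed

subsection \<open>Quasi-periodicity\<close>

lemma quasi_periodic_sum:
  assumes "quasi_periodic d M G" "i < Suc d"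
  shows "G i (x + 2 * pi) = (\<Sum>k<Suc d. M $$ (i, k) * G k x)"
proof -
  have M: "M \<in> carrier_mat (Suc d) (Suc d)" using assms(1) unfolding quasi_periodic_def by simp
  have "Matrix.vec (d + 1) (\<lambda>i. G i (x + 2 * pi)) = M *\<^sub>v Matrix.vec (d + 1) (\<lambda>i. G i x)"
    using assms(1) unfolding quasi_periodic_def by blast
  from arg_cong[OF this, of "\<lambda>v. vec_index v i"] show ?thesis
    using assms(2) M by (simp add: scalar_prod_def atLeast0LessThan)
qed

text \<open>Covectors transform by the inverse transpose of M, written here without an inverse. M is
  pulled out of the whole determinant at once by viewing column j of M as M applied to the j-th unit
  vector; det M = 1 leaves no factor.\<close>

lemma hyp_cov_quasi_periodic:
  assumes "quasi_periodic d M G" "j < Suc d"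
  shows "(\<Sum>i<Suc d. M $$ (i, j) * hyp_cov d \<alpha> G \<epsilon> i (x + 2 * pi)) = hyp_cov d \<alpha> G \<epsilon> j x"
proof -
  let ?e = "\<lambda>i. if i = j then 1 else 0 :: real"
  have M: "M \<in> carrier_mat (Suc d) (Suc d)" and det: "Determinant.det M = 1"
    using assms(1) unfolding quasi_periodic_def by simp_all
  have detM: "mdet (Suc d) (\<lambda>i k. M $$ (i, k)) = 1"
    unfolding mdet_def det[symmetric] by (rule arg_cong[of _ _ Determinant.det], rule eq_matI) (use M in auto)
  have fc: "frame_col d \<alpha> G c r \<epsilon> (x + 2 * pi) = (\<Sum>k<Suc d. M $$ (r, k) * frame_col d \<alpha> G c k \<epsilon> x)" if "r < Suc d" for c r
  proof -
    have "frame_col d \<alpha> G c r \<epsilon> (x + 2 * pi) = (\<Sum>b<d. \<alpha> c b / \<epsilon> ^ c * (\<Sum>k<Suc d. M $$ (r, k) * G k (x + node d b * \<epsilon>)))"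
      unfolding frame_col_def
    proof (rule sum.cong[OF refl])
      fix b
      have "x + 2 * pi + node d b * \<epsilon> = x + node d b * \<epsilon> + 2 * pi" by simp
      then show "\<alpha> c b / \<epsilon> ^ c * G r (x + 2 * pi + node d b * \<epsilon>) =
         \<alpha> c b / \<epsilon> ^ c * (\<Sum>k<Suc d. M $$ (r, k) * G k (x + node d b * \<epsilon>))"
        by (simp only: quasi_periodic_sum[OF assms(1) that])
    qed
    then show ?thesis unfolding frame_col_def sum_distrib_left by (subst sum.swap) (simp only: mult_ac)
  qed
  have "(\<Sum>i<Suc d. M $$ (i, j) * hyp_cov d \<alpha> G \<epsilon> i (x + 2 * pi)) =
     mdet (Suc d) (\<lambda>r c. \<Sum>k<Suc d. M $$ (r, k) * (if c < d then frame_col d \<alpha> G c k \<epsilon> x else ?e k))"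
    unfolding sum_hyp_cov
  proof (rule mdet_cong)
    fix r c assume "r < Suc d" "c < Suc d"
    then show "(if c < d then frame_col d \<alpha> G c r \<epsilon> (x + 2 * pi) else M $$ (r, j)) =
       (\<Sum>k<Suc d. M $$ (r, k) * (if c < d then frame_col d \<alpha> G c k \<epsilon> x else ?e k))"
      using fc assms(2) by (cases "c < d") (simp_all add: if_distrib[of "\<lambda>x. _ * x"] del: sum.lessThan_Suc cong: if_cong)
  qed
  also have "\<dots> = mdet (Suc d) (\<lambda>r c. if c < d then frame_col d \<alpha> G c r \<epsilon> x else ?e r)"
    unfolding mdet_mult detM by simp
  also have "\<dots> = (\<Sum>i<Suc d. ?e i * hyp_cov d \<alpha> G \<epsilon> i x)" unfolding sum_hyp_cov ..
  also have "\<dots> = hyp_cov d \<alpha> G \<epsilon> j x"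
    using assms(2) by (simp add: if_distrib[of "\<lambda>x. x * _"] del: sum.lessThan_Suc cong: if_cong)
  finally show ?thesis .
qed

lemma rev_wronskian_periodic:
  assumes "quasi_periodic d M G" "\<And>i. i < Suc d \<Longrightarrow> smooth (G i)"
  shows "rev_wronskian d (hyp_cov d \<alpha> G \<epsilon>) (x + 2 * pi) = rev_wronskian d (hyp_cov d \<alpha> G \<epsilon>) x"
proof -
  have M: "M \<in> carrier_mat (Suc d) (Suc d)" and det: "Determinant.det M = 1"
    using assms(1) unfolding quasi_periodic_def by simp_all
  have detM: "mdet (Suc d) (\<lambda>i k. M $$ (i, k)) = 1"
    unfolding mdet_def det[symmetric] by (rule arg_cong[of _ _ Determinant.det], rule eq_matI) (use M in auto)
  have s: "smooth (hyp_cov d \<alpha> G \<epsilon> i)" if "i < Suc d" for i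
    using smooth_hyp_cov[OF assms(2) that] .
  have "Dn k (hyp_cov d \<alpha> G \<epsilon> j) x = (\<Sum>i<Suc d. M $$ (i, j) * Dn k (hyp_cov d \<alpha> G \<epsilon> i) (x + 2 * pi))"
    if "j < Suc d" for j k
  proof -
    have "hyp_cov d \<alpha> G \<epsilon> j = (\<lambda>x. \<Sum>i<Suc d. M $$ (i, j) * hyp_cov d \<alpha> G \<epsilon> i (x + 2 * pi))"
      using hyp_cov_quasi_periodic[OF assms(1) that] by (intro ext) (rule sym)
    then have "Dn k (hyp_cov d \<alpha> G \<epsilon> j) x = Dn k (\<lambda>x. \<Sum>i<Suc d. M $$ (i, j) * hyp_cov d \<alpha> G \<epsilon> i (x + 2 * pi)) x"
      by (rule arg_cong)
    also have "Dn k (\<lambda>x. \<Sum>i<Suc d. M $$ (i, j) * hyp_cov d \<alpha> G \<epsilon> i (x + 2 * pi)) =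
        (\<lambda>x. \<Sum>i<Suc d. Dn k (\<lambda>x. M $$ (i, j) * hyp_cov d \<alpha> G \<epsilon> i (x + 2 * pi)) x)"
      by (rule funpow_deriv_sum) (intro smooth_cmult smooth_shift s, simp)
    also have "\<dots> x = (\<Sum>i<Suc d. M $$ (i, j) * Dn k (hyp_cov d \<alpha> G \<epsilon> i) (x + 2 * pi))"
    proof (rule sum.cong[OF refl])
      fix i assume "i \<in> {..<Suc d}"
      then have "smooth (hyp_cov d \<alpha> G \<epsilon> i)" using s by simp
      then show "Dn k (\<lambda>x. M $$ (i, j) * hyp_cov d \<alpha> G \<epsilon> i (x + 2 * pi)) x = M $$ (i, j) * Dn k (hyp_cov d \<alpha> G \<epsilon> i) (x + 2 * pi)"
        by (simp only: funpow_deriv_cmult[OF smooth_shift] funpow_deriv_shift)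
    qed
    finally show ?thesis .
  qed
  then have "rev_wronskian d (hyp_cov d \<alpha> G \<epsilon>) x = mdet (Suc d) (\<lambda>j k. \<Sum>i<Suc d. M $$ (i, j) * Dn (d - k) (hyp_cov d \<alpha> G \<epsilon> i) (x + 2 * pi))"
    unfolding rev_wronskian_def by (intro mdet_cong) simp
  also have "\<dots> = mdet (Suc d) (\<lambda>j i. M $$ (i, j)) * rev_wronskian d (hyp_cov d \<alpha> G \<epsilon>) (x + 2 * pi)"
    unfolding rev_wronskian_def by (rule mdet_mult)
  also have "mdet (Suc d) (\<lambda>j i. M $$ (i, j)) = mdet (Suc d) (\<lambda>i j. M $$ (i, j))"
    by (rule mdet_transpose)
  finally show ?thesis by (simp add: detM)
qed

lemma periodic_representative:
  fixes f :: "real \<Rightarrow> real"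
  assumes "\<And>x. f (x + 2 * pi) = f x"
  obtains y where "y \<in> {0..2 * pi}" "f x = f y"
proof -
  have n: "f (x + 2 * pi * real n) = f x" for n x
  proof (induction n)
    case (Suc n)
    have "x + 2 * pi * real (Suc n) = (x + 2 * pi * real n) + 2 * pi" by (simp add: algebra_simps)
    then show ?case using assms Suc by metis
  qed simp
  have z: "f (x + 2 * pi * of_int k) = f x" for k x
  proof (cases "k \<ge> 0")
    case True
    then show ?thesis using n[of x "nat k"] by simp
  next
    case False
    then show ?thesis using n[of "x + 2 * pi * of_int k" "nat (- k)"] by simp
  qed
  define k where "k = \<lfloor>x / (2 * pi)\<rfloor>"
  have "of_int k \<le> x / (2 * pi)" "x / (2 * pi) < of_int k + 1" unfolding k_def by linarith+
  then have "2 * pi * of_int k \<le> x" "x < 2 * pi * of_int k + 2 * pi"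
    by (simp_all add: field_simps)
  then show thesis using that[of "x + 2 * pi * of_int (- k)"] z[of x "- k"] by simp
qed

text \<open>The expansion is uniform only on compact sets; periodicity reduces the whole line to
  [0, 2 pi].\<close>

lemma eventually_periodic_pos:
  assumes "expansion f (\<lambda>_. 1) b" "\<And>\<epsilon> x. f \<epsilon> (x + 2 * pi) = f \<epsilon> x"
  shows "\<forall>\<^sub>F \<epsilon> in at_right 0. \<forall>x. f \<epsilon> x > 0"
proof -
  note f = expansionD[OF assms(1)]
  have "bigO_pow 2 (\<lambda>\<epsilon> x. (f \<epsilon> x - (1 + \<epsilon>\<^sup>2 * b x)) + \<epsilon>\<^sup>2 * b x)"
    by (rule bigO_pow_add[OF bigO_pow_mono[OF f(4)] bigO_pow_monom[OF f(2)]]) simp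
  then have "compact {0..2 * pi} \<longrightarrow> (\<exists>K. \<forall>\<^sub>F \<epsilon> in at_right 0. \<forall>x\<in>{0..2 * pi}.
      \<bar>(f \<epsilon> x - (1 + \<epsilon>\<^sup>2 * b x)) + \<epsilon>\<^sup>2 * b x\<bar> \<le> K * \<epsilon>\<^sup>2)"
    unfolding bigO_pow_def by (rule spec)
  then obtain K where K: "\<forall>\<^sub>F \<epsilon> in at_right 0. \<forall>x\<in>{0..2 * pi}. \<bar>(f \<epsilon> x - (1 + \<epsilon>\<^sup>2 * b x)) + \<epsilon>\<^sup>2 * b x\<bar> \<le> K * \<epsilon>\<^sup>2"
    by auto
  have "((\<lambda>\<epsilon>::real. K * \<epsilon>\<^sup>2) \<longlongrightarrow> 0) (at_right 0)"
    by (auto intro!: tendsto_eq_intros)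
  then have "\<forall>\<^sub>F \<epsilon> in at_right 0. K * \<epsilon>\<^sup>2 < 1"
    by (rule order_tendstoD) simp
  with K show ?thesis
  proof eventually_elim
    case (elim \<epsilon>)
    show ?case
    proof
      fix x
      obtain y where y: "y \<in> {0..2 * pi}" "f \<epsilon> x = f \<epsilon> y"
        using periodic_representative[of "f \<epsilon>" x] assms(2) by metis
      with elim have "\<bar>(f \<epsilon> y - (1 + \<epsilon>\<^sup>2 * b y)) + \<epsilon>\<^sup>2 * b y\<bar> < 1" by fastforce
      then show "f \<epsilon> x > 0" using y(2) by simp
    qed
  qed
qed

subsection \<open>Existence and uniqueness of the envelope\<close>

text \<open>The contacts of the derivatives of G with its osculating covector are moved onto
  derivatives of the covector. Moving d derivatives costs (-1)^d, and the power d + 1 of this sign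
  is 1 because d(d+1) is even, which leaves \<open>alt_sign d\<close> for the Wronskian of the dual
  curve.\<close>

lemma osc_cov_pairing:
  assumes "normalized_lift d G"
  shows "k < d \<Longrightarrow> (\<Sum>i<Suc d. G i x * Dn k (osc_cov d G i) x) = 0"
    and "(\<Sum>i<Suc d. G i x * Dn d (osc_cov d G i) x) = (- 1) ^ d"
    and "rev_wronskian d (osc_cov d G) x = alt_sign d"
proof -
  have G: "smooth (G i)" if "i < Suc d" for i using assms that unfolding normalized_lift_def by auto
  have o: "smooth (osc_cov d G i)" if "i < Suc d" for i using smooth_osc_cov[OF G that] .
  have W: "wronskian d G x = 1" for x using assms unfolding normalized_lift_def by blast
  have 1: "(\<Sum>i<Suc d. G i x * Dn k (osc_cov d G i) x) = 0" if "k < d" for k x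
    by (rule pairing_derivatives_swap(1)[OF G o osc_cov_derivs(1) that]) auto
  have 2: "(\<Sum>i<Suc d. G i x * Dn d (osc_cov d G i) x) = (- 1) ^ d"
    using pairing_derivatives_swap(2)[where n = "Suc d" and p = G and q = "osc_cov d G" and d = d and x = x, OF G o osc_cov_derivs(1)]
    unfolding osc_cov_derivs(2) W by simp
  show "k < d \<Longrightarrow> (\<Sum>i<Suc d. G i x * Dn k (osc_cov d G i) x) = 0"
    "(\<Sum>i<Suc d. G i x * Dn d (osc_cov d G i) x) = (- 1) ^ d"
    by (fact 1 2)+
  have "((- 1 :: real) ^ d) ^ Suc d = 1" by (cases "even d") auto
  then show "rev_wronskian d (osc_cov d G) x = alt_sign d"
    using wronskian_mult_rev_wronskian[where p = G and q = "osc_cov d G" and d = d and x = x, OF G o 1]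
    unfolding 2 W by simp
qed

text \<open>The dual curve and its derivatives up to order d serve as coordinates: vectors are
  identified by their pairings, first the limit of \<open>env\<close>, later its second order
  term.\<close>

lemma osc_cov_kernel:
  assumes "normalized_lift d G" "\<And>k. k \<le> d \<Longrightarrow> (\<Sum>i<Suc d. v i * Dn k (osc_cov d G i) x) = 0" "r < Suc d"
  shows "v r = 0"
proof (rule mdet_nonzero_kernel[of "Suc d" "\<lambda>i j. Dn (d - j) (osc_cov d G i) x"])
  have "alt_sign d \<noteq> 0" using alt_sign_square[of d] by auto
  then show "mdet (Suc d) (\<lambda>i j. Dn (d - j) (osc_cov d G i) x) \<noteq> 0"
    using osc_cov_pairing(3)[OF assms(1), of x] unfolding rev_wronskian_def by simp
qed (use assms in auto)

text \<open>The choice of nodes enters through two facts: \<open>moments\<close> relates the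
  determinant condition to the covector, and \<open>frame\<close> provides the expansion in
  \<epsilon>.\<close>

locale envelope_data =
  fixes d :: nat and \<alpha> :: "nat \<Rightarrow> nat \<Rightarrow> real" and \<beta> :: "nat \<Rightarrow> real" and G :: "nat \<Rightarrow> real \<Rightarrow> real" and M :: "real mat"
  assumes lift: "normalized_lift d G" and qp: "quasi_periodic d M G"
    and moments: "\<And>m k. m < d \<Longrightarrow> k < d \<Longrightarrow> (\<Sum>c<d. \<alpha> m c * node d c ^ k) = (if k = m then fact m else 0)"
    and frame: "\<And>m i. m < d \<Longrightarrow> i < Suc d \<Longrightarrow>
      expansion (frame_col d \<alpha> G m i) (Dn m (G i)) (\<lambda>x. \<beta> m * Dn (m + 2) (G i) x)"
begin

abbreviation "cov \<equiv> hyp_cov d \<alpha> G"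
abbreviation "cov0 \<equiv> osc_cov d G"

text \<open>The Wronskian of the covector curve, with the sign that makes its limit 1.\<close>

definition "dens \<epsilon> x = alt_sign d * rev_wronskian d (cov \<epsilon>) x"

text \<open>Column 0 carries the derivative of order d, so its cofactors annihilate the covector and
  its derivatives below order d. A scale factor \<rho> makes the Wronskian equal to \<rho>^(d+1)
  \<open>dens\<close>^d, hence the exponent -d/(d+1). The signs in front make the limit G rather
  than -G.\<close>

definition "env \<epsilon> i x = alt_sign d * (- 1) ^ d *
  (dens \<epsilon> x powr (- real d / real (Suc d)) * cof (Suc d) (\<lambda>i j. Dn (d - j) (cov \<epsilon> i) x) i 0)"

lemma smooth_G: "i < Suc d \<Longrightarrow> smooth (G i)"
  using lift unfolding normalized_lift_def by auto

lemma smooth_cov: "i < Suc d \<Longrightarrow> smooth (cov \<epsilon> i)"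
  using smooth_hyp_cov[OF smooth_G] .

lemma smooth_cov0: "i < Suc d \<Longrightarrow> smooth (cov0 i)"
  using smooth_osc_cov[OF smooth_G] .

lemma wronskian_G: "wronskian d G x = 1"
  using lift unfolding normalized_lift_def by blast

lemma expansion_cov: "i < Suc d \<Longrightarrow> \<exists>b. expansion (\<lambda>\<epsilon>. cov \<epsilon> i) (cov0 i) b"
  by (rule expansion_hyp_cov) (rule exI, rule frame)

lemma expansion_cov_deriv: "i < Suc d \<Longrightarrow> \<exists>b. expansion (\<lambda>\<epsilon>. Dn k (cov \<epsilon> i)) (Dn k (cov0 i)) b"
  by (drule expansion_cov, elim exE) (rule exI, erule expansion_funpow_deriv)

lemma expansion_dens: "\<exists>b. expansion dens (\<lambda>_. 1) b"
proof -
  have "\<exists>b. expansion (\<lambda>\<epsilon> x. mdet (Suc d) (\<lambda>i j. Dn (d - j) (cov \<epsilon> i) x)) (\<lambda>x. mdet (Suc d) (\<lambda>i j. Dn (d - j) (cov0 i) x)) b"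
    using expansion_mdet[of "Suc d" "\<lambda>i j \<epsilon>. Dn (d - j) (cov \<epsilon> i)" "\<lambda>i j. Dn (d - j) (cov0 i)", OF expansion_cov_deriv] .
  then obtain b where "expansion (\<lambda>\<epsilon>. rev_wronskian d (cov \<epsilon>)) (rev_wronskian d cov0) b"
    unfolding rev_wronskian_def ..
  from expansion_cmult[OF this, of "alt_sign d"]
  have "expansion dens (\<lambda>x. 1) (\<lambda>x. alt_sign d * b x)"
    unfolding dens_def osc_cov_pairing(3)[OF lift] alt_sign_square .
  then show ?thesis by (rule exI[of _ "\<lambda>x. alt_sign d * b x"])
qed

lemma eventually_dens_pos: "\<forall>\<^sub>F \<epsilon> in at_right 0. \<forall>x. dens \<epsilon> x > 0"
proof -
  obtain b where "expansion dens (\<lambda>_. 1) b" using expansion_dens ..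
  then show ?thesis
    by (rule eventually_periodic_pos) (simp add: dens_def rev_wronskian_periodic[OF qp smooth_G])
qed

lemma smooth_dens: "smooth (dens \<epsilon>)"
  unfolding dens_def rev_wronskian_def
  by (intro smooth_mult smooth_const smooth_mdet smooth_funpow_deriv smooth_cov)

lemma smooth_env:
  assumes "\<forall>x. dens \<epsilon> x > 0" "i < Suc d" shows "smooth (env \<epsilon> i)"
  unfolding env_def
  by (intro smooth_mult smooth_const smooth_powr smooth_dens assms smooth_cof smooth_funpow_deriv smooth_cov) simp_all

lemma env_pairing:
  assumes "k \<le> d"
  shows "(\<Sum>i<Suc d. env \<epsilon> i x * Dn k (cov \<epsilon> i) x) =
    (if k = d then (- 1) ^ d * (dens \<epsilon> x powr (- real d / real (Suc d)) * dens \<epsilon> x) else 0)"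
proof -
  let ?f = "\<lambda>i j. Dn (d - j) (cov \<epsilon> i) x"
  have "(\<Sum>i<Suc d. env \<epsilon> i x * Dn k (cov \<epsilon> i) x) =
     alt_sign d * (- 1) ^ d * (dens \<epsilon> x powr (- real d / real (Suc d)) * (\<Sum>i<Suc d. ?f i (d - k) * cof (Suc d) ?f i 0))"
    unfolding env_def sum_distrib_left using assms by (intro sum.cong) (auto simp only: diff_diff_cancel mult_ac)
  also have "(\<Sum>i<Suc d. ?f i (d - k) * cof (Suc d) ?f i 0) = (if d - k = 0 then mdet (Suc d) ?f else 0)"
    by (rule sum_column_cof) auto
  finally show ?thesis using assms by (auto simp: dens_def rev_wronskian_def)
qed

lemma env_cov:
  assumes "\<forall>x. dens \<epsilon> x > 0" "k < d"
  shows "(\<Sum>i<Suc d. Dn k (env \<epsilon> i) x * cov \<epsilon> i x) = 0"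
proof -
  have "(\<Sum>i<Suc d. env \<epsilon> i x * Dn k (cov \<epsilon> i) x) = 0" if "k < d" for k x
    using env_pairing[of k \<epsilon> x] that by simp
  from pairing_derivatives(1)[OF smooth_env[OF assms(1)] smooth_cov this, where b = 0 and a = k] assms(2)
  show ?thesis by simp
qed

lemma hyperplane_det_iff:
  "\<epsilon> > 0 \<Longrightarrow> hyperplane_det d G \<epsilon> x v = 0 \<longleftrightarrow> (\<Sum>i<Suc d. v i * cov \<epsilon> i x) = 0"
  by (rule hyperplane_det_eq_0_iff[OF moments]) auto

lemma envelope_lift_env:
  assumes pos: "\<forall>x. dens \<epsilon> x > 0" and "\<epsilon> > 0"
  shows "envelope_lift d G \<epsilon> (env \<epsilon>)"
proof -
  have W: "wronskian d (env \<epsilon>) x = 1" for x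
  proof -
    let ?\<delta> = "dens \<epsilon> x"
    have p: "?\<delta> > 0" using pos by blast
    have 0: "(\<Sum>i<Suc d. env \<epsilon> i x * Dn k (cov \<epsilon> i) x) = 0" if "k < d" for k x
      using env_pairing[of k \<epsilon> x] that by simp
    have e: "(- real d / real (Suc d) + 1) * real (Suc d) = 1" by (simp add: field_simps)
    have "(?\<delta> powr (- real d / real (Suc d)) * ?\<delta>) ^ Suc d = (?\<delta> powr (- real d / real (Suc d) + 1)) ^ Suc d"
      using p by (simp only: powr_add powr_one)
    also have "\<dots> = ?\<delta> powr ((- real d / real (Suc d) + 1) * real (Suc d))"
      using p by (subst powr_power) (simp_all only: mult.commute less_imp_neq[THEN not_sym] not_False_eq_True)
    finally have "(?\<delta> powr (- real d / real (Suc d)) * ?\<delta>) ^ Suc d = ?\<delta>"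
      unfolding e using p by simp
    moreover have "((- 1 :: real) ^ d) ^ Suc d = 1" by (cases "even d") auto
    moreover have "wronskian d (env \<epsilon>) x * rev_wronskian d (cov \<epsilon>) x =
        alt_sign d * (\<Sum>i<Suc d. env \<epsilon> i x * Dn d (cov \<epsilon> i) x) ^ Suc d"
      by (rule wronskian_mult_rev_wronskian) (erule smooth_env[OF pos] smooth_cov 0)+
    ultimately have "wronskian d (env \<epsilon>) x * rev_wronskian d (cov \<epsilon>) x = alt_sign d * ?\<delta>"
      by (simp only: env_pairing[OF order_refl] power_mult_distrib if_True mult_1_left refl)
    also have "\<dots> = rev_wronskian d (cov \<epsilon>) x"
      unfolding dens_def mult.assoc[symmetric] alt_sign_square by simp
    finally show ?thesis using p unfolding dens_def by auto
  qed
  show ?thesis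
    unfolding envelope_lift_def normalized_lift_def hyperplane_det_iff[OF \<open>\<epsilon> > 0\<close>]
    using W smooth_env[OF pos] env_cov[OF pos] by (auto simp: less_Suc_eq_le simp del: sum.lessThan_Suc)
qed

lemma expansion_env:
  assumes "i < Suc d" shows "\<exists>B. expansion (\<lambda>\<epsilon>. env \<epsilon> i) (G i) B"
proof -
  let ?q = "- real d / real (Suc d)"
  \<comment> \<open>The limit of \<open>env\<close>, since the power of \<open>dens\<close> tends to
    1; its pairings with the dual curve identify it with G.\<close>
  define H where "H i x = alt_sign d * (- 1) ^ d * cof (Suc d) (\<lambda>i j. Dn (d - j) (cov0 i) x) i 0" for i x
  obtain b where "expansion dens (\<lambda>_. 1) b" using expansion_dens ..
  from expansion_powr[OF this eventually_dens_pos, of ?q]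
  have \<rho>: "expansion (\<lambda>\<epsilon> x. dens \<epsilon> x powr ?q) (\<lambda>_. 1) (\<lambda>x. ?q * b x)" .
  have "\<exists>b. expansion (\<lambda>\<epsilon> x. cof (Suc d) (\<lambda>i j. Dn (d - j) (cov \<epsilon> i) x) i 0)
      (\<lambda>x. cof (Suc d) (\<lambda>i j. Dn (d - j) (cov0 i) x) i 0) b"
    using expansion_cof[of "Suc d" "\<lambda>i j \<epsilon>. Dn (d - j) (cov \<epsilon> i)" "\<lambda>i j. Dn (d - j) (cov0 i)" i 0,
        OF expansion_cov_deriv assms zero_less_Suc] .
  then obtain b' where "expansion (\<lambda>\<epsilon> x. cof (Suc d) (\<lambda>i j. Dn (d - j) (cov \<epsilon> i) x) i 0)
      (\<lambda>x. cof (Suc d) (\<lambda>i j. Dn (d - j) (cov0 i) x) i 0) b'" ..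
  from expansion_cmult[OF expansion_mult[OF \<rho> this], of "alt_sign d * (- 1) ^ d"]
  have "\<exists>B. expansion (\<lambda>\<epsilon>. env \<epsilon> i) (H i) B"
    unfolding env_def H_def mult_1_left
    by (intro exI[of _ "\<lambda>x. alt_sign d * (- 1) ^ d * (1 * b' x + ?q * b x * cof (Suc d) (\<lambda>i j. Dn (d - j) (cov0 i) x) i 0)"])
      (simp only: mult_1_left)
  moreover have "H i = G i"
  proof
    fix x
    have "H i x - G i x = 0"
    proof (rule osc_cov_kernel[OF lift _ assms])
      fix k assume k: "k \<le> d"
      let ?f = "\<lambda>i j. Dn (d - j) (cov0 i) x"
      have "(\<Sum>i<Suc d. H i x * Dn k (cov0 i) x) = alt_sign d * (- 1) ^ d * (\<Sum>i<Suc d. ?f i (d - k) * cof (Suc d) ?f i 0)"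
        unfolding H_def sum_distrib_left using k by (intro sum.cong) (auto simp only: diff_diff_cancel mult_ac)
      also have "(\<Sum>i<Suc d. ?f i (d - k) * cof (Suc d) ?f i 0) = (if d - k = 0 then mdet (Suc d) ?f else 0)"
        by (rule sum_column_cof) auto
      also have "mdet (Suc d) ?f = alt_sign d"
        using osc_cov_pairing(3)[OF lift, of x] unfolding rev_wronskian_def .
      also have "alt_sign d * (- 1) ^ d * (if d - k = 0 then alt_sign d else 0) = (if k = d then (- 1) ^ d else 0)"
        using k alt_sign_square[of d] by (auto simp: mult_ac)
      also have "\<dots> = (\<Sum>i<Suc d. G i x * Dn k (cov0 i) x)"
        using osc_cov_pairing(1,2)[OF lift, where x = x] k by (cases "k = d") (auto simp del: sum.lessThan_Suc)
      finally show "(\<Sum>i<Suc d. (H i x - G i x) * Dn k (cov0 i) x) = 0"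
        unfolding left_diff_distrib sum_subtractf by simp
    qed
    then show "H i x = G i x" by simp
  qed
  ultimately show ?thesis by simp
qed

text \<open>An envelope lift is proportional to \<open>env \<epsilon>\<close>, and the normalization forces the factor to be a
  constant sign.\<close>

lemma envelope_unique:
  assumes pos: "\<forall>x. dens \<epsilon> x > 0" and "\<epsilon> > 0" and L: "envelope_lift d G \<epsilon> L"
  shows "\<exists>s. \<forall>i<Suc d. L i = (\<lambda>x. s * env \<epsilon> i x)"
proof -
  let ?E = "env \<epsilon>"
  have sL: "smooth (L i)" if "i < Suc d" for i
    using L that unfolding envelope_lift_def normalized_lift_def by auto
  note sE = smooth_env[OF pos]
  have WL: "wronskian d L x = 1" for x using L unfolding envelope_lift_def normalized_lift_def by blast
  have WE: "wronskian d ?E x = 1" for x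
    using envelope_lift_env[OF pos \<open>\<epsilon> > 0\<close>] unfolding envelope_lift_def normalized_lift_def by blast
  have "(\<Sum>i<Suc d. Dn k (L i) x * cov \<epsilon> i x) = 0" if "k < d" for k x
    using L that unfolding envelope_lift_def hyperplane_det_iff[OF \<open>\<epsilon> > 0\<close>] by blast
  then have L0: "(\<Sum>i<Suc d. L i x * Dn k (cov \<epsilon> i) x) = 0" if "k < d" for k x
    by (intro pairing_derivatives_swap(1)[where d = d, OF sL smooth_cov _ that])
  have E0: "(\<Sum>i<Suc d. ?E i x * Dn k (cov \<epsilon> i) x) = 0" if "k < d" for k x
    using env_pairing[of k \<epsilon> x] that by simp
  define a where "a x = (\<Sum>i<Suc d. L i x * Dn d (cov \<epsilon> i) x)" for x
  \<comment> \<open>Both curves annihilate the covector and its derivatives below order d, so each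
    is determined by one remaining pairing, and the quotient of these pairings is the factor between
    the curves.\<close>
  define b where "b x = (\<Sum>i<Suc d. ?E i x * Dn d (cov \<epsilon> i) x)" for x
  have \<Delta>: "rev_wronskian d (cov \<epsilon>) x \<noteq> 0" for x
    using pos[rule_format, of x] unfolding dens_def by auto
  have a: "rev_wronskian d (cov \<epsilon>) x = alt_sign d * a x ^ Suc d" for x
  proof -
    have "wronskian d (L) x * rev_wronskian d (cov \<epsilon>) x = alt_sign d * a x ^ Suc d"
      unfolding a_def by (rule wronskian_mult_rev_wronskian) (erule sL smooth_cov L0)+
    then show ?thesis by (simp only: WL mult_1_left)
  qed
  have b: "rev_wronskian d (cov \<epsilon>) x = alt_sign d * b x ^ Suc d" for x
  proof -
    have "wronskian d (?E) x * rev_wronskian d (cov \<epsilon>) x = alt_sign d * b x ^ Suc d"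
      unfolding b_def by (rule wronskian_mult_rev_wronskian) (erule sE smooth_cov E0)+
    then show ?thesis by (simp only: WE mult_1_left)
  qed
  have b_ne: "b x \<noteq> 0" for x using \<Delta>[of x] b[of x] by auto
  define s where "s x = a x / b x" for x
  have "s x ^ Suc d = 1" for x
  proof -
    have "a x ^ Suc d = b x ^ Suc d" using a[of x] b[of x] \<Delta>[of x] by auto
    then show ?thesis unfolding s_def power_divide using b_ne[of x] by simp
  qed
  then have "\<bar>s x\<bar> ^ Suc d = 1 ^ Suc d" for x by (simp only: power_abs[symmetric] abs_one power_one)
  then have s1: "\<bar>s x\<bar> = 1" for x by (rule power_inject_base) auto
  have Lprop: "L i x = s x * ?E i x" if "i < Suc d" for i x
  proof -
    have "L i x - s x * ?E i x = 0"
    proof (rule mdet_nonzero_kernel[of "Suc d" "\<lambda>i j. Dn (d - j) (cov \<epsilon> i) x" "\<lambda>i. L i x - s x * ?E i x" i])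
      show "mdet (Suc d) (\<lambda>i j. Dn (d - j) (cov \<epsilon> i) x) \<noteq> 0"
        using \<Delta>[of x] unfolding rev_wronskian_def .
      fix j
      have "(\<Sum>i<Suc d. (L i x - s x * ?E i x) * Dn (d - j) (cov \<epsilon> i) x) =
          (\<Sum>i<Suc d. L i x * Dn (d - j) (cov \<epsilon> i) x) - s x * (\<Sum>i<Suc d. ?E i x * Dn (d - j) (cov \<epsilon> i) x)"
        unfolding sum_distrib_left left_diff_distrib sum_subtractf by (simp only: mult.assoc)
      also have "\<dots> = 0"
      proof (cases "d - j < d")
        case False
        then have "d - j = d" by simp
        then show ?thesis using b_ne[of x] unfolding s_def by (simp only: a_def[symmetric] b_def[symmetric]) simp
      qed (simp only: L0 E0 mult_zero_right diff_zero)
      finally show "(\<Sum>i<Suc d. (L i x - s x * ?E i x) * Dn (d - j) (cov \<epsilon> i) x) = 0" .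
    qed (rule that)
    then show ?thesis by simp
  qed
  have sm: "smooth a" "smooth b"
    unfolding a_def[abs_def] b_def[abs_def] using sL sE smooth_cov
    by (auto intro!: smooth_sum smooth_mult smooth_funpow_deriv simp del: sum.lessThan_Suc)
  \<comment> \<open>Pointwise only |s| = 1 is known; s is differentiable as a quotient of smooth
    functions, and s^2 = 1 gives 2 s s' = 0, so the sign cannot jump.\<close>
  have "(s has_real_derivative 0) (at x)" for x
  proof -
    define D where "D = (deriv a x * b x - a x * deriv b x) / (b x * b x)"
    have D: "(s has_real_derivative D) (at x)"
      unfolding D_def s_def[abs_def] by (rule DERIV_divide[OF smooth_DERIV[OF sm(1)] smooth_DERIV[OF sm(2)] b_ne])
    have "(\<lambda>x. s x * s x) = (\<lambda>x. 1)"
      using s1 by (intro ext) (metis abs_mult_self_eq mult_1_left)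
    then have "D * s x + s x * D = 0"
      using DERIV_mult'[OF D D] DERIV_unique[OF _ DERIV_const] by (metis add.commute mult.commute)
    then have "D = 0" using s1[of x] by auto
    then show ?thesis using D by simp
  qed
  then have s_const: "s x = s 0" for x by (intro DERIV_isconst_all) blast
  show ?thesis
  proof (rule exI[of _ "s 0"], intro allI impI ext)
    fix i x assume "i < Suc d"
    from Lprop[OF this, of x] show "L i x = s 0 * env \<epsilon> i x" by (simp only: s_const[of x])
  qed
qed

text \<open>A constant multiple of a curve is annihilated by the same operator. Hence the sign left
  open by \<open>envelope_unique\<close>, which may change with \<epsilon>, does not affect
  \<open>U\<close>.\<close>

lemma envelope_ode_coeff:
  assumes "\<forall>x. dens \<epsilon> x > 0" "\<epsilon> > 0" and L: "envelope_lift d G \<epsilon> L" and U: "satisfies_ode d U L" and "j < d"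
  shows "U j x = ode_coeff d (env \<epsilon>) j x"
proof -
  have lE: "normalized_lift d (env \<epsilon>)"
    using envelope_lift_env[OF assms(1,2)] unfolding envelope_lift_def by blast
  have lL: "normalized_lift d L" using L unfolding envelope_lift_def by blast
  obtain s where "\<forall>i<Suc d. L i = (\<lambda>x. s * env \<epsilon> i x)"
    using envelope_unique[OF assms(1,2) L] ..
  then have s: "L i = (\<lambda>x. s * env \<epsilon> i x)" if "i < Suc d" for i using that by blast
  have E: "satisfies_ode d (ode_coeff d (env \<epsilon>)) (env \<epsilon>)"
    unfolding satisfies_ode_iff[OF lE] by simp
  have D: "Dn k (L i) x = s * Dn k (env \<epsilon> i) x" if "i < Suc d" for i k x
    unfolding s[OF that] funpow_deriv_cmult[OF smooth_env[OF assms(1) that]] ..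
  have "satisfies_ode d (ode_coeff d (env \<epsilon>)) L"
    unfolding satisfies_ode_def
  proof (intro allI impI)
    fix i x assume "i \<le> d"
    then have i: "i < Suc d" by simp
    have "Dn (d + 1) (L i) x + (\<Sum>j<d. ode_coeff d (env \<epsilon>) j x * Dn j (L i) x)
      = s * (Dn (d + 1) (env \<epsilon> i) x + (\<Sum>j<d. ode_coeff d (env \<epsilon>) j x * Dn j (env \<epsilon> i) x))"
      unfolding D[OF i] distrib_left sum_distrib_left by (simp only: mult_ac)
    also have "\<dots> = 0" using E \<open>i \<le> d\<close> unfolding satisfies_ode_def by simp
    finally show "Dn (d + 1) (L i) x + (\<Sum>j<d. ode_coeff d (env \<epsilon>) j x * Dn j (L i) x) = 0" .
  qed
  then have "ode_coeff d (env \<epsilon>) j x = ode_coeff d L j x"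
    unfolding satisfies_ode_iff[OF lL] using \<open>j < d\<close> by simp
  moreover have "U j x = ode_coeff d L j x"
    using U \<open>j < d\<close> unfolding satisfies_ode_iff[OF lL] by simp
  ultimately show ?thesis by simp
qed

end

subsection \<open>Roots of pseudo-differential operators\<close>

text \<open>Any convenient finite superset may replace the index set of the product. This also
  excludes the default value 0 of a sum over an infinite set.\<close>

lemma psido_mult_eq:
  assumes "finite S" "\<And>i l. A i \<noteq> (\<lambda>_. 0) \<Longrightarrow> B (k - i + int l) \<noteq> (\<lambda>_. 0) \<Longrightarrow> (i, l) \<in> S"
  shows "psido_mult A B k x = (\<Sum>(i, l)\<in>S. ((of_int i :: real) gchoose l) * A i x * Dn l (B (k - i + int l)) x)"
  unfolding psido_mult_def
  by (rule sum.mono_neutral_left) (use assms in \<open>auto simp: funpow_deriv_const\<close>)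

text \<open>\<open>pow_coeff r n p\<close> is the coefficient of \<open>\<partial>\<^bsup>n-p\<^esup>\<close> in \<open>(\<Sum>\<^sub>q r\<^sub>q \<partial>\<^bsup>1-q\<^esup>)\<^sup>n\<close>.\<close>

primrec pow_coeff :: "(nat \<Rightarrow> real \<Rightarrow> real) \<Rightarrow> nat \<Rightarrow> nat \<Rightarrow> real \<Rightarrow> real" where
  "pow_coeff r 0 = (\<lambda>p x. if p = 0 then 1 else 0)"
| "pow_coeff r (Suc n) = (\<lambda>p x. \<Sum>q\<le>p. \<Sum>l\<le>p - q. ((1 - real q) gchoose l) * r q x * Dn l (pow_coeff r n (p - q - l)) x)"

text \<open>Orders are counted downwards from the leading one, i = 1 - q and k = n - p, which turns
  bounded-above series into sequences over the naturals and every coefficient into a finite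
  sum.\<close>

lemma psido_power_pow_coeff:
  assumes "\<And>k. k > 1 \<Longrightarrow> R k = (\<lambda>_. 0)"
  shows "psido_power R n (int n - int p) = pow_coeff (\<lambda>q. R (1 - int q)) n p"
    and "k > int n \<Longrightarrow> psido_power R n k = (\<lambda>_. 0)"
proof -
  have "(\<forall>p. psido_power R n (int n - int p) = pow_coeff (\<lambda>q. R (1 - int q)) n p) \<and>
    (\<forall>k>int n. psido_power R n k = (\<lambda>_. 0))"
  proof (induction n)
    case 0
    show ?case by (auto simp: fun_eq_iff)
  next
    case (Suc n)
    have le1: "i \<le> 1" if "R i \<noteq> (\<lambda>_. 0)" for i using assms[of i] that by linarith
    have len: "k \<le> int n" if "psido_power R n k \<noteq> (\<lambda>_. 0)" for k using Suc that by (meson not_le)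
    have "psido_power R (Suc n) (int (Suc n) - int p) x = pow_coeff (\<lambda>q. R (1 - int q)) (Suc n) p x" for p x
    proof -
      let ?k = "int (Suc n) - int p"
      let ?I = "SIGMA q:{..p}. {..p - q}"
      let ?S = "(\<lambda>(q, l). (1 - int q, l)) ` ?I"
      have "psido_power R (Suc n) ?k x = (\<Sum>(i, l)\<in>?S. ((of_int i :: real) gchoose l) * R i x * Dn l (psido_power R n (?k - i + int l)) x)"
        unfolding psido_power.simps
      proof (rule psido_mult_eq)
        fix i l assume "R i \<noteq> (\<lambda>_. 0)" "psido_power R n (?k - i + int l) \<noteq> (\<lambda>_. 0)"
        then have "i \<le> 1" "?k - i + int l \<le> int n" using le1 len by blast+
        then show "(i, l) \<in> ?S" by (intro image_eqI[of _ _ "(nat (1 - i), l)"]) auto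
      qed auto
      also have "\<dots> = (\<Sum>(q, l)\<in>?I. ((of_int (1 - int q) :: real) gchoose l) * R (1 - int q) x * Dn l (psido_power R n (?k - (1 - int q) + int l)) x)"
        by (subst sum.reindex) (auto simp: inj_on_def case_prod_unfold)
      also have "\<dots> = (\<Sum>(q, l)\<in>?I. ((1 - real q) gchoose l) * R (1 - int q) x * Dn l (pow_coeff (\<lambda>q. R (1 - int q)) n (p - q - l)) x)"
      proof (rule sum.cong[OF refl], clarify)
        fix q l assume "q \<le> p" "l \<le> p - q"
        then have "?k - (1 - int q) + int l = int n - int (p - q - l)" by (simp add: of_nat_diff)
        then have "psido_power R n (?k - (1 - int q) + int l) = pow_coeff (\<lambda>q. R (1 - int q)) n (p - q - l)"
          using Suc by (simp only:)
        then show "((of_int (1 - int q) :: real) gchoose l) * R (1 - int q) x * Dn l (psido_power R n (?k - (1 - int q) + int l)) x =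
           ((1 - real q) gchoose l) * R (1 - int q) x * Dn l (pow_coeff (\<lambda>q. R (1 - int q)) n (p - q - l)) x"
          by simp
      qed
      also have "\<dots> = pow_coeff (\<lambda>q. R (1 - int q)) (Suc n) p x"
        unfolding pow_coeff.simps by (subst sum.Sigma) auto
      finally show ?thesis .
    qed
    moreover have "psido_power R (Suc n) k x = 0" if k: "k > int (Suc n)" for k x
    proof -
      have "psido_mult R (psido_power R n) k x = (\<Sum>(i, l)\<in>{}. ((of_int i :: real) gchoose l) * R i x * Dn l (psido_power R n (k - i + int l)) x)"
      proof (rule psido_mult_eq)
        fix i l assume "R i \<noteq> (\<lambda>_. 0)" "psido_power R n (k - i + int l) \<noteq> (\<lambda>_. 0)"
        then have "i \<le> 1" "k - i + int l \<le> int n" using le1 len by blast+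
        then show "(i, l) \<in> {}" using k by simp
      qed auto
      then show ?thesis by simp
    qed
    ultimately show ?case by (auto simp: fun_eq_iff simp del: psido_power.simps pow_coeff.simps)
  qed
  then show "psido_power R n (int n - int p) = pow_coeff (\<lambda>q. R (1 - int q)) n p"
    "k > int n \<Longrightarrow> psido_power R n k = (\<lambda>_. 0)" by blast+
qed

lemma smooth_pow_coeff:
  assumes "\<And>q. smooth (r q)" shows "smooth (pow_coeff r n p)"
proof (induction n arbitrary: p)
  case 0
  show ?case unfolding pow_coeff.simps by (rule smooth_const)
next
  case (Suc n)
  show ?case unfolding pow_coeff.simps
    by (intro smooth_sum smooth_mult smooth_const smooth_funpow_deriv assms Suc)
qed

lemma pow_coeff_zero: "r 0 = (\<lambda>_. 1) \<Longrightarrow> pow_coeff r n 0 = (\<lambda>_. 1)"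
  by (induction n) auto

lemma pow_coeff_cong: "(\<And>q. q \<le> p \<Longrightarrow> r q = r' q) \<Longrightarrow> pow_coeff r n p = pow_coeff r' n p"
proof (induction n arbitrary: p)
  case (Suc n)
  have "pow_coeff r n (p - q - l) = pow_coeff r' n (p - q - l)" for q l
    by (rule Suc.IH) (use Suc.prems in auto)
  then show ?case unfolding pow_coeff.simps using Suc.prems by (intro ext sum.cong) auto
qed simp

text \<open>The entry \<open>r p\<close> reaches coefficient p only when all other factors
  contribute their leading 1, and there are n places for it; terms with a derivative involve entries
  below p only. This triangular shape gives both uniqueness and recursive existence of
  roots.\<close>

lemma pow_coeff_diff:
  assumes "r 0 = (\<lambda>_. 1)" "r' 0 = (\<lambda>_. 1)" "p > 0" "\<And>q. q < p \<Longrightarrow> r q = r' q"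
  shows "pow_coeff r n p x - pow_coeff r' n p x = real n * (r p x - r' p x)"
proof (induction n)
  case (Suc n)
  define T where "T r q l = ((1 - real q) gchoose l) * r q x * Dn l (pow_coeff r n (p - q - l)) x" for r q l
  have eq: "pow_coeff r n s = pow_coeff r' n s" if "s < p" for s
    by (rule pow_coeff_cong) (use assms that in auto)
  have zero: "pow_coeff r n 0 = (\<lambda>_. 1)" "pow_coeff r' n 0 = (\<lambda>_. 1)"
    by (rule pow_coeff_zero, rule assms)+
  have Td: "T r q l - T r' q l = (if l = 0 then (if q = 0 then real n * (r p x - r' p x) else 0) + (if q = p then r p x - r' p x else 0) else 0)"
    if "q \<le> p" "l \<le> p - q" for q l
  proof -
    have "q = 0 \<and> l = 0 \<or> q = 0 \<and> l > 0 \<or> q = p \<and> q > 0 \<or> q < p \<and> q > 0" using that by auto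
    then consider "q = 0" "l = 0" | "q = 0" "l > 0" | "q = p" "q > 0" | "q < p" "q > 0" by blast
    then show ?thesis
    proof cases
      case 1
      then show ?thesis using Suc assms by (simp add: T_def)
    next
      case 2
      then show ?thesis using eq[of "p - l"] assms by (simp add: T_def)
    next
      case 3
      then show ?thesis using that zero by (simp add: T_def)
    next
      case 4
      then show ?thesis using eq[of "p - q - l"] assms by (simp add: T_def)
    qed
  qed
  have "pow_coeff r (Suc n) p x - pow_coeff r' (Suc n) p x = (\<Sum>q\<le>p. \<Sum>l\<le>p - q. T r q l - T r' q l)"
    unfolding pow_coeff.simps T_def sum_subtractf ..
  also have "\<dots> = (\<Sum>q\<le>p. \<Sum>l\<le>p - q. (if l = 0 then (if q = 0 then real n * (r p x - r' p x) else 0) + (if q = p then r p x - r' p x else 0) else 0))"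
    by (intro sum.cong refl) (use Td in auto)
  also have "\<dots> = (\<Sum>q\<le>p. (if q = 0 then real n * (r p x - r' p x) else 0) + (if q = p then r p x - r' p x else 0))"
    by simp
  also have "\<dots> = real (Suc n) * (r p x - r' p x)"
    unfolding sum.distrib by (simp add: algebra_simps)
  finally show ?case .
qed simp

text \<open>The powers of \<partial> itself: the reference against which
  \<open>pow_coeff_diff\<close> computes the first coefficients in \<open>kdv_Q_2\<close>.\<close>

lemma pow_coeff_trivial: "pow_coeff (\<lambda>q x. if q = 0 then 1 else 0) n p = (\<lambda>x. if p = 0 then 1 else 0)"
proof (induction n arbitrary: p)
  case (Suc n)
  have "(\<Sum>q\<le>p. \<Sum>l\<le>p - q. ((1 - real q) gchoose l) * (if q = 0 then 1 else 0) * Dn l (\<lambda>x. if p - q - l = 0 then 1 else 0) x) =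
     (if p = 0 then 1 else 0)" for x :: real
  proof -
    have "(\<Sum>q\<le>p. \<Sum>l\<le>p - q. ((1 - real q) gchoose l) * (if q = 0 then 1 else 0) * Dn l (\<lambda>x. if p - q - l = 0 then 1 else 0) x) =
       (\<Sum>q\<le>p. if q = 0 then \<Sum>l\<le>p. (1 gchoose l) * Dn l (\<lambda>x. if p - l = 0 then 1 else 0) x else 0)"
      by (intro sum.cong refl) auto
    also have "\<dots> = (\<Sum>l\<le>p. (1 gchoose l) * Dn l (\<lambda>x. if p - l = 0 then 1 else 0) x)"
      by (simp only: sum.delta finite_atMost) simp
    also have "\<dots> = (\<Sum>l\<le>p. if l = 0 then (if p = 0 then 1 else 0) else 0)"
      unfolding funpow_deriv_const by (intro sum.cong refl) auto
    also have "\<dots> = (if p = 0 then 1 else 0)" by simp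
    finally show ?thesis .
  qed
  then show ?case unfolding pow_coeff.simps Suc by (simp only:)
qed simp

lemma pow_coeff_inject:
  assumes "r 0 = (\<lambda>_. 1)" "r' 0 = (\<lambda>_. 1)" "n > 0" "\<And>p. pow_coeff r n p = pow_coeff r' n p"
  shows "r p = r' p"
proof (induction p rule: less_induct)
  case (less p)
  show ?case
  proof (cases "p = 0")
    case False
    then show ?thesis
      using pow_coeff_diff[of r r' p n] assms less by (intro ext) simp
  qed (simp add: assms)
qed

lemma pow_coeff_surj:
  assumes "a 0 = (\<lambda>_. 1)" "\<And>p. smooth (a p)" "n > 0"
  shows "\<exists>r. r 0 = (\<lambda>_. 1) \<and> (\<forall>q. smooth (r q)) \<and> (\<forall>p. pow_coeff r n p = a p)"
proof -
  \<comment> \<open>\<open>g p\<close> matches the coefficients up to p. The next step changes only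
    entry p + 1, dividing the defect by n as \<open>pow_coeff_diff\<close> dictates, so the diagonal
    of \<open>g\<close> is the root.\<close>
  define g where "g = rec_nat (\<lambda>q x. if q = 0 then 1 else 0)
    (\<lambda>p h. h(Suc p := (\<lambda>x. (1 / real n) * (a (Suc p) x - pow_coeff h n (Suc p) x))))"
  have g0: "g 0 = (\<lambda>q x. if q = 0 then 1 else 0)"
    and gS: "g (Suc p) = (g p)(Suc p := (\<lambda>x. (1 / real n) * (a (Suc p) x - pow_coeff (g p) n (Suc p) x)))" for p
    by (simp_all add: g_def)
  have sm: "smooth (g p q)" for p q
  proof (induction p arbitrary: q)
    case 0
    show ?case unfolding g0 by (rule smooth_const)
  next
    case (Suc p)
    have "smooth (\<lambda>x. (1 / real n) * (a (Suc p) x - pow_coeff (g p) n (Suc p) x))"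
      by (intro smooth_cmult smooth_diff smooth_pow_coeff assms(2) Suc)
    then show ?case unfolding gS fun_upd_def using Suc by simp
  qed
  have zero: "q > p \<Longrightarrow> g p q = (\<lambda>_. 0)" for p q
    by (induction p) (auto simp: g0 gS)
  have stable: "q \<le> p \<Longrightarrow> g p q = g q q" for p q
  proof (induction p)
    case (Suc p)
    then show ?case by (cases "q = Suc p") (auto simp: gS)
  qed simp
  define r where "r q = g q q" for q
  have r0: "r 0 = (\<lambda>_. 1)" by (simp add: r_def g0)
  have g0': "g p 0 = (\<lambda>_. 1)" for p using stable[of 0 p] r0 by (simp add: r_def)
  have "pow_coeff r n p = a p" for p
  proof (cases p)
    case 0
    then show ?thesis using pow_coeff_zero[of r n] r0 assms(1) by simp
  next
    case (Suc j)
    show ?thesis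
    proof
      fix x
      have "pow_coeff r n (Suc j) x - pow_coeff (g j) n (Suc j) x = real n * (r (Suc j) x - g j (Suc j) x)"
      proof (rule pow_coeff_diff)
        show "r q = g j q" if "q < Suc j" for q
          unfolding r_def using stable[of q j] that by simp
      qed (simp_all only: r0 g0' zero_less_Suc)
      then show "pow_coeff r n p x = a p x"
        using assms(3) unfolding Suc r_def by (simp add: zero gS)
    qed
  qed
  moreover have "smooth (r q)" for q unfolding r_def by (rule sm)
  ultimately show ?thesis using r0 by (intro exI[of _ r] conjI allI)
qed

text \<open>Gives meaning to the definite description in \<open>psido_root\<close>.\<close>

lemma ex1_psido_root:
  assumes "n > 0" "\<And>k. smooth (A k)" "A (int n) = (\<lambda>_. 1)" "\<And>k. k > int n \<Longrightarrow> A k = (\<lambda>_. 0)"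
  shows "\<exists>!R. is_psido R \<and> R 1 = (\<lambda>_. 1) \<and> (\<forall>k>1. R k = (\<lambda>_. 0)) \<and> psido_power R n = A"
proof -
  have char: "psido_power R n = A \<longleftrightarrow> (\<forall>p. pow_coeff (\<lambda>q. R (1 - int q)) n p = A (int n - int p))"
    if "\<And>k. k > 1 \<Longrightarrow> R k = (\<lambda>_. 0)" for R
  proof
    assume R: "\<forall>p. pow_coeff (\<lambda>q. R (1 - int q)) n p = A (int n - int p)"
    show "psido_power R n = A"
    proof
      fix k show "psido_power R n k = A k"
      proof (cases "k > int n")
        case True
        then show ?thesis using psido_power_pow_coeff(2)[of R n k] that assms(4) by simp
      next
        case False
        then have "k = int n - int (nat (int n - k))" by simp
        then show ?thesis using psido_power_pow_coeff(1)[of R n "nat (int n - k)"] that R by metis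
      qed
    qed
  qed (use psido_power_pow_coeff(1)[of R n] that in auto)
  obtain r where r: "r 0 = (\<lambda>_. 1)" "\<forall>q. smooth (r q)" "\<forall>p. pow_coeff r n p = A (int n - int p)"
    using pow_coeff_surj[of "\<lambda>p. A (int n - int p)" n] assms by auto
  define R where "R k = (if k > 1 then (\<lambda>_. 0) else r (nat (1 - k)))" for k :: int
  have Rr: "(\<lambda>q. R (1 - int q)) = r" unfolding R_def by (intro ext) simp
  have R: "is_psido R \<and> R 1 = (\<lambda>_. 1) \<and> (\<forall>k>1. R k = (\<lambda>_. 0)) \<and> psido_power R n = A"
  proof (intro conjI)
    show "is_psido R" unfolding is_psido_def R_def using r by (auto intro!: exI[of _ 1])
    show "psido_power R n = A" by (subst char) (auto simp: Rr r, simp add: R_def)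
  qed (auto simp: R_def r)
  show ?thesis
  proof (rule ex1I[of _ R], rule R)
    fix R' assume R': "is_psido R' \<and> R' 1 = (\<lambda>_. 1) \<and> (\<forall>k>1. R' k = (\<lambda>_. 0)) \<and> psido_power R' n = A"
    then have "\<forall>p. pow_coeff (\<lambda>q. R' (1 - int q)) n p = A (int n - int p)" using char[of R'] by blast
    then have eq: "R' (1 - int q) = r q" for q
      using pow_coeff_inject[of "\<lambda>q. R' (1 - int q)" r n q] r R' assms(1) by simp
    show "R' = R"
    proof
      fix k show "R' k = R k"
        using eq[of "nat (1 - k)"] R' by (cases "k > 1") (auto simp: R_def)
    qed
  qed
qed

section \<open>The operator of order two and its commutator with the KdV operator\<close>

lemma kdv_operator_nat: "kdv_operator d u (int j) = (if j = Suc d then (\<lambda>_. 1) else if j < d then u j else (\<lambda>_. 0))"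
  unfolding kdv_operator_def by auto

lemma kdv_operator_neg: "k < 0 \<Longrightarrow> kdv_operator d u k = (\<lambda>_. 0)"
  unfolding kdv_operator_def by auto

lemma smooth_kdv_operator: "\<forall>j<d. smooth (u j) \<Longrightarrow> smooth (kdv_operator d u k)"
  unfolding kdv_operator_def by auto

text \<open>Only two coefficients of the root below the leading one reach the differential part of
  its square: r_1, which is 0 because the operator has no term of order d, and r_2, which is
  u_(d-1)/(d+1) and is doubled by squaring.\<close>

lemma kdv_Q_2:
  assumes "d \<ge> 1" "\<forall>j<d. smooth (u j)"
  shows "kdv_Q 2 d u k = (if k = 2 then (\<lambda>_. 1) else if k = 0 then (\<lambda>x. 2 / real (d + 1) * u (d - 1) x) else (\<lambda>_. 0))"
proof -
  let ?A = "kdv_operator d u" and ?n = "d + 1"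
  define R where "R = psido_root ?n ?A"
  have "\<exists>!R. is_psido R \<and> R 1 = (\<lambda>_. 1) \<and> (\<forall>k>1. R k = (\<lambda>_. 0)) \<and> psido_power R ?n = ?A"
    by (rule ex1_psido_root) (use assms(2) smooth_kdv_operator in \<open>auto simp: kdv_operator_def\<close>)
  from theI'[OF this]
  have "is_psido R \<and> R 1 = (\<lambda>_. 1) \<and> (\<forall>k>1. R k = (\<lambda>_. 0)) \<and> psido_power R ?n = ?A"
    unfolding R_def psido_root_def .
  then have R: "R 1 = (\<lambda>_. 1)" "\<And>k. k > 1 \<Longrightarrow> R k = (\<lambda>_. 0)" "psido_power R ?n = ?A" by auto
  define r where "r q = R (1 - int q)" for q
  have r0: "r 0 = (\<lambda>_. 1)" using R by (simp add: r_def)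
  define e where "e = (\<lambda>q x::real. if q = (0::nat) then 1 else 0 :: real)"
  have e0: "e 0 = (\<lambda>_. 1)" and e: "pow_coeff e n p x = (if p = 0 then 1 else 0)" for n p x
    unfolding e_def pow_coeff_trivial by auto
  have A: "pow_coeff r ?n p = ?A (int ?n - int p)" for p
    using psido_power_pow_coeff(1)[of R ?n p] R unfolding r_def by simp
  have d1: "pow_coeff r n 1 x = real n * r 1 x" for n x
    using pow_coeff_diff[of r e 1 n x] r0 e0 e[of n 1 x] by (simp add: e_def)
  have a1: "pow_coeff r ?n 1 = (\<lambda>_. 0)" unfolding A using kdv_operator_nat[of d u d] by simp
  have "r 1 x = 0" for x
    using d1[of ?n x] unfolding a1 by simp
  then have r1: "r 1 = (\<lambda>_. 0)" by auto
  have re: "r q = e q" if "q < 2" for q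
    using that r0 e0 r1 by (cases "q = 0") (auto simp: e_def less_2_cases_iff)
  have d2: "pow_coeff r n 2 x = real n * r 2 x" for n x
    using pow_coeff_diff[of r e 2 n x] r0 e0 e[of n 2 x] re by (simp add: e_def)
  have i2: "int ?n - int 2 = int (d - 1)" using assms(1) by (simp add: of_nat_diff)
  have a2: "pow_coeff r ?n 2 = u (d - 1)"
    unfolding A i2 kdv_operator_nat using assms(1) by auto
  have r2: "real ?n * r 2 x = u (d - 1) x" for x
    using d2[of ?n x] unfolding a2 by simp
  have r2': "r 2 x = u (d - 1) x / real ?n" for x
    using r2[of x] by (simp add: field_simps)
  have Q: "psido_power R 2 (2 - int p) = pow_coeff r 2 p" for p
    using psido_power_pow_coeff(1)[of R 2 p] R unfolding r_def by simp
  have Qbig: "psido_power R 2 k = (\<lambda>_. 0)" if "k > 2" for k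
    using psido_power_pow_coeff(2)[of R 2 k] R that by simp
  have "kdv_Q 2 d u k = differential_part (psido_power R 2) k" unfolding kdv_Q_def R_def ..
  also have "\<dots> = (if k = 2 then (\<lambda>_. 1) else if k = 0 then (\<lambda>x. 2 / real (d + 1) * u (d - 1) x) else (\<lambda>_. 0))"
  proof -
    consider "k < 0" | "k = 0" | "k = 1" | "k = 2" | "k > 2" by linarith
    then show ?thesis
    proof cases
      case 2
      have "pow_coeff r 2 2 = (\<lambda>x. 2 / real (d + 1) * u (d - 1) x)" by (intro ext) (simp only: d2 r2', simp)
      then show ?thesis using 2 Q[of 2] by (simp add: differential_part_def)
    next
      case 3
      have "pow_coeff r 2 1 = (\<lambda>x. 0)" by (intro ext) (simp only: d1 r1 mult_zero_right)
      then show ?thesis using 3 Q[of 1] by (simp add: differential_part_def)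
    next
      case 4
      then show ?thesis using Q[of 0] pow_coeff_zero[of r 2] r0 by (simp add: differential_part_def)
    qed (auto simp: differential_part_def Qbig)
  qed
  finally show ?thesis .
qed

text \<open>With Q = \<partial>^2 + q, both Q K and K Q contain the coefficient of K at order k - 2,
  which cancels. What remains is the rest of the Leibniz expansion of \<partial>^2 K, the product q
  K, and the Leibniz sum for K q.\<close>

lemma kdv_field_eq:
  assumes "d \<ge> 1" "\<forall>j<d. smooth (u j)"
  shows "kdv_field 2 d u k x = Dn 2 (kdv_operator d u k) x + 2 * deriv (kdv_operator d u (k - 1)) x
      + 2 / real (d + 1) * u (d - 1) x * kdv_operator d u k x
      - (\<Sum>j\<le>Suc d. if k \<le> int j then real (j choose nat (int j - k)) * kdv_operator d u (int j) x *
           Dn (nat (int j - k)) (\<lambda>x. 2 / real (d + 1) * u (d - 1) x) x else 0)"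
proof -
  define K where "K = kdv_operator d u"
  define q where "q = (\<lambda>x. 2 / real (d + 1) * u (d - 1) x)"
  define Q where "Q k = (if k = 2 then (\<lambda>_. 1) else if k = 0 then q else (\<lambda>_. 0))" for k :: int
  have Q: "kdv_Q 2 d u = Q" using kdv_Q_2[OF assms] unfolding Q_def q_def by (intro ext) simp
  have K_supp: "0 \<le> i \<and> i \<le> int d + 1" if "K i \<noteq> (\<lambda>_. 0)" for i
    using that unfolding K_def kdv_operator_def by (auto split: if_splits)
  \<comment> \<open>N bounds l in both products; in the first one the range is widened to 2 + N so
    that it contains {..2} even when N = 0.\<close>
  define N where "N = nat (int d + 3 - k)"
  have "psido_mult Q K k x = (\<Sum>(i, l)\<in>{0, 2} \<times> {..2 + N}. ((of_int i :: real) gchoose l) * Q i x * Dn l (K (k - i + int l)) x)"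
  proof (rule psido_mult_eq)
    fix i l assume "Q i \<noteq> (\<lambda>_. 0)" "K (k - i + int l) \<noteq> (\<lambda>_. 0)"
    then have "i = 0 \<or> i = 2" "k - i + int l \<le> int d + 1" using K_supp by (auto simp: Q_def split: if_splits)
    then show "(i, l) \<in> {0, 2} \<times> {..2 + N}" unfolding N_def by auto
  qed auto
  also have "\<dots> = (\<Sum>l\<le>2 + N. (0 gchoose l) * q x * Dn l (K (k + int l)) x) + (\<Sum>l\<le>2 + N. (2 gchoose l) * Dn l (K (k - 2 + int l)) x)"
    by (subst sum.cartesian_product[symmetric]) (simp add: Q_def)
  also have "(\<Sum>l\<le>2 + N. (0 gchoose l) * q x * Dn l (K (k + int l)) x) = (\<Sum>l\<in>{0}. (0 gchoose l) * q x * Dn l (K (k + int l)) x)"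
    by (rule sum.mono_neutral_right) (auto simp: gbinomial_0_left)
  also have "(\<Sum>l\<le>2 + N. (2 gchoose l) * Dn l (K (k - 2 + int l)) x) = (\<Sum>l\<le>2. (2 gchoose l) * Dn l (K (k - 2 + int l)) x)"
  proof (rule sum.mono_neutral_right)
    show "\<forall>l\<in>{..2 + N} - {..2}. (2 gchoose l) * Dn l (K (k - 2 + int l)) x = 0"
      using binomial_gbinomial[of 2, where 'a = real] by (auto simp: not_le simp flip: binomial_gbinomial)
        (metis binomial_eq_0 binomial_gbinomial of_nat_0 of_nat_numeral)
  qed auto
  also have "\<dots> = K (k - 2) x + 2 * deriv (K (k - 1)) x + Dn 2 (K k) x"
    by (simp add: numeral_2_eq_2 gbinomial_Suc atMost_Suc)
  finally have QK: "psido_mult Q K k x = q x * K k x + (K (k - 2) x + 2 * deriv (K (k - 1)) x + Dn 2 (K k) x)"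
    by simp
  have "psido_mult K Q k x = (\<Sum>(i, l)\<in>{0..int d + 1} \<times> {..N}. ((of_int i :: real) gchoose l) * K i x * Dn l (Q (k - i + int l)) x)"
  proof (rule psido_mult_eq)
    fix i l assume "K i \<noteq> (\<lambda>_. 0)" "Q (k - i + int l) \<noteq> (\<lambda>_. 0)"
    then have "k - i + int l = 0 \<or> k - i + int l = 2" "0 \<le> i \<and> i \<le> int d + 1" using K_supp by (auto simp: Q_def split: if_splits)
    then show "(i, l) \<in> {0..int d + 1} \<times> {..N}" unfolding N_def by auto
  qed auto
  also have "\<dots> = (\<Sum>i\<in>{0..int d + 1}. \<Sum>l\<le>N. ((of_int i :: real) gchoose l) * K i x * Dn l (Q (k - i + int l)) x)"
    by (rule sum.cartesian_product[symmetric])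
  also have "\<dots> = (\<Sum>i\<in>{0..int d + 1}. (if i = k - 2 then K i x else 0) + (if k \<le> i then (of_int i gchoose nat (i - k)) * K i x * Dn (nat (i - k)) q x else 0))"
  proof (rule sum.cong[OF refl])
    fix i assume i: "i \<in> {0..int d + 1}"
    \<comment> \<open>Q lives in the orders 2 and 0. Its top coefficient is constant, so there only
      l = 0 survives and i = k - 2; order 0 forces l = i - k.\<close>
    have "(\<Sum>l\<le>N. ((of_int i :: real) gchoose l) * K i x * Dn l (Q (k - i + int l)) x)
      = (\<Sum>l\<le>N. (if l = 0 then (if i = k - 2 then K i x else 0) else 0) + (if l = nat (i - k) then (if k \<le> i then (of_int i gchoose nat (i - k)) * K i x * Dn (nat (i - k)) q x else 0) else 0))"
    proof (rule sum.cong[OF refl])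
      fix l
      consider "k - i + int l = 2" | "k - i + int l = 0" | "k - i + int l \<noteq> 2" "k - i + int l \<noteq> 0" by blast
      then show "((of_int i :: real) gchoose l) * K i x * Dn l (Q (k - i + int l)) x = (if l = 0 then (if i = k - 2 then K i x else 0) else 0) + (if l = nat (i - k) then (if k \<le> i then (of_int i gchoose nat (i - k)) * K i x * Dn (nat (i - k)) q x else 0) else 0)"
      proof cases
        case 1
        then show ?thesis by (auto simp: Q_def funpow_deriv_const)
      next
        case 2
        then have "l = nat (i - k)" "k \<le> i" "\<not> (l = 0 \<and> i = k - 2)" by auto
        then show ?thesis using 2 by (auto simp: Q_def)
      next
        case 3
        then show ?thesis by (auto simp: Q_def funpow_deriv_const)
      qed
    qed
    also have "\<dots> = (if i = k - 2 then K i x else 0) + (if k \<le> i then (of_int i gchoose nat (i - k)) * K i x * Dn (nat (i - k)) q x else 0)"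
    proof -
      have "nat (i - k) \<le> N" using i unfolding N_def by auto
      then show ?thesis unfolding sum.distrib by (simp add: sum.delta)
    qed
    finally show "(\<Sum>l\<le>N. ((of_int i :: real) gchoose l) * K i x * Dn l (Q (k - i + int l)) x) =
      (if i = k - 2 then K i x else 0) + (if k \<le> i then (of_int i gchoose nat (i - k)) * K i x * Dn (nat (i - k)) q x else 0)" .
  qed
  also have "\<dots> = K (k - 2) x + (\<Sum>i\<in>{0..int d + 1}. if k \<le> i then (of_int i gchoose nat (i - k)) * K i x * Dn (nat (i - k)) q x else 0)"
  proof -
    have "K (k - 2) x = 0" if "\<not> (0 \<le> k - 2 \<and> k - 2 \<le> int d + 1)"
      using K_supp[of "k - 2"] that by (metis (full_types))
    then show ?thesis unfolding sum.distrib by (auto simp: sum.delta)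
  qed
  also have "(\<Sum>i\<in>{0..int d + 1}. if k \<le> i then (of_int i gchoose nat (i - k)) * K i x * Dn (nat (i - k)) q x else 0)
    = (\<Sum>j\<le>Suc d. if k \<le> int j then real (j choose nat (int j - k)) * K (int j) x * Dn (nat (int j - k)) q x else 0)"
    by (rule sum.reindex_bij_witness[of _ int nat]) (auto simp: binomial_gbinomial)
  finally have KQ: "psido_mult K Q k x = K (k - 2) x + (\<Sum>j\<le>Suc d. if k \<le> int j then real (j choose nat (int j - k)) * K (int j) x * Dn (nat (int j - k)) q x else 0)" .
  have qx: "2 / real (d + 1) * u (d - 1) x = q x" by (simp add: q_def)
  show ?thesis
    unfolding kdv_field_def psido_commutator_def Q K_def[symmetric] QK KQ qx q_def[symmetric] by simp
qed

text \<open>The undifferentiated summand j = m of K q cancels the term q K_m of Q K, so q enters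
  only through its derivatives.\<close>

lemma kdv_field_nat:
  assumes "d \<ge> 1" "\<forall>j<d. smooth (u j)"
  shows "kdv_field 2 d u (int m) x = Dn 2 (kdv_operator d u (int m)) x + 2 * deriv (kdv_operator d u (int m - 1)) x
      - (\<Sum>j\<in>{m<..Suc d}. real (j choose (j - m)) * kdv_operator d u (int j) x *
           Dn (j - m) (\<lambda>x. 2 / real (d + 1) * u (d - 1) x) x)"
proof -
  define q where "q = (\<lambda>x. 2 / real (d + 1) * u (d - 1) x)"
  define t where "t j = real (j choose (j - m)) * kdv_operator d u (int j) x * Dn (j - m) q x" for j
  have "(\<Sum>j\<le>Suc d. if int m \<le> int j then real (j choose nat (int j - int m)) * kdv_operator d u (int j) x * Dn (nat (int j - int m)) q x else 0)
    = (\<Sum>j\<le>Suc d. (if j = m then t m else 0) + (if j \<in> {m<..Suc d} then t j else 0))"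
    by (intro sum.cong refl) (auto simp: t_def nat_diff_distrib)
  also have "\<dots> = (if m \<le> Suc d then t m else 0) + (\<Sum>j\<in>{m<..Suc d}. t j)"
  proof -
    have "{..Suc d} \<inter> {m<..Suc d} = {m<..Suc d}" by auto
    then have "(\<Sum>j\<le>Suc d. if j \<in> {m<..Suc d} then t j else 0) = (\<Sum>j\<in>{m<..Suc d}. t j)"
      by (subst sum.inter_restrict[symmetric]) (simp_all only: finite_atMost)
    then show ?thesis unfolding sum.distrib by (simp add: sum.delta del: sum.atMost_Suc greaterThanAtMost_iff)
  qed
  also have "(if m \<le> Suc d then t m else 0) = q x * kdv_operator d u (int m) x"
    by (auto simp: t_def kdv_operator_nat)
  finally have key: "(\<Sum>j\<le>Suc d. if int m \<le> int j then real (j choose nat (int j - int m)) * kdv_operator d u (int j) x * Dn (nat (int j - int m)) q x else 0)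
    = q x * kdv_operator d u (int m) x + (\<Sum>j\<in>{m<..Suc d}. t j)" .
  have qx: "2 / real (d + 1) * u (d - 1) x = q x" by (simp add: q_def)
  show ?thesis
    unfolding kdv_field_eq[OF assms] qx q_def[symmetric] key t_def by simp
qed

text \<open>\<open>kdv_flow\<close> also fixes the coefficients outside the orders 0 to d - 1. The
  delicate one is order d, where 2 u'_(d-1) cancels against (d + 1) q': this is what the factor
  2/(d+1) achieves. In negative orders the binomial coefficients vanish, and above d all
  coefficients are constant.\<close>

lemma kdv_field_high:
  assumes "d \<ge> 1" "\<forall>j<d. smooth (u j)" "k < 0 \<or> k \<ge> int d"
  shows "kdv_field 2 d u k x = 0"
proof (cases "k < 0")
  case True
  have "(\<Sum>j\<le>Suc d. if k \<le> int j then real (j choose nat (int j - k)) * kdv_operator d u (int j) x *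
           Dn (nat (int j - k)) (\<lambda>x. 2 / real (d + 1) * u (d - 1) x) x else 0) = 0"
    using True by (intro sum.neutral ballI) (auto simp: binomial_eq_0)
  note z = this
  show ?thesis
    unfolding kdv_field_eq[OF assms(1,2)] z using True by (simp add: kdv_operator_neg funpow_deriv_const)
next
  case False
  then have "k \<ge> int d" using assms(3) by simp
  then have m: "k = int (nat k)" "nat k \<ge> d" by auto
  define m where "m = nat k"
  note m = m[folded m_def]
  show ?thesis
  proof (cases "m = d")
    case True
    have S: "{d<..Suc d} = {Suc d}" by auto
    have i: "int d - 1 = int (d - 1)" using assms(1) by (simp add: of_nat_diff)
    have "deriv (\<lambda>x. 2 / real (d + 1) * u (d - 1) x) x = 2 / real (d + 1) * deriv (u (d - 1)) x"
      using funpow_deriv_cmult[of "u (d - 1)" 1 "2 / real (d + 1)"] assms(1,2) by simp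
    then have D: "Dn (Suc d - d) (\<lambda>x. 2 / real (d + 1) * u (d - 1) x) x = 2 / real (d + 1) * deriv (u (d - 1)) x"
      by (simp only: Suc_diff_le[OF order_refl] diff_self_eq_0 funpow.simps o_apply id_apply)
    have K: "kdv_operator d u (int d) = (\<lambda>_. 0)" "kdv_operator d u (int (Suc d)) = (\<lambda>_. 1)"
      "kdv_operator d u (int (d - 1)) = u (d - 1)"
      unfolding kdv_operator_nat using assms(1) by auto
    have "kdv_field 2 d u k x = 2 * deriv (u (d - 1)) x - real (Suc d choose (Suc d - d)) * (2 / real (d + 1) * deriv (u (d - 1)) x)"
      unfolding m(1) True kdv_field_nat[OF assms(1,2)] S i K by (simp only: sum.insert sum.empty finite.emptyI empty_iff not_False_eq_True K D)
        (simp add: funpow_deriv_const)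
    also have "real (Suc d choose (Suc d - d)) = real (d + 1)" by simp
    finally show ?thesis by simp
  next
    case False
    then have i: "int m - 1 = int (m - 1)" and S: "{m<..Suc d} = {}" and "m \<ge> Suc d" using m by auto
    then have K: "\<exists>c. kdv_operator d u (int m) = (\<lambda>_. c)" "\<exists>c. kdv_operator d u (int (m - 1)) = (\<lambda>_. c)"
      unfolding kdv_operator_nat by auto
    then show ?thesis
      unfolding m(1) kdv_field_nat[OF assms(1,2)] i S by (auto simp: funpow_deriv_const)
  qed
qed

subsection \<open>The second order term\<close>

context envelope_data
begin

text \<open>Comparing the \<open>\<epsilon>\<^sup>2\<close>-terms of \<open>L\<^sub>\<epsilon>\<^bsup>(k)\<^esup> \<in> P\<^sub>\<epsilon>\<close> with those of \<open>frame_col k \<in> P\<^sub>\<epsilon>\<close> shows that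
  \<open>B - \<beta>\<^bsub>d-2\<^esub> G''\<close> has the same contacts with the osculating hyperplanes of \<open>G\<close> as \<open>G\<close> itself.\<close>

lemma second_order_term:
  assumes "d \<ge> 2" and ode: "satisfies_ode d u G"
    and B: "\<And>i. i < Suc d \<Longrightarrow> expansion (\<lambda>\<epsilon>. env \<epsilon> i) (G i) (B i)"
  shows "\<exists>b. smooth b \<and> (\<forall>i<Suc d. B i = (\<lambda>x. \<beta> (d - 2) * Dn 2 (G i) x + b x * G i x))"
proof -
  define c where "c = \<beta> (d - 2)"
  have "\<forall>i\<in>{..<Suc d}. \<exists>b. expansion (\<lambda>\<epsilon>. cov \<epsilon> i) (cov0 i) b"
    using expansion_cov by (intro ballI) simp
  from bchoice[OF this] obtain e where "\<forall>i\<in>{..<Suc d}. expansion (\<lambda>\<epsilon>. cov \<epsilon> i) (cov0 i) (e i)" ..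
  then have e: "expansion (\<lambda>\<epsilon>. cov \<epsilon> i) (cov0 i) (e i)" if "i < Suc d" for i using that by simp
  have sB: "smooth (B i)" if "i < Suc d" for i using expansionD(2)[OF B[OF that]] .
  \<comment> \<open>For k = d - 1 the vector is G^(d+1), which the differential equation expresses
    through derivatives below order d, all annihilated by the covector.\<close>
  have G_high: "(\<Sum>i<Suc d. Dn (k + 2) (G i) x * cov0 i x) = (if k + 2 = d then 1 else 0)" if "k < d" for k x
  proof -
    have "k + 2 < d \<or> k + 2 = d \<or> k + 2 = d + 1" using that by linarith
    then consider "k + 2 < d" | "k + 2 = d" | "k + 2 = d + 1" by blast
    then show ?thesis
    proof cases
      case 1
      then show ?thesis by (simp only: osc_cov_derivs(1)) simp
    next
      case 2
      then show ?thesis by (simp only: osc_cov_derivs(2) wronskian_G if_True refl)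
    next
      case 3
      have "(\<Sum>i<Suc d. Dn (d + 1) (G i) x * cov0 i x) = (\<Sum>i<Suc d. (- (\<Sum>j<d. u j x * Dn j (G i) x)) * cov0 i x)"
      proof (rule sum.cong[OF refl])
        fix i assume "i \<in> {..<Suc d}"
        then have "Dn (d + 1) (G i) x + (\<Sum>j<d. u j x * Dn j (G i) x) = 0"
          using ode unfolding satisfies_ode_def by (simp only: lessThan_iff less_Suc_eq_le)
        then have "Dn (d + 1) (G i) x = - (\<Sum>j<d. u j x * Dn j (G i) x)" by linarith
        then show "Dn (d + 1) (G i) x * cov0 i x = (- (\<Sum>j<d. u j x * Dn j (G i) x)) * cov0 i x" by (simp only:)
      qed
      also have "\<dots> = - (\<Sum>j<d. u j x * (\<Sum>i<Suc d. Dn j (G i) x * cov0 i x))"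
        unfolding mult_minus_left sum_negf sum_distrib_left sum_distrib_right by (subst sum.swap) (simp only: mult.assoc)
      also have "\<dots> = 0" using osc_cov_derivs(1) by (simp del: sum.lessThan_Suc)
      finally show ?thesis using 3 by (simp only:) simp
    qed
  qed
  \<comment> \<open>\<open>e\<close> is the unknown second order term of the covector. The same sum
    involving \<open>e\<close> occurs in fact \<open>2\<close>, so subtracting the two relations
    eliminates it.\<close>
  have 1: "(\<Sum>i<Suc d. Dn k (G i) x * e i x) + \<beta> k * (if k + 2 = d then 1 else 0) = 0" if k: "k < d" for k x
  proof -
    have "expansion (\<lambda>\<epsilon> x. \<Sum>i<Suc d. frame_col d \<alpha> G k i \<epsilon> x * cov \<epsilon> i x)
      (\<lambda>x. \<Sum>i<Suc d. Dn k (G i) x * cov0 i x)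
      (\<lambda>x. \<Sum>i<Suc d. Dn k (G i) x * e i x + \<beta> k * Dn (k + 2) (G i) x * cov0 i x)"
      by (rule expansion_sum, rule expansion_mult[OF frame[OF k] e]) (simp_all only: lessThan_iff)
    from expansion_unique(2)[OF this, of x]
    have "(\<Sum>i<Suc d. Dn k (G i) x * e i x + \<beta> k * Dn (k + 2) (G i) x * cov0 i x) = 0"
      unfolding hyp_cov_frame_col[OF k] by simp
    then show ?thesis
      unfolding sum.distrib mult.assoc sum_distrib_left[symmetric] G_high[OF k] .
  qed
  have 2: "(\<Sum>i<Suc d. Dn k (G i) x * e i x) + (\<Sum>i<Suc d. Dn k (B i) x * cov0 i x) = 0" if k: "k < d" for k x
  proof -
    have "expansion (\<lambda>\<epsilon> x. \<Sum>i<Suc d. Dn k (env \<epsilon> i) x * cov \<epsilon> i x)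
      (\<lambda>x. \<Sum>i<Suc d. Dn k (G i) x * cov0 i x)
      (\<lambda>x. \<Sum>i<Suc d. Dn k (G i) x * e i x + Dn k (B i) x * cov0 i x)"
      by (rule expansion_sum, rule expansion_mult[OF expansion_funpow_deriv[OF B] e]) (simp_all only: lessThan_iff)
    moreover have "\<forall>\<^sub>F \<epsilon> in at_right 0. (\<Sum>i<Suc d. Dn k (env \<epsilon> i) x * cov \<epsilon> i x) = 0"
      using eventually_dens_pos by eventually_elim (rule env_cov[OF _ k])
    ultimately have "(\<Sum>i<Suc d. Dn k (G i) x * e i x + Dn k (B i) x * cov0 i x) = 0"
      by (rule expansion_unique(2))
    then show ?thesis unfolding sum.distrib .
  qed
  define E where "E i x = B i x - c * Dn 2 (G i) x" for i x
  have sE: "smooth (E i)" if "i < Suc d" for i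
    unfolding E_def[abs_def] by (intro smooth_diff smooth_cmult smooth_funpow_deriv smooth_G sB that)
  have E0: "(\<Sum>i<Suc d. Dn k (E i) x * cov0 i x) = 0" if k: "k < d" for k x
  proof -
    have "(\<Sum>i<Suc d. Dn k (E i) x * cov0 i x) =
      (\<Sum>i<Suc d. (Dn k (B i) x - c * Dn (k + 2) (G i) x) * cov0 i x)"
    proof (rule sum.cong[OF refl])
      fix i assume "i \<in> {..<Suc d}"
      then have i: "i < Suc d" by simp
      have "Dn k (E i) x = Dn k (B i) x - c * Dn (k + 2) (G i) x"
        unfolding E_def[abs_def] funpow_deriv_diff[OF sB[OF i] smooth_cmult[OF smooth_funpow_deriv[OF smooth_G[OF i]]]]
          funpow_deriv_cmult[OF smooth_funpow_deriv[OF smooth_G[OF i]]] funpow_add o_apply ..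
      then show "Dn k (E i) x * cov0 i x = (Dn k (B i) x - c * Dn (k + 2) (G i) x) * cov0 i x"
        by (simp only:)
    qed
    also have "\<dots> = (\<Sum>i<Suc d. Dn k (B i) x * cov0 i x) - c * (if k + 2 = d then 1 else 0)"
      unfolding left_diff_distrib sum_subtractf mult.assoc sum_distrib_left[symmetric] G_high[OF k] ..
    also have "\<dots> = (\<beta> k - c) * (if k + 2 = d then 1 else 0)"
      using 1[OF k, of x] 2[OF k, of x] by (simp add: left_diff_distrib del: sum.lessThan_Suc)
    also have "\<dots> = 0" by (auto simp: c_def)
    finally show ?thesis .
  qed
  have E1: "(\<Sum>i<Suc d. E i x * Dn k (cov0 i) x) = 0" if "k < d" for k x
    by (rule pairing_derivatives_swap(1)[where d = d, OF sE smooth_cov0 E0 that])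
  \<comment> \<open>The sign compensates the pairing (-1)^d of G with the d-th derivative of its
    dual curve.\<close>
  define b where "b x = (- 1) ^ d * (\<Sum>i<Suc d. E i x * Dn d (cov0 i) x)" for x
  have "smooth b"
    unfolding b_def[abs_def] by (intro smooth_cmult smooth_sum smooth_mult smooth_funpow_deriv smooth_cov0 sE) (simp_all only: lessThan_iff)
  moreover have Eb: "E i x = b x * G i x" if "i < Suc d" for i x
  proof -
    have "E i x - b x * G i x = 0"
    proof (rule osc_cov_kernel[OF lift _ that])
      fix k assume k: "k \<le> d"
      have "(\<Sum>i<Suc d. (E i x - b x * G i x) * Dn k (cov0 i) x) =
        (\<Sum>i<Suc d. E i x * Dn k (cov0 i) x) - b x * (\<Sum>i<Suc d. G i x * Dn k (cov0 i) x)"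
        unfolding left_diff_distrib sum_subtractf mult.assoc sum_distrib_left ..
      also have "\<dots> = 0"
      proof (cases "k = d")
        case True
        show ?thesis
          unfolding True osc_cov_pairing(2)[OF lift] b_def by (cases "even d") (simp_all del: sum.lessThan_Suc)
      next
        case False
        then have "k < d" using k by simp
        then show ?thesis by (simp only: E1 osc_cov_pairing(1)[OF lift])
      qed
      finally show "(\<Sum>i<Suc d. (E i x - b x * G i x) * Dn k (cov0 i) x) = 0" .
    qed
    then show ?thesis by simp
  qed
  moreover have "B i = (\<lambda>x. c * Dn 2 (G i) x + b x * G i x)" if "i < Suc d" for i
  proof
    fix x
    have "B i x - c * Dn 2 (G i) x = b x * G i x" using Eb[OF that, of x] unfolding E_def .
    then show "B i x = c * Dn 2 (G i) x + b x * G i x" by linarith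
  qed
  ultimately show ?thesis unfolding c_def by (intro exI[of _ b] conjI allI impI)
qed

end

text \<open>The coefficient of \<open>G\<^bsup>(d)\<^esup>\<close> in the \<open>\<epsilon>\<^sup>2\<close>-term of the differential equation determines \<open>b'\<close>; a
  constant in \<open>b\<close> drops out of the other coefficients.\<close>

lemma second_order_coefficients:
  assumes "d \<ge> 1" and lift: "normalized_lift d G" and ode: "satisfies_ode d u G"
    and u: "\<forall>j<d. smooth (u j)" and b: "smooth b"
    and B: "\<And>i. i < Suc d \<Longrightarrow> B i = (\<lambda>x. c * Dn 2 (G i) x + b x * G i x)"
    and w: "\<And>i x. i < Suc d \<Longrightarrow> Dn (Suc d) (B i) x +
      (\<Sum>j<d. u j x * Dn j (B i) x + w j x * Dn j (G i) x) = 0"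
    and "m < d"
  shows "w m x = c * kdv_field 2 d u (int m) x"
proof -
  let ?N = "Suc d"
  define K where "K j = kdv_operator d u (int j)" for j
  have K: "K j = (if j = Suc d then (\<lambda>_. 1) else if j < d then u j else (\<lambda>_. 0))" for j
    unfolding K_def kdv_operator_nat ..
  have sK: "smooth (K j)" for j unfolding K_def using smooth_kdv_operator[OF u] .
  have G: "smooth (G i)" if "i < ?N" for i using lift that unfolding normalized_lift_def by auto
  have W: "mdet ?N (\<lambda>i j. Dn j (G i) x) = 1" for x
    using lift unfolding normalized_lift_def wronskian_mdet by blast
  have K_sum: "(\<Sum>j\<le>?N. K j x * f j) = f ?N + (\<Sum>j<d. u j x * f j)" for f x
  proof -
    have "(\<Sum>j\<le>?N. K j x * f j) = (\<Sum>j<d. K j x * f j) + K d x * f d + K ?N x * f ?N"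
      by (simp add: lessThan_Suc_atMost[symmetric])
    also have "(\<Sum>j<d. K j x * f j) = (\<Sum>j<d. u j x * f j)" by (intro sum.cong) (auto simp: K)
    finally show ?thesis by (simp add: K)
  qed
  have S0: "(\<Sum>j\<le>?N. K j x * Dn j (G i) x) = 0" if "i < ?N" for i x
    unfolding K_sum using ode that unfolding satisfies_ode_def by (simp only: less_Suc_eq_le Suc_eq_plus1)
  \<comment> \<open>Differentiating K G = 0 twice expresses K G'' as minus the commutator of
    \<partial>^2 with K applied to G, which has order at most d.\<close>
  have S2: "(\<Sum>j\<le>?N. K j x * Dn (j + 2) (G i) x) =
      - (\<Sum>j\<le>?N. 2 * deriv (K j) x * Dn (Suc j) (G i) x) - (\<Sum>j\<le>?N. Dn 2 (K j) x * Dn j (G i) x)" if i: "i < ?N" for i x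
  proof -
    have "(\<lambda>x. \<Sum>j\<le>?N. K j x * Dn j (G i) x) = (\<lambda>_. 0)" using S0[OF i] by (intro ext)
    then have "0 = Dn 2 (\<lambda>x. \<Sum>j\<le>?N. K j x * Dn j (G i) x) x" by (simp add: funpow_deriv_const)
    also have "Dn 2 (\<lambda>x. \<Sum>j\<le>?N. K j x * Dn j (G i) x) = (\<lambda>x. \<Sum>j\<le>?N. Dn 2 (\<lambda>x. K j x * Dn j (G i) x) x)"
      by (rule funpow_deriv_sum) (intro smooth_mult sK smooth_funpow_deriv G i)
    also have "\<dots> x = (\<Sum>j\<le>?N. K j x * Dn (j + 2) (G i) x + 2 * deriv (K j) x * Dn (Suc j) (G i) x + Dn 2 (K j) x * Dn j (G i) x)"
    proof (rule sum.cong[OF refl])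
      fix j
      show "Dn 2 (\<lambda>x. K j x * Dn j (G i) x) x = K j x * Dn (j + 2) (G i) x + 2 * deriv (K j) x * Dn (Suc j) (G i) x + Dn 2 (K j) x * Dn j (G i) x"
        unfolding funpow_deriv_mult[OF sK smooth_funpow_deriv[OF G[OF i]]] by (simp add: numeral_2_eq_2)
    qed
    finally show ?thesis unfolding sum.distrib by linarith
  qed
  define t where "t m j x = real (j choose (j - m)) * K j x * Dn (j - m) b x" for m j x
  \<comment> \<open>The terms of K (b G) in which b is not differentiated sum to b K G = 0, so only
    j > m remains.\<close>
  have S3: "(\<Sum>j\<le>?N. K j x * Dn j (\<lambda>x. b x * G i x) x) =
      (\<Sum>m\<le>?N. (\<Sum>j\<in>{m<..?N}. t m j x) * Dn m (G i) x)" if i: "i < ?N" for i x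
  proof -
    have "(\<Sum>j\<le>?N. K j x * Dn j (\<lambda>x. b x * G i x) x) = (\<Sum>j\<le>?N. \<Sum>m\<le>?N. if m \<le> j then t m j x * Dn m (G i) x else 0)"
    proof (rule sum.cong[OF refl])
      fix j assume j: "j \<in> {..?N}"
      have "K j x * Dn j (\<lambda>x. b x * G i x) x = (\<Sum>l\<le>j. K j x * (real (j choose l) * Dn l b x * Dn (j - l) (G i) x))"
        unfolding funpow_deriv_mult[OF b G[OF i]] sum_distrib_left ..
      also have "\<dots> = (\<Sum>m\<le>j. t m j x * Dn m (G i) x)"
        by (rule sum.reindex_bij_witness[of _ "\<lambda>m. j - m" "\<lambda>m. j - m"]) (auto simp: t_def)
      also have "\<dots> = (\<Sum>m\<le>?N. if m \<le> j then t m j x * Dn m (G i) x else 0)"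
        by (rule sum.mono_neutral_cong_left) (use j in auto)
      finally show "K j x * Dn j (\<lambda>x. b x * G i x) x = (\<Sum>m\<le>?N. if m \<le> j then t m j x * Dn m (G i) x else 0)" .
    qed
    also have "\<dots> = (\<Sum>m\<le>?N. \<Sum>j\<le>?N. if m \<le> j then t m j x * Dn m (G i) x else 0)" by (rule sum.swap)
    also have "\<dots> = (\<Sum>m\<le>?N. b x * (K m x * Dn m (G i) x) + (\<Sum>j\<in>{m<..?N}. t m j x) * Dn m (G i) x)"
    proof (rule sum.cong[OF refl])
      fix m assume m: "m \<in> {..?N}"
      have "(\<Sum>j\<le>?N. if m \<le> j then t m j x * Dn m (G i) x else 0) = (\<Sum>j\<in>insert m {m<..?N}. t m j x * Dn m (G i) x)"
        by (rule sum.mono_neutral_cong_right) (use m in auto)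
      also have "\<dots> = t m m x * Dn m (G i) x + (\<Sum>j\<in>{m<..?N}. t m j x * Dn m (G i) x)"
        by (rule sum.insert) auto
      finally show "(\<Sum>j\<le>?N. if m \<le> j then t m j x * Dn m (G i) x else 0) = b x * (K m x * Dn m (G i) x) + (\<Sum>j\<in>{m<..?N}. t m j x) * Dn m (G i) x"
        unfolding sum_distrib_right by (simp add: t_def)
    qed
    finally show ?thesis
      unfolding sum.distrib sum_distrib_left[symmetric] S0[OF i] by (simp only: mult_zero_right add_0_left)
  qed
  \<comment> \<open>The shift by one comes from the first derivatives in \<open>S2\<close>; the
    value 0 at m = 0 matches the vanishing coefficient of the operator at order -1.\<close>
  define K' where "K' m x = (if m = 0 then 0 else deriv (K (m - 1)) x)" for m x
  have S1: "(\<Sum>j\<le>?N. 2 * deriv (K j) x * Dn (Suc j) (G i) x) = (\<Sum>m\<le>?N. 2 * K' m x * Dn m (G i) x)" for i x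
  proof -
    have "(\<Sum>j\<le>?N. 2 * deriv (K j) x * Dn (Suc j) (G i) x) = (\<Sum>j<?N. 2 * deriv (K j) x * Dn (Suc j) (G i) x)"
      by (simp add: lessThan_Suc_atMost[symmetric] K)
    also have "\<dots> = (\<Sum>j<?N. 2 * K' (Suc j) x * Dn (Suc j) (G i) x)" by (simp add: K'_def)
    also have "\<dots> = (\<Sum>m\<le>?N. 2 * K' m x * Dn m (G i) x)"
      unfolding sum.atMost_shift by (simp add: K'_def del: funpow.simps)
    finally show ?thesis .
  qed
  define e where "e m x = - c * (2 * K' m x + Dn 2 (K m) x) + (\<Sum>j\<in>{m<..?N}. t m j x) + (if m < d then w m x else 0)" for m x
  have e_sum: "(\<Sum>m\<le>?N. e m x * Dn m (G i) x) = 0" if i: "i < ?N" for i x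
  proof -
    have DB: "Dn j (B i) x = c * Dn (j + 2) (G i) x + Dn j (\<lambda>x. b x * G i x) x" for j
      unfolding B[OF i] funpow_deriv_add[OF smooth_cmult[OF smooth_funpow_deriv[OF G[OF i]]] smooth_mult[OF b G[OF i]]]
        funpow_deriv_cmult[OF smooth_funpow_deriv[OF G[OF i]]] funpow_add o_apply ..
    have ww: "(\<Sum>m\<le>?N. (if m < d then w m x else 0) * Dn m (G i) x) = (\<Sum>j<d. w j x * Dn j (G i) x)"
      by (rule sum.mono_neutral_cong_right) auto
    have "0 = (\<Sum>j\<le>?N. K j x * Dn j (B i) x) + (\<Sum>j<d. w j x * Dn j (G i) x)"
      using w[OF i, of x] unfolding K_sum sum.distrib by linarith
    also have "(\<Sum>j\<le>?N. K j x * Dn j (B i) x) = c * (\<Sum>j\<le>?N. K j x * Dn (j + 2) (G i) x) + (\<Sum>j\<le>?N. K j x * Dn j (\<lambda>x. b x * G i x) x)"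
      unfolding DB distrib_left sum.distrib sum_distrib_left by (simp only: mult.left_commute)
    finally have "0 = c * (- (\<Sum>m\<le>?N. 2 * K' m x * Dn m (G i) x) - (\<Sum>j\<le>?N. Dn 2 (K j) x * Dn j (G i) x))
      + (\<Sum>m\<le>?N. (\<Sum>j\<in>{m<..?N}. t m j x) * Dn m (G i) x) + (\<Sum>m\<le>?N. (if m < d then w m x else 0) * Dn m (G i) x)"
      unfolding S2[OF i] S3[OF i] S1 ww .
    also have "\<dots> = (\<Sum>m\<le>?N. e m x * Dn m (G i) x)"
      unfolding e_def right_diff_distrib sum_negf[symmetric] sum_distrib_left sum_subtractf[symmetric] sum.distrib[symmetric]
      by (rule sum.cong[OF refl]) (simp only: algebra_simps)
    finally show ?thesis by simp
  qed
  \<comment> \<open>\<open>e m\<close> is the coefficient of G^(m) in the second order equation. As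
    it vanishes at order d + 1, only the d + 1 independent vectors G, ..., G^(d) are left.\<close>
  have eN: "e ?N x = 0" for x
    unfolding e_def K'_def K by (simp add: funpow_deriv_const)
  have e0: "e m x = 0" if "m < ?N" for m x
  proof (rule mdet_nonzero_kernel'[of ?N "\<lambda>i j. Dn j (G i) x" "\<lambda>m. e m x" m, OF _ _ that])
    fix i assume "i < ?N"
    from e_sum[OF this, of x] show "(\<Sum>j<?N. Dn j (G i) x * e j x) = 0"
      unfolding lessThan_Suc_atMost[symmetric] sum.lessThan_Suc[of _ ?N] eN by (simp only: mult.commute mult_zero_left add_0_right)
  next
    show "mdet ?N (\<lambda>i j. Dn j (G i) x) \<noteq> 0" unfolding W by simp
  qed
  define q where "q = (\<lambda>x. 2 / real (d + 1) * u (d - 1) x)"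
  have sq: "smooth q" unfolding q_def by (rule smooth_cmult) (use u assms(1) in auto)
  have "deriv b x = c * deriv q x" for x
  proof -
    have "{d<..?N} = {?N}" by auto
    then have "(\<Sum>j\<in>{d<..?N}. t d j x) = real (d + 1) * deriv b x"
      by (simp add: t_def K)
    moreover have "K' d x = deriv (u (d - 1)) x" using assms(1) by (simp add: K'_def K)
    moreover have "Dn 2 (K d) x = 0" by (simp add: K funpow_deriv_const)
    ultimately have "real (d + 1) * deriv b x = c * (2 * deriv (u (d - 1)) x)"
      using e0[of d x] unfolding e_def by simp
    moreover have "deriv q x = 2 / real (d + 1) * deriv (u (d - 1)) x"
      unfolding q_def using funpow_deriv_cmult[of "u (d - 1)" 1 "2 / real (d + 1)"] u assms(1) by simp
    ultimately have "real (d + 1) * deriv b x = real (d + 1) * (c * deriv q x)" by simp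
    then show ?thesis by (simp only: mult_cancel_left of_nat_eq_0_iff) simp
  qed
  then have "deriv b = (\<lambda>x. c * deriv q x)" by (rule ext)
  then have bq: "Dn (Suc l) b x = c * Dn (Suc l) q x" for l x
    unfolding deriv_funpow_deriv[symmetric] by (simp only: funpow_deriv_cmult[OF smooth_deriv[OF sq]])
  have "(\<Sum>j\<in>{m<..?N}. t m j x) = c * (\<Sum>j\<in>{m<..?N}. real (j choose (j - m)) * K j x * Dn (j - m) q x)"
    unfolding sum_distrib_left
  proof (rule sum.cong[OF refl])
    fix j assume "j \<in> {m<..?N}"
    then have "j - m \<noteq> 0" by simp
    then obtain l where "j - m = Suc l" using not0_implies_Suc by blast
    then show "t m j x = c * (real (j choose (j - m)) * K j x * Dn (j - m) q x)"
      unfolding t_def by (simp only: bq mult_ac)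
  qed
  moreover have "deriv (kdv_operator d u (int m - 1)) x = K' m x"
  proof (cases m)
    case 0
    then show ?thesis by (simp add: K'_def kdv_operator_neg)
  next
    case (Suc m')
    then show ?thesis by (simp add: K'_def K_def)
  qed
  ultimately show ?thesis
    using e0[of m x] \<open>m < d\<close> unfolding kdv_field_nat[OF assms(1) u] K_def[symmetric] q_def[symmetric] e_def
    by (simp add: algebra_simps)
qed

subsection \<open>The continuous limit\<close>

context envelope_data
begin

text \<open>\<open>env\<close> is the witness for existence. Conversely, the coefficients of any
  admissible family coincide with those of \<open>env\<close> for small \<epsilon>, whichever family
  is chosen, and so do their second order terms.\<close>

lemma limit_field_iff:
  assumes "d \<ge> 2" and u: "\<forall>j<d. smooth (u j)" and ode: "satisfies_ode d u G"
  shows "pentagram_limit_field d G u w \<longleftrightarrow> (\<forall>j<d. \<forall>x. w j x = \<beta> (d - 2) * kdv_field 2 d u (int j) x)"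
proof -
  have "\<forall>i\<in>{..<Suc d}. \<exists>B. expansion (\<lambda>\<epsilon>. env \<epsilon> i) (G i) B"
    using expansion_env by (intro ballI) simp
  from bchoice[OF this] obtain B where "\<forall>i\<in>{..<Suc d}. expansion (\<lambda>\<epsilon>. env \<epsilon> i) (G i) (B i)" ..
  then have B: "expansion (\<lambda>\<epsilon>. env \<epsilon> i) (G i) (B i)" if "i < Suc d" for i using that by simp
  have "\<forall>j\<in>{..<d}. \<exists>w. expansion (\<lambda>\<epsilon>. ode_coeff d (env \<epsilon>) j) (ode_coeff d G j) w"
  proof
    fix j assume "j \<in> {..<d}"
    then show "\<exists>w. expansion (\<lambda>\<epsilon>. ode_coeff d (env \<epsilon>) j) (ode_coeff d G j) w"
      using expansion_ode_coeff[of d "\<lambda>i \<epsilon>. env \<epsilon> i" G j, OF expansion_env] by simp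
  qed
  from bchoice[OF this] obtain w0 where "\<forall>j\<in>{..<d}. expansion (\<lambda>\<epsilon>. ode_coeff d (env \<epsilon>) j) (ode_coeff d G j) (w0 j)" ..
  moreover have "ode_coeff d G j = u j" if "j < d" for j
    using ode that unfolding satisfies_ode_iff[OF lift] by (intro ext) simp
  ultimately have w0: "expansion (\<lambda>\<epsilon>. ode_coeff d (env \<epsilon>) j) (u j) (w0 j)" if "j < d" for j using that by simp
  have env_ode: "\<forall>\<^sub>F \<epsilon> in at_right 0. \<epsilon> > 0 \<and> (\<forall>x. dens \<epsilon> x > 0) \<and> envelope_lift d G \<epsilon> (env \<epsilon>) \<and> satisfies_ode d (ode_coeff d (env \<epsilon>)) (env \<epsilon>)"
    using eventually_dens_pos eventually_pos_le_1
  proof eventually_elim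
    case (elim \<epsilon>)
    then have "envelope_lift d G \<epsilon> (env \<epsilon>)" by (intro envelope_lift_env) auto
    moreover from this have "satisfies_ode d (ode_coeff d (env \<epsilon>)) (env \<epsilon>)"
      unfolding envelope_lift_def by (simp add: satisfies_ode_iff)
    ultimately show ?case using elim by blast
  qed
  have "\<exists>b. smooth b \<and> (\<forall>i<Suc d. B i = (\<lambda>x. \<beta> (d - 2) * Dn 2 (G i) x + b x * G i x))"
    by (rule second_order_term[OF assms(1) ode]) (rule B)
  then obtain b where b: "smooth b" "\<forall>i<Suc d. B i = (\<lambda>x. \<beta> (d - 2) * Dn 2 (G i) x + b x * G i x)"
    by (elim exE conjE)
  have w0_eq: "w0 m x = \<beta> (d - 2) * kdv_field 2 d u (int m) x" if m: "m < d" for m x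
  proof (rule second_order_coefficients[OF _ lift ode u b(1) _ _ m])
    show "1 \<le> d" using assms(1) by simp
    show "B i = (\<lambda>x. \<beta> (d - 2) * Dn 2 (G i) x + b x * G i x)" if "i < Suc d" for i
      using b(2) that by blast
    show "Dn (Suc d) (B i) x + (\<Sum>j<d. u j x * Dn j (B i) x + w0 j x * Dn j (G i) x) = 0" if i: "i < Suc d" for i x
    proof -
      have "expansion (\<lambda>\<epsilon> x. Dn (Suc d) (env \<epsilon> i) x + (\<Sum>j<d. ode_coeff d (env \<epsilon>) j x * Dn j (env \<epsilon> i) x))
        (\<lambda>x. Dn (Suc d) (G i) x + (\<Sum>j<d. u j x * Dn j (G i) x))
        (\<lambda>x. Dn (Suc d) (B i) x + (\<Sum>j<d. u j x * Dn j (B i) x + w0 j x * Dn j (G i) x))"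
        by (rule expansion_add[OF expansion_funpow_deriv[OF B[OF i]]], rule expansion_sum,
            rule expansion_mult[OF w0 expansion_funpow_deriv[OF B[OF i]]]) (simp only: lessThan_iff)
      moreover have "\<forall>\<^sub>F \<epsilon> in at_right 0. Dn (Suc d) (env \<epsilon> i) x + (\<Sum>j<d. ode_coeff d (env \<epsilon>) j x * Dn j (env \<epsilon> i) x) = 0"
        using env_ode
      proof eventually_elim
        case (elim \<epsilon>)
        then show ?case using i unfolding satisfies_ode_def by (simp only: less_Suc_eq_le Suc_eq_plus1)
      qed
      ultimately show ?thesis by (rule expansion_unique(2))
    qed
  qed
  show ?thesis
  proof
    assume w: "\<forall>j<d. \<forall>x. w j x = \<beta> (d - 2) * kdv_field 2 d u (int j) x"
    obtain e where e: "e > 0" "\<And>\<epsilon>. 0 < \<epsilon> \<Longrightarrow> \<epsilon> < e \<Longrightarrow> envelope_lift d G \<epsilon> (env \<epsilon>) \<and> satisfies_ode d (ode_coeff d (env \<epsilon>)) (env \<epsilon>)"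
      using env_ode unfolding eventually_at_right_field by blast
    show "pentagram_limit_field d G u w"
      unfolding pentagram_limit_field_def
    proof (rule exI[of _ e], rule conjI[OF e(1)], rule exI[of _ env],
        rule exI[of _ "\<lambda>\<epsilon>. ode_coeff d (env \<epsilon>)"], rule exI[of _ B], intro conjI)
      show "\<forall>\<epsilon>. 0 < \<epsilon> \<and> \<epsilon> < e \<longrightarrow> envelope_lift d G \<epsilon> (env \<epsilon>) \<and> satisfies_ode d (ode_coeff d (env \<epsilon>)) (env \<epsilon>)"
        using e(2) by blast
      show "\<forall>i\<le>d. \<forall>x. (\<lambda>\<epsilon>. env \<epsilon> i x - (G i x + \<epsilon>\<^sup>2 * B i x)) \<in> O[at_right 0](\<lambda>\<epsilon>. \<epsilon> ^ 4)"
        by (intro allI impI bigO_pow_at[OF expansionD(4)[OF B]]) simp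
      show "\<forall>j<d. \<forall>x. (\<lambda>\<epsilon>. ode_coeff d (env \<epsilon>) j x - (u j x + \<epsilon>\<^sup>2 * w j x)) \<in> O[at_right 0](\<lambda>\<epsilon>. \<epsilon> ^ 4)"
      proof (intro allI impI)
        fix j x assume j: "j < d"
        then have "w j x = w0 j x" using w w0_eq by simp
        then show "(\<lambda>\<epsilon>. ode_coeff d (env \<epsilon>) j x - (u j x + \<epsilon>\<^sup>2 * w j x)) \<in> O[at_right 0](\<lambda>\<epsilon>. \<epsilon> ^ 4)"
          using bigO_pow_at[OF expansionD(4)[OF w0[OF j]], of x] by simp
      qed
    qed
  next
    assume "pentagram_limit_field d G u w"
    then obtain e L U B' where e: "e > 0"
      and LU: "\<forall>\<epsilon>. 0 < \<epsilon> \<and> \<epsilon> < e \<longrightarrow> envelope_lift d G \<epsilon> (L \<epsilon>) \<and> satisfies_ode d (U \<epsilon>) (L \<epsilon>)"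
      and "\<forall>i\<le>d. \<forall>x. (\<lambda>\<epsilon>. L \<epsilon> i x - (G i x + \<epsilon>\<^sup>2 * B' i x)) \<in> O[at_right 0](\<lambda>\<epsilon>. \<epsilon> ^ 4)"
      and w: "\<forall>j<d. \<forall>x. (\<lambda>\<epsilon>. U \<epsilon> j x - (u j x + \<epsilon>\<^sup>2 * w j x)) \<in> O[at_right 0](\<lambda>\<epsilon>. \<epsilon> ^ 4)"
      unfolding pentagram_limit_field_def by (elim exE conjE)
    show "\<forall>j<d. \<forall>x. w j x = \<beta> (d - 2) * kdv_field 2 d u (int j) x"
    proof (intro allI impI)
      fix j x assume j: "j < d"
      have small: "\<forall>\<^sub>F \<epsilon> in at_right 0. \<epsilon> < e"
        using e unfolding eventually_at_right_field by blast
      have "\<forall>\<^sub>F \<epsilon> in at_right 0. U \<epsilon> j x = ode_coeff d (env \<epsilon>) j x"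
        using env_ode small
      proof eventually_elim
        case (elim \<epsilon>)
        then show ?case using LU[rule_format, of \<epsilon>] by (intro envelope_ode_coeff[OF _ _ _ _ j]) auto
      qed
      \<comment> \<open>Two expansions of the same coefficient are subtracted: \<epsilon>^2 times a
        constant is of order \<epsilon>^4 only if the constant is 0.\<close>
      then have "\<forall>\<^sub>F \<epsilon> in at_right 0. (ode_coeff d (env \<epsilon>) j x - (u j x + \<epsilon>\<^sup>2 * w0 j x)) - (U \<epsilon> j x - (u j x + \<epsilon>\<^sup>2 * w j x)) = 0 + \<epsilon>\<^sup>2 * (w j x - w0 j x)"
        by eventually_elim (simp add: algebra_simps)
      moreover have "(\<lambda>\<epsilon>. (ode_coeff d (env \<epsilon>) j x - (u j x + \<epsilon>\<^sup>2 * w0 j x)) - (U \<epsilon> j x - (u j x + \<epsilon>\<^sup>2 * w j x))) \<in> O[at_right 0](\<lambda>\<epsilon>. \<epsilon> ^ 4)"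
        by (rule sum_in_bigo(2)[OF bigO_pow_at[OF expansionD(4)[OF w0[OF j]]] w[rule_format, OF j]])
      ultimately have "(\<lambda>\<epsilon>. 0 + \<epsilon>\<^sup>2 * (w j x - w0 j x)) \<in> O[at_right 0](\<lambda>\<epsilon>. \<epsilon> ^ 4)"
        by (rule landau_o.big.in_cong[THEN iffD1])
      then have "w j x - w0 j x = 0" by (rule bigO_power4_imp_zero)
      then show "w j x = \<beta> (d - 2) * kdv_field 2 d u (int j) x" using w0_eq[OF j, of x] by simp
    qed
  qed
qed

end

theorem theorem2p7:
  fixes d :: nat
  assumes "d \<ge> 2"
  shows "\<exists>C>0.
    (\<forall>M G u w. curve_with_operator d M G u \<longrightarrow>
       (pentagram_limit_field d G u w \<longleftrightarrow>
        (\<forall>j<d. \<forall>x. w j x = C * kdv_field 2 d u (int j) x))) \<and>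
    (\<forall>a b M G u. (\<forall>t\<in>{a<..<b}. curve_with_operator d (M t) (G t) (u t)) \<longrightarrow>
       (pentagram_limit_flow d a b G u \<longleftrightarrow>
        kdv_flow 2 d (C * a) (C * b) (\<lambda>\<tau>. u (\<tau> / C))))"
proof -
  obtain \<alpha> :: "nat \<Rightarrow> nat \<Rightarrow> real" where
    \<alpha>: "\<And>m k. m < d \<Longrightarrow> k < d \<Longrightarrow> (\<Sum>c<d. \<alpha> m c * node d c ^ k) = (if k = m then fact m else 0)"
    and \<alpha>_odd: "\<And>m k. m < d \<Longrightarrow> odd (m + k) \<Longrightarrow> (\<Sum>c<d. \<alpha> m c * node d c ^ k) = 0"
    and \<alpha>_top: "(\<Sum>c<d. \<alpha> (d - 2) c * node d c ^ d) > 0"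
    using node_moments[OF assms] by blast
  define \<beta> where "\<beta> m = (\<Sum>c<d. \<alpha> m c * node d c ^ (m + 2)) / fact (m + 2)" for m
  define C where "C = \<beta> (d - 2)"
  have "d - 2 + 2 = d" using assms by simp
  then have C: "C > 0" using \<alpha>_top unfolding C_def \<beta>_def by simp
  have field: "pentagram_limit_field d G u w \<longleftrightarrow> (\<forall>j<d. \<forall>x. w j x = C * kdv_field 2 d u (int j) x)"
    if curve: "curve_with_operator d M G u" for M G u w
  proof -
    have lift: "normalized_lift d G" using curve unfolding curve_with_operator_def by blast
    interpret envelope_data d \<alpha> \<beta> G M
    proof
      show "normalized_lift d G" by (rule lift)
      show "quasi_periodic d M G" using curve unfolding curve_with_operator_def by blast
      show "(\<Sum>c<d. \<alpha> m c * node d c ^ k) = (if k = m then fact m else 0)" if "m < d" "k < d" for m k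
        by (rule \<alpha>[OF that])
      show "expansion (frame_col d \<alpha> G m i) (Dn m (G i)) (\<lambda>x. \<beta> m * Dn (m + 2) (G i) x)"
        if m: "m < d" and i: "i < Suc d" for m i
      proof -
        have "expansion (\<lambda>\<epsilon> x. \<Sum>c<d. \<alpha> m c / \<epsilon> ^ m * G i (x + node d c * \<epsilon>)) (Dn m (G i))
          (\<lambda>x. (\<Sum>c<d. \<alpha> m c * node d c ^ (m + 2)) / fact (m + 2) * Dn (m + 2) (G i) x)"
        proof (rule expansion_difference_quotient)
          show "smooth (G i)" using lift i unfolding normalized_lift_def by simp
          fix k assume k: "k < m + 4" "k \<noteq> m + 2"
          show "(\<Sum>c<d. \<alpha> m c * node d c ^ k) = (if k = m then fact m else 0)"
          \<comment> \<open>Exponents k \<ge> d that still matter are m + 1 and m + 3; they have the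
            parity opposite to m, and the symmetry of the nodes kills their moments.\<close>
          proof (cases "k < d")
            case False
            then have "k = m + 1 \<or> k = m + 3" using k m by linarith
            then show ?thesis using \<alpha>_odd[OF m, of k] by auto
          qed (rule \<alpha>[OF m])
        qed
        then show ?thesis unfolding frame_col_def \<beta>_def .
      qed
    qed
    show ?thesis
      unfolding C_def by (rule limit_field_iff[OF assms]) (use curve in \<open>auto simp: curve_with_operator_def periodic_coeffs_def\<close>)
  qed
  have flow: "pentagram_limit_flow d a b G u \<longleftrightarrow> kdv_flow 2 d (C * a) (C * b) (\<lambda>\<tau>. u (\<tau> / C))"
    if curves: "\<forall>t\<in>{a<..<b}. curve_with_operator d (M t) (G t) (u t)" for a b M G u
  proof -
    have per: "periodic_coeffs d (u t)" if "t \<in> {a<..<b}" for t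
      using curves that unfolding curve_with_operator_def by blast
    then have u: "\<forall>j<d. smooth (u t j)" if "t \<in> {a<..<b}" for t
      using that unfolding periodic_coeffs_def by blast
    \<comment> \<open>The limit field is C times the KdV field, so the KdV time is \<tau> = C
      t.\<close>
    have range: "\<tau> / C \<in> {a<..<b} \<longleftrightarrow> \<tau> \<in> {C * a<..<C * b}" for \<tau>
      using C by (auto simp: field_simps)
    show ?thesis
    proof
      assume L: "pentagram_limit_flow d a b G u"
      show "kdv_flow 2 d (C * a) (C * b) (\<lambda>\<tau>. u (\<tau> / C))"
        unfolding kdv_flow_def
      proof (intro ballI conjI allI)
        fix \<tau> assume "\<tau> \<in> {C * a<..<C * b}"
        then have t: "\<tau> / C \<in> {a<..<b}" using range by blast
        then show "periodic_coeffs d (u (\<tau> / C))" by (rule per)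
        fix k x
        obtain w where "pentagram_limit_field d (G (\<tau> / C)) (u (\<tau> / C)) w"
          and w: "\<forall>j<d. \<forall>x. ((\<lambda>s. u s j x) has_real_derivative w j x) (at (\<tau> / C))"
          using L t unfolding pentagram_limit_flow_def by blast
        then have w_eq: "w j x = C * kdv_field 2 d (u (\<tau> / C)) (int j) x" if "j < d" for j
          using field[OF bspec[OF curves t]] that by blast
        show "((\<lambda>s. kdv_operator d (u (s / C)) k x) has_real_derivative kdv_field 2 d (u (\<tau> / C)) k x) (at \<tau>)"
        proof (cases "0 \<le> k \<and> k < int d")
          case True
          define j where "j = nat k"
          have j: "j < d" "k = int j" using True by (auto simp: j_def)
          have "((\<lambda>s. u s j x) has_real_derivative w j x) (at (\<tau> / C))" using w j(1) by blast
          moreover have "((\<lambda>s. s / C) has_real_derivative 1 / C) (at \<tau>)" by (rule DERIV_cdivide) (rule DERIV_ident)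
          ultimately have "((\<lambda>s. u (s / C) j x) has_real_derivative w j x * (1 / C)) (at \<tau>)"
            by (rule DERIV_chain2)
          moreover have "w j x * (1 / C) = kdv_field 2 d (u (\<tau> / C)) k x"
            using w_eq[OF j(1)] C j(2) by simp
          moreover have "kdv_operator d v k = v j" for v using j by (simp add: kdv_operator_nat)
          ultimately show ?thesis by (simp only:)
        next
          case False
          \<comment> \<open>Outside the orders 0 to d - 1 the coefficient is the same for all u, so
            its value for the zero coefficients represents it at every time.\<close>
          define c where "c = kdv_operator d (\<lambda>_ _. 0) k"
          have "kdv_operator d v k = c" for v
            using False unfolding c_def kdv_operator_def by auto
          moreover have "kdv_field 2 d (u (\<tau> / C)) k x = 0"
            using kdv_field_high[OF _ u[OF t]] False assms by (simp add: not_le not_less)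
          ultimately show ?thesis by (simp only: DERIV_const)
        qed
      qed
    next
      assume K: "kdv_flow 2 d (C * a) (C * b) (\<lambda>\<tau>. u (\<tau> / C))"
      show "pentagram_limit_flow d a b G u"
        unfolding pentagram_limit_flow_def
      proof
        fix t assume t: "t \<in> {a<..<b}"
        show "\<exists>w. pentagram_limit_field d (G t) (u t) w \<and> (\<forall>j<d. \<forall>x. ((\<lambda>s. u s j x) has_real_derivative w j x) (at t))"
        proof (rule exI[of _ "\<lambda>j x. C * kdv_field 2 d (u t) (int j) x"], intro conjI allI impI)
        show "pentagram_limit_field d (G t) (u t) (\<lambda>j x. C * kdv_field 2 d (u t) (int j) x)"
          using field[OF bspec[OF curves t]] by blast
        fix j x assume j: "j < d"
        have Ct: "C * t / C = t" for t using C by simp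
        have "C * t \<in> {C * a<..<C * b}" using range[of "C * t"] t unfolding Ct by blast
        then have "((\<lambda>s. kdv_operator d (u (s / C)) (int j) x) has_real_derivative kdv_field 2 d (u (C * t / C)) (int j) x) (at (C * t))"
          using K unfolding kdv_flow_def by blast
        moreover have "kdv_operator d v (int j) = v j" for v using j by (simp add: kdv_operator_nat)
        ultimately have 1: "((\<lambda>s. u (s / C) j x) has_real_derivative kdv_field 2 d (u t) (int j) x) (at (C * t))"
          by (simp only: Ct)
        have 2: "((\<lambda>s. C * s) has_real_derivative C) (at t)" using DERIV_cmult_Id by blast
        have "((\<lambda>s. u (C * s / C) j x) has_real_derivative kdv_field 2 d (u t) (int j) x * C) (at t)"
          by (rule DERIV_chain2[OF 1 2])
        then show "((\<lambda>s. u s j x) has_real_derivative C * kdv_field 2 d (u t) (int j) x) (at t)"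
          using C by (simp add: mult.commute)
        qed
      qed
    qed
  qed
  show ?thesis using C field flow by blast
qed

end
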